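(* Let $H$ be a fixed graph with $h$ vertices. If $G=(V,E)$ is a graph with $n$ vertices and $w : E \rightarrow \mathbb{R}$ is a weight function, then an induced $H$-subgraph of $G$ of maximum weight (if one exists) can be found in $O(n^h/\log n)$ time.
   Context: The weight of a subgraph is the sum of the weights of its edges. Computation is in the addition-comparison model: real numbers may only be added and compared.
   Formalization: The cases h = 0 and h = 2 are excluded, since the claim fails there: for h = 2 one must read all of the order n^2 edge weights (or adjacency matrix entries) of a complete graph, and for h = 0 the bound 1/log n falls below one step. *)

theory Defs
  imports Complex_Main "HOL-Library.Landau_Symbols"
begin

section \<open>Graphs\<close>

datatype 'a graph = Graph (verts: "'a set") (edges: "'a set set")

definition simple_graph :: "'a graph \<Rightarrow> bool" where
  "simple_graph G \<longleftrightarrow> finite (verts G) \<and> (\<forall>e\<in>edges G. e \<subseteq> verts G \<and> card e = 2)"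

definition graph_isomorphic :: "'a graph \<Rightarrow> 'b graph \<Rightarrow> bool" where
  "graph_isomorphic G H \<longleftrightarrow>
     (\<exists>f. bij_betw f (verts G) (verts H) \<and>
          (\<forall>u\<in>verts G. \<forall>v\<in>verts G. {u, v} \<in> edges G \<longleftrightarrow> {f u, f v} \<in> edges H))"

definition induced_subgraph :: "'a graph \<Rightarrow> 'a set \<Rightarrow> 'a graph" where
  "induced_subgraph G S = Graph S {e \<in> edges G. e \<subseteq> S}"

definition induced_H_subgraph :: "'b graph \<Rightarrow> 'a graph \<Rightarrow> 'a graph \<Rightarrow> bool" where
  "induced_H_subgraph H G K \<longleftrightarrow>
     (\<exists>S\<subseteq>verts G. K = induced_subgraph G S) \<and> graph_isomorphic K H"

definition weight :: "('a set \<Rightarrow> real) \<Rightarrow> 'a graph \<Rightarrow> real" where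
  "weight w K = (\<Sum>e\<in>edges K. w e)"

definition max_induced_H_subgraph ::
    "'b graph \<Rightarrow> 'a graph \<Rightarrow> ('a set \<Rightarrow> real) \<Rightarrow> 'a graph \<Rightarrow> bool" where
  "max_induced_H_subgraph H G w K \<longleftrightarrow>
     induced_H_subgraph H G K \<and>
     (\<forall>K'. induced_H_subgraph H G K' \<longrightarrow> weight w K' \<le> weight w K)"

section \<open>The addition-comparison random access machine\<close>

text \<open>
  Programs are structured RAM programs. The store consists of unbounded, randomly accessible
  arrays of words (natural numbers) and of reals. A program mentions only finitely many array
  names, so this is a RAM memory divided into finitely many regions; a scalar variable is an
  array that is only used at index 0. There are no real constants: reals enter a computation
  only through the input (and as the 0 in untouched cells), and the only operations on them are
  copying, addition and comparison.
\<close>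

type_synonym aname = string

datatype wexp =
    WConst nat
  | WRead aname wexp
  | WAdd wexp wexp
  | WSub wexp wexp
  | WMul wexp wexp
  | WDiv wexp wexp
  | WMod wexp wexp

datatype rexp =
    RRead aname wexp
  | RAdd rexp rexp

datatype bexp =
    WLe wexp wexp
  | RLe rexp rexp
  | BNot bexp
  | BAnd bexp bexp

datatype com =
    Skip
  | WWrite aname wexp wexp
  | RWrite aname wexp rexp
  | Seq com com
  | Cond bexp com com
  | While bexp com

record store =
  words :: "aname \<Rightarrow> nat \<Rightarrow> nat"
  reals :: "aname \<Rightarrow> nat \<Rightarrow> real"

fun wval :: "wexp \<Rightarrow> store \<Rightarrow> nat" where
  "wval (WConst k) s = k"
| "wval (WRead x a) s = words s x (wval a s)"
| "wval (WAdd a b) s = wval a s + wval b s"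
| "wval (WSub a b) s = wval a s - wval b s"
| "wval (WMul a b) s = wval a s * wval b s"
| "wval (WDiv a b) s = wval a s div wval b s"
| "wval (WMod a b) s = wval a s mod wval b s"

fun rval :: "rexp \<Rightarrow> store \<Rightarrow> real" where
  "rval (RRead x a) s = reals s x (wval a s)"
| "rval (RAdd p q) s = rval p s + rval q s"

fun bval :: "bexp \<Rightarrow> store \<Rightarrow> bool" where
  "bval (WLe a b) s \<longleftrightarrow> wval a s \<le> wval b s"
| "bval (RLe p q) s \<longleftrightarrow> rval p s \<le> rval q s"
| "bval (BNot b) s \<longleftrightarrow> \<not> bval b s"
| "bval (BAnd b c) s \<longleftrightarrow> bval b s \<and> bval c s"

text \<open>Unit cost for every constant, memory access, operation and comparison.\<close>

fun wcost :: "wexp \<Rightarrow> nat" where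
  "wcost (WConst k) = 1"
| "wcost (WRead x a) = 1 + wcost a"
| "wcost (WAdd a b) = 1 + wcost a + wcost b"
| "wcost (WSub a b) = 1 + wcost a + wcost b"
| "wcost (WMul a b) = 1 + wcost a + wcost b"
| "wcost (WDiv a b) = 1 + wcost a + wcost b"
| "wcost (WMod a b) = 1 + wcost a + wcost b"

fun rcost :: "rexp \<Rightarrow> nat" where
  "rcost (RRead x a) = 1 + wcost a"
| "rcost (RAdd p q) = 1 + rcost p + rcost q"

fun bcost :: "bexp \<Rightarrow> nat" where
  "bcost (WLe a b) = 1 + wcost a + wcost b"
| "bcost (RLe p q) = 1 + rcost p + rcost q"
| "bcost (BNot b) = 1 + bcost b"
| "bcost (BAnd b c) = 1 + bcost b + bcost c"

definition write_word :: "aname \<Rightarrow> nat \<Rightarrow> nat \<Rightarrow> store \<Rightarrow> store" where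
  "write_word x i v s = s\<lparr>words := (words s)(x := (words s x)(i := v))\<rparr>"

definition write_real :: "aname \<Rightarrow> nat \<Rightarrow> real \<Rightarrow> store \<Rightarrow> store" where
  "write_real x i v s = s\<lparr>reals := (reals s)(x := (reals s x)(i := v))\<rparr>"

text \<open>
  \<open>exec B c s t s'\<close>: started in \<open>s\<close>, the program \<open>c\<close> terminates in \<open>s'\<close> after \<open>t\<close> steps, and all
  words it writes are less than \<open>B\<close>; a program that attempts to write a larger word has no
  execution. With \<open>B\<close> polynomial in the input size \<open>n\<close> this is the usual restriction to words of
  \<open>O(log n)\<close> bits. Intermediate values and addresses then have \<open>O(log n)\<close> bits as well, because
  the expressions of a program have fixed size.
\<close>

inductive exec :: "nat \<Rightarrow> com \<Rightarrow> store \<Rightarrow> nat \<Rightarrow> store \<Rightarrow> bool" for B :: nat where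
  Skip: "exec B Skip s 1 s"
| WWrite: "wval e s < B \<Longrightarrow>
    exec B (WWrite x a e) s (1 + wcost a + wcost e) (write_word x (wval a s) (wval e s) s)"
| RWrite:
    "exec B (RWrite x a e) s (1 + wcost a + rcost e) (write_real x (wval a s) (rval e s) s)"
| Seq: "exec B c s t s' \<Longrightarrow> exec B d s' u s'' \<Longrightarrow> exec B (Seq c d) s (t + u) s''"
| CondTrue: "bval b s \<Longrightarrow> exec B c s t s' \<Longrightarrow> exec B (Cond b c d) s (1 + bcost b + t) s'"
| CondFalse: "\<not> bval b s \<Longrightarrow> exec B d s t s' \<Longrightarrow> exec B (Cond b c d) s (1 + bcost b + t) s'"
| WhileFalse: "\<not> bval b s \<Longrightarrow> exec B (While b c) s (1 + bcost b) s"
| WhileTrue: "bval b s \<Longrightarrow> exec B c s t s' \<Longrightarrow> exec B (While b c) s' u s'' \<Longrightarrow>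
    exec B (While b c) s (1 + bcost b + t + u) s''"

inductive_cases SkipE: "exec B Skip s t s'"
inductive_cases WWriteE: "exec B (WWrite x a e) s t s'"
inductive_cases RWriteE: "exec B (RWrite x a e) s t s'"
inductive_cases SeqE: "exec B (Seq c d) s t s'"
inductive_cases CondE: "exec B (Cond b c d) s t s'"
inductive_cases WhileE: "exec B (While b c) s t s'"

text \<open>Hence it does not matter that correctness and running time are stated for some execution.\<close>

lemma exec_deterministic:
  "exec B c s t s' \<Longrightarrow> exec B c s u s'' \<Longrightarrow> u = t \<and> s'' = s'"
proof (induction arbitrary: u s'' rule: exec.induct)
  case (Skip s)
  then show ?case by (rule SkipE) simp
next
  case (WWrite e s x a)
  from WWrite.prems show ?case by (rule WWriteE) simp
next
  case (RWrite x a e s)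
  then show ?case by (rule RWriteE) simp
next
  case (Seq c s t s1 d v s2)
  from Seq.prems show ?case
    by (rule SeqE) (metis Seq.IH)
next
  case (CondTrue b s c t s1 d)
  from CondTrue.prems show ?case
    by (rule CondE) (metis CondTrue.IH CondTrue.hyps(1) plus_1_eq_Suc add_Suc)+
next
  case (CondFalse b s d t s1 c)
  from CondFalse.prems show ?case
    by (rule CondE) (metis CondFalse.IH CondFalse.hyps(1) plus_1_eq_Suc add_Suc)+
next
  case (WhileFalse b s c)
  from WhileFalse.prems show ?case
    by (rule WhileE) (simp_all add: WhileFalse.hyps)
next
  case (WhileTrue b s c t s1 v s2)
  from WhileTrue.prems show ?case
    by (rule WhileE) (metis WhileTrue.IH WhileTrue.hyps(1) plus_1_eq_Suc add_Suc)+
qed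

section \<open>Input and output\<close>

text \<open>
  A graph with vertex set \<open>{..<n}\<close> is given by its order, its adjacency matrix and its matrix of
  edge weights (with 0 for non-edges), both stored row by row. All other cells contain 0.
\<close>

definition input :: "nat \<Rightarrow> nat graph \<Rightarrow> (nat set \<Rightarrow> real) \<Rightarrow> store" where
  "input n G w = \<lparr>
     words = (\<lambda>x a.
       if x = ''n'' \<and> a = 0 then n
       else if x = ''adj'' \<and> a < n * n \<and> {a div n, a mod n} \<in> edges G then 1
       else 0),
     reals = (\<lambda>x a.
       if x = ''w'' \<and> a < n * n \<and> {a div n, a mod n} \<in> edges G then w {a div n, a mod n}
       else 0)\<rparr>"

text \<open>
  An induced subgraph is reported by listing its vertices in \<open>''out''\<close>; the word \<open>''found''\<close> tells
  whether there is one.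
\<close>

definition output_correct ::
    "'b graph \<Rightarrow> nat graph \<Rightarrow> (nat set \<Rightarrow> real) \<Rightarrow> store \<Rightarrow> bool" where
  "output_correct H G w s \<longleftrightarrow>
     (if \<exists>K. induced_H_subgraph H G K
      then words s ''found'' 0 = 1 \<and>
           max_induced_H_subgraph H G w
             (induced_subgraph G (words s ''out'' ` {..<card (verts H)}))
      else words s ''found'' 0 = 0)"

end

theory Submission imports Defs "HOL-Library.Multiset" begin

text \<open>
  Fix a labelling of \<open>H\<close> and search for the tuples \<open>u\<close> of \<open>h\<close> vertices that induce it. After the choice
  of \<open>u 3, \<dots>, u (h - 1)\<close> the weight is a sum \<open>A (u 0) (u 1) + B (u 1) (u 2) + C (u 0) (u 2)\<close>, so it remains
  to find the best \<open>u 1\<close> for all \<open>u 0\<close> and \<open>u 2\<close>, a (max,+) product, in time \<open>O(n\<^sup>3 / log n)\<close>.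

  The middle indices are cut into blocks of length \<open>d\<close>, a small multiple of \<open>log n\<close>. By Fredman's trick,
  \<open>A i b + B b k \<ge> A i t + B t k\<close> compares the key \<open>A i b - A i t\<close> of a row with the key
  \<open>B t k - B b k\<close> of a column. Sort the keys of the rows and columns together and bisect the order
  recursively: in each dyadic block the rows of the upper half and the columns of the lower half form a
  problem in which \<open>b\<close> survives, and the rows of the lower half and the columns of the upper half one in
  which \<open>t\<close> survives. Every pair \<open>(i, k)\<close> lies in exactly one of these problems, and after \<open>d\<close> rounds each
  problem knows its best middle index. The problems have total size \<open>c\<^sup>d n\<^sup>1\<^sup>+\<^sup>\<epsilon>\<close>, which is \<open>o(n\<^sup>2)\<close>
  for small \<open>d\<close>, so a block costs \<open>O(n\<^sup>2)\<close> for the enumeration of the pairs, and there are \<open>n / d\<close> blocks.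
\<close>

section \<open>Executing programs\<close>

text \<open>An entry of the matrices is not one real number. A tuple is admissible only if all its
  pairs are mapped correctly and no vertex is repeated, and the machine offers neither real
  constants nor an infinite penalty to express this. Each entry is therefore a word, counting
  correct pairs, together with a real weight, and the two are compared lexicographically. An
  admissible tuple has the largest possible count, so maximising over the middle index never trades
  it for an inadmissible one. Subtraction of reals is missing as well: keys are never computed, and
  a comparison of two keys is rearranged into a comparison of two sums of four entries. Inside the
  proof count and weight are fused into a single real function \<open>V\<close>, which makes
  ordinary inequalities available. Bisection is what saves the logarithm: the rounds of a block work
  on records, of which there are few, and each pair is touched only once per block, after all of its
  indices have been compared.\<close>

text \<open>The equations for \<open>run\<close> below hold because execution is deterministic; as rewrite rules they
  execute loop-free programs symbolically.\<close>

definition run :: "nat \<Rightarrow> com \<Rightarrow> (nat \<Rightarrow> store \<Rightarrow> bool) \<Rightarrow> store \<Rightarrow> bool" where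
  "run B c Q s \<longleftrightarrow> (\<exists>t s'. exec B c s t s' \<and> Q t s')"

lemma run_Skip [simp]: "run B Skip Q s \<longleftrightarrow> Q 1 s"
  unfolding run_def by (metis SkipE exec.Skip)

lemma run_WWrite [simp]:
  "run B (WWrite x a e) Q s \<longleftrightarrow>
     wval e s < B \<and> Q (1 + wcost a + wcost e) (write_word x (wval a s) (wval e s) s)"
  unfolding run_def by (metis WWriteE exec.WWrite)

lemma run_RWrite [simp]:
  "run B (RWrite x a e) Q s \<longleftrightarrow>
     Q (1 + wcost a + rcost e) (write_real x (wval a s) (rval e s) s)"
  unfolding run_def by (metis RWriteE exec.RWrite)

lemma run_Seq [simp]:
  "run B (Seq c d) Q s \<longleftrightarrow> run B c (\<lambda>t. run B d (\<lambda>u. Q (t + u))) s"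
  unfolding run_def by (fast elim: SeqE intro: exec.Seq)

lemma run_Cond [simp]:
  "run B (Cond b c d) Q s \<longleftrightarrow>
     (if bval b s then run B c (\<lambda>t. Q (1 + bcost b + t)) s
      else run B d (\<lambda>t. Q (1 + bcost b + t)) s)"
  unfolding run_def by (cases "bval b s") (simp_all, (metis CondE exec.CondTrue exec.CondFalse plus_1_eq_Suc add_Suc)+)

lemma run_mono: "run B c Q s \<Longrightarrow> (\<And>t s'. Q t s' \<Longrightarrow> Q' t s') \<Longrightarrow> run B c Q' s"
  unfolding run_def by blast

section \<open>Frame conditions and the rule for counted loops\<close>

fun wmod :: "com \<Rightarrow> aname set" where
  "wmod Skip = {}"
| "wmod (WWrite x a e) = {x}"
| "wmod (RWrite x a e) = {}"
| "wmod (Seq c d) = wmod c \<union> wmod d"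
| "wmod (Cond b c d) = wmod c \<union> wmod d"
| "wmod (While b c) = wmod c"

fun rmod :: "com \<Rightarrow> aname set" where
  "rmod Skip = {}"
| "rmod (WWrite x a e) = {}"
| "rmod (RWrite x a e) = {x}"
| "rmod (Seq c d) = rmod c \<union> rmod d"
| "rmod (Cond b c d) = rmod c \<union> rmod d"
| "rmod (While b c) = rmod c"

lemma words_write [simp]:
  "words (write_word x i v s) y = (if y = x then (words s x)(i := v) else words s y)"
  "words (write_real x i r s) = words s"
  by (auto simp: write_word_def write_real_def)

lemma reals_write [simp]:
  "reals (write_real x i r s) y = (if y = x then (reals s x)(i := r) else reals s y)"
  "reals (write_word x i v s) = reals s"
  by (auto simp: write_word_def write_real_def)

text \<open>The frame condition is syntactic: an array outside \<open>wmod c\<close> and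
  \<open>rmod c\<close> cannot change. A loop invariant then only mentions what the loop body
  writes, and facts about the store before the loop remain available.\<close>

definition same_except :: "com \<Rightarrow> store \<Rightarrow> store \<Rightarrow> bool" where
  "same_except c s s' \<longleftrightarrow> (\<forall>x. x \<notin> wmod c \<longrightarrow> words s' x = words s x) \<and>
                         (\<forall>x. x \<notin> rmod c \<longrightarrow> reals s' x = reals s x)"

lemma exec_same_except: "exec B c s t s' \<Longrightarrow> same_except c s s'"
  by (induction rule: exec.induct) (auto simp: same_except_def)

lemma same_except_refl [simp]: "same_except c s s"
  by (simp add: same_except_def)

lemma run_mono_frame:
  "run B c Q s \<Longrightarrow> (\<And>t s'. Q t s' \<Longrightarrow> same_except c s s' \<Longrightarrow> Q' t s') \<Longrightarrow> run B c Q' s"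
  unfolding run_def using exec_same_except by blast

text \<open>The invariant is indexed by the number of completed iterations, which ends at
  \<open>N\<close>; this gives termination. The cost \<open>\<tau> k\<close> may depend on the
  iteration, so that the time of nested loops can be summed instead of being bounded by a
  maximum.\<close>

lemma run_While:
  assumes "I 0 s"
    and step: "\<And>k s'. k < N \<Longrightarrow> I k s' \<Longrightarrow> same_except c s s' \<Longrightarrow>
                 bval b s' \<and> run B c (\<lambda>t s''. t \<le> \<tau> k \<and> I (Suc k) s'') s'"
    and stop: "\<And>s'. I N s' \<Longrightarrow> same_except c s s' \<Longrightarrow> \<not> bval b s'"
  shows "run B (While b c)
           (\<lambda>t s'. t \<le> (\<Sum>k<N. \<tau> k + 1 + bcost b) + 1 + bcost b \<and> I N s' \<and> same_except c s s') s"
proof -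
  have "\<exists>t s''. exec B (While b c) s' t s'' \<and>
          t \<le> (\<Sum>k\<in>{N-m..<N}. \<tau> k + 1 + bcost b) + 1 + bcost b \<and> I N s'' \<and> same_except c s s''"
    if "m \<le> N" "I (N - m) s'" "same_except c s s'" for m s'
    using that
  proof (induction m arbitrary: s')
    case 0
    then show ?case using exec.WhileFalse[OF stop[of s']] by fastforce
  next
    case (Suc m)
    let ?k = "N - Suc m"
    have k: "?k < N" "Suc ?k = N - m" using Suc.prems by auto
    from step[OF k(1) Suc.prems(2,3)] obtain t s1 where
      e: "bval b s'" "exec B c s' t s1" "t \<le> \<tau> ?k" "I (N - m) s1"
      unfolding run_def k(2) by blast
    have "same_except c s s1"
      using Suc.prems(3) exec_same_except[OF e(2)] by (auto simp: same_except_def)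
    then obtain u s2 where u: "exec B (While b c) s1 u s2"
      "u \<le> (\<Sum>k\<in>{N-m..<N}. \<tau> k + 1 + bcost b) + 1 + bcost b" "I N s2" "same_except c s s2"
      using Suc.IH[of s1] Suc.prems(1) e(4) by auto
    have "{?k..<N} = insert ?k {N - m..<N}" using k by auto
    then have "(\<Sum>k\<in>{?k..<N}. \<tau> k + 1 + bcost b) = \<tau> ?k + 1 + bcost b + (\<Sum>k\<in>{N-m..<N}. \<tau> k + 1 + bcost b)"
      using k by simp
    then have "1 + bcost b + t + u \<le> (\<Sum>k\<in>{?k..<N}. \<tau> k + 1 + bcost b) + 1 + bcost b"
      using u(2) e(3) by linarith
    then show ?case
      using exec.WhileTrue[OF e(1,2) u(1)] u by blast
  qed
  from this[of N s] assms(1) show ?thesis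
    unfolding run_def by (simp add: lessThan_atLeast0)
qed

lemma run_While_const:
  assumes "I 0 s"
    and "\<And>k s'. k < N \<Longrightarrow> I k s' \<Longrightarrow> same_except c s s' \<Longrightarrow>
           bval b s' \<and> run B c (\<lambda>t s''. t \<le> \<tau> \<and> I (Suc k) s'') s'"
    and "\<And>s'. I N s' \<Longrightarrow> same_except c s s' \<Longrightarrow> \<not> bval b s'"
    and "\<And>t s'. t \<le> N * (\<tau> + 1 + bcost b) + 1 + bcost b \<Longrightarrow> I N s' \<Longrightarrow> same_except c s s' \<Longrightarrow> Q t s'"
  shows "run B (While b c) Q s"
  by (rule run_mono[OF run_While[where \<tau> = "\<lambda>_. \<tau>" and I = I and N = N]])
     (use assms in auto)

abbreviation Var :: "aname \<Rightarrow> wexp" where "Var x \<equiv> WRead x (WConst 0)"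
abbreviation Arr :: "aname \<Rightarrow> wexp \<Rightarrow> wexp" where "Arr x e \<equiv> WRead x e"
abbreviation set0 :: "aname \<Rightarrow> wexp \<Rightarrow> com" where "set0 x e \<equiv> WWrite x (WConst 0) e"
abbreviation inc :: "aname \<Rightarrow> com" where "inc x \<equiv> WWrite x (WConst 0) (WAdd (Var x) (WConst 1))"
abbreviation WLt :: "wexp \<Rightarrow> wexp \<Rightarrow> bexp" where "WLt a b \<equiv> BNot (WLe b a)"
abbreviation BOr :: "bexp \<Rightarrow> bexp \<Rightarrow> bexp" where "BOr a b \<equiv> BNot (BAnd (BNot a) (BNot b))"
abbreviation WEq :: "wexp \<Rightarrow> wexp \<Rightarrow> bexp" where "WEq a b \<equiv> BAnd (WLe a b) (WLe b a)"
notation Seq (infixr ";;" 60)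

text \<open>The names are opaque constants, so that the simplifier separates two arrays by a stored
  inequality and not by comparing strings.\<close>

definition x_n :: aname where "x_n = ''n''"
definition x_adj :: aname where "x_adj = ''adj''"
definition x_w :: aname where "x_w = ''w''"
definition x_found :: aname where "x_found = ''found''"
definition x_out :: aname where "x_out = ''out''"
definition x_M :: aname where "x_M = ''M''"
definition x_p :: aname where "x_p = ''p''"
definition x_q :: aname where "x_q = ''q''"
definition x_W :: aname where "x_W = ''W''"
definition x_o :: aname where "x_o = ''o''"
definition x_i :: aname where "x_i = ''i''"
definition x_j :: aname where "x_j = ''j''"
definition x_e :: aname where "x_e = ''e''"
definition x_f :: aname where "x_f = ''f''"
definition x_x :: aname where "x_x = ''x''"
definition x_y :: aname where "x_y = ''y''"
definition x_I :: aname where "x_I = ''I''"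
definition x_P :: aname where "x_P = ''P''"
definition x_B :: aname where "x_B = ''B''"
definition x_F :: aname where "x_F = ''F''"
definition x_Ia :: aname where "x_Ia = ''Ia''"
definition x_Pa :: aname where "x_Pa = ''Pa''"
definition x_Ba :: aname where "x_Ba = ''Ba''"
definition x_Fa :: aname where "x_Fa = ''Fa''"
definition x_Ma :: aname where "x_Ma = ''Ma''"
definition x_r :: aname where "x_r = ''r''"
definition x_S :: aname where "x_S = ''S''"
definition x_l :: aname where "x_l = ''l''"
definition x_g :: aname where "x_g = ''g''"
definition x_v :: aname where "x_v = ''v''"
definition x_c :: aname where "x_c = ''c''"
definition x_t :: aname where "x_t = ''t''"
definition x_L :: aname where "x_L = ''L''"
definition x_D :: aname where "x_D = ''D''"
definition x_s :: aname where "x_s = ''s''"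
definition x_z :: aname where "x_z = ''z''"
definition x_u :: aname where "x_u = ''u''"
definition x_gP :: aname where "x_gP = ''gP''"
definition x_gQ :: aname where "x_gQ = ''gQ''"
definition x_gC :: aname where "x_gC = ''gC''"
definition x_rP :: aname where "x_rP = ''rP''"
definition x_rQ :: aname where "x_rQ = ''rQ''"
definition x_rC :: aname where "x_rC = ''rC''"
definition x_best :: aname where "x_best = ''best''"
definition x_hd :: aname where "x_hd = ''hd''"
definition x_nx :: aname where "x_nx = ''nx''"
definition x_a :: aname where "x_a = ''a''"
definition x_d :: aname where "x_d = ''d''"

lemmas name_defs =
  x_n_def x_adj_def x_w_def x_found_def x_out_def x_M_def x_p_def x_q_def x_W_def x_o_def x_i_def x_j_def x_e_def x_f_def x_x_def x_y_def x_I_def x_P_def x_B_def x_F_def x_Ia_def x_Pa_def x_Ba_def x_Fa_def x_Ma_def x_r_def x_S_def x_l_def x_g_def x_v_def x_c_def x_t_def x_L_def x_D_def x_s_def x_z_def x_u_def x_gP_def x_gQ_def x_gC_def x_rP_def x_rQ_def x_rC_def x_best_def x_hd_def x_nx_def x_a_def x_d_def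

lemma names_distinct: "distinct [x_n, x_adj, x_w, x_found, x_out, x_M, x_p, x_q, x_W, x_o, x_i, x_j, x_e, x_f, x_x, x_y, x_I, x_P, x_B, x_F, x_Ia, x_Pa, x_Ba, x_Fa, x_Ma, x_r, x_S, x_l, x_g, x_v, x_c, x_t, x_L, x_D, x_s, x_z, x_u, x_gP, x_gQ, x_gC, x_rP, x_rQ, x_rC, x_best, x_hd, x_nx, x_a, x_d]"
  by (simp add: name_defs)

text \<open>Unfolding \<open>distinct\<close> yields every inequality in one orientation only; the
  reversed list provides the other one.\<close>

lemma names_distinct_rev: "distinct (rev [x_n, x_adj, x_w, x_found, x_out, x_M, x_p, x_q, x_W, x_o, x_i, x_j, x_e, x_f, x_x, x_y, x_I, x_P, x_B, x_F, x_Ia, x_Pa, x_Ba, x_Fa, x_Ma, x_r, x_S, x_l, x_g, x_v, x_c, x_t, x_L, x_D, x_s, x_z, x_u, x_gP, x_gQ, x_gC, x_rP, x_rQ, x_rC, x_best, x_hd, x_nx, x_a, x_d])"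
  by (simp only: distinct_rev names_distinct)

lemmas names_neq [simp] =
  names_distinct[unfolded distinct.simps list.set insert_iff empty_iff de_Morgan_disj simp_thms]
  names_distinct_rev[unfolded rev.simps append.simps distinct.simps list.set insert_iff empty_iff de_Morgan_disj simp_thms]

section \<open>Merge sort\<close>

definition blocks_sorted :: "('b \<Rightarrow> 'b \<Rightarrow> bool) \<Rightarrow> nat \<Rightarrow> (nat \<Rightarrow> 'b) \<Rightarrow> nat \<Rightarrow> bool" where
  "blocks_sorted le W a N \<longleftrightarrow> (\<forall>x y. x \<le> y \<longrightarrow> y < N \<longrightarrow> x div W = y div W \<longrightarrow> le (a x) (a y))"

text \<open>\<open>b\<close> is the start of the current pair of runs, \<open>i\<close> and
  \<open>j\<close> are the read positions in its left and right run, and \<open>k\<close> is the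
  write position. The disjunct \<open>j = b + W\<close> covers a last pair whose right run would
  start beyond \<open>M\<close>. The final clause is the heart: what has been written for this pair
  is at most everything that is still unread.\<close>

definition merging where
  "merging le M W p q k b i j \<longleftrightarrow>
     b mod (2 * W) = 0 \<and> b \<le> i \<and> i \<le> b + W \<and> b + W \<le> j \<and> j \<le> b + 2 * W \<and> k + W = i + (j - b) \<and>
     (j \<le> M \<or> j = b + W) \<and> i \<le> M \<and>
     mset (map q [0..<k]) = mset (map p [0..<i]) + mset (map p [b + W..<j]) \<and>
     (\<forall>y z. b \<le> y \<and> y < k \<and> z < M \<and> (i \<le> z \<and> z < b + W \<or> j \<le> z \<and> z < b + 2 * W) \<longrightarrow> le (q y) (p z))"

text \<open>Totality and transitivity are required on the indices to be sorted only, because the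
  order of records used below is known to be transitive only among actual records.\<close>

locale total_preorder_below =
  fixes le :: "nat \<Rightarrow> nat \<Rightarrow> bool" and M :: nat
  assumes total: "a < M \<Longrightarrow> b < M \<Longrightarrow> le a b \<or> le b a"
    and trans: "a < M \<Longrightarrow> b < M \<Longrightarrow> c < M \<Longrightarrow> le a b \<Longrightarrow> le b c \<Longrightarrow> le a c"
begin

lemma perm_less: "mset (map p [0..<M]) = mset [0..<M] \<Longrightarrow> x < M \<Longrightarrow> p x < M"
proof -
  assume m: "mset (map p [0..<M]) = mset [0..<M]" and "x < M"
  have "set (map p [0..<M]) = {0..<M}"
    using arg_cong[OF m, of set_mset] by (simp del: mset_map mset_upt)
  then show ?thesis using \<open>x < M\<close> by auto
qed

lemma merging_start:
  assumes "k < M" "k mod (2 * W) = 0" "mset (map q [0..<k]) = mset (map p [0..<k])"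
  shows "merging le M W p q k k k (k + W)"
  using assms by (auto simp: merging_def)

lemma merging_end:
  assumes m: "merging le M W p q k b i j" and W: "0 < W" and k: "k = b + 2 * W \<or> k = M"
  shows "mset (map q [0..<k]) = mset (map p [0..<k])"
proof -
  have "mset (map p [0..<i]) + mset (map p [b + W..<j]) = mset (map p [0..<k])"
  \<comment> \<open>An untouched right run forces \<open>k = i\<close>, which lies before
    \<open>b + 2 * W\<close>, so the array ends no later than the left run. Otherwise both runs have
    been used up.\<close>
  proof (cases "j = b + W")
    case True
    then have "k = i" using m W k by (auto simp: merging_def)
    then show ?thesis using True by simp
  next
    case False
    then have "i = b + W" "j = k" using m W k by (auto simp: merging_def)
    then have "[0..<k] = [0..<i] @ [b + W..<j]"
      using m upt_add_eq_append[of 0 "b + W" "j - (b + W)"] by (auto simp: merging_def)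
    then show ?thesis by simp
  qed
  then show ?thesis using m by (simp add: merging_def)
qed

lemma merging_take_left:
  assumes m: "merging le M W p q k b i j" and i: "i < b + W" "i < M"
    and perm: "mset (map p [0..<M]) = mset [0..<M]"
    and s: "blocks_sorted le W p M" and W: "0 < W"
    and c: "j < b + 2 * W \<Longrightarrow> j < M \<Longrightarrow> le (p i) (p j)"
  shows "merging le M W p (q(k := p i)) (Suc k) b (Suc i) j"
proof -
  have "le (p i) (p z)" if "z < M" "Suc i \<le> z \<and> z < b + W \<or> j \<le> z \<and> z < b + 2 * W" for z
    using that(2)
  proof
    assume z: "Suc i \<le> z \<and> z < b + W"
    have "W * (b div W) = b" using m
      by (metis dvd_mult_div_cancel dvd_triv_right merging_def mod_0_imp_dvd dvd_trans)
    then have "i div W = b div W" "z div W = b div W"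
      using z m i W by (auto simp: merging_def intro!: div_nat_eqI)
    then show ?thesis using s that z by (auto simp: blocks_sorted_def)
  next
    assume z: "j \<le> z \<and> z < b + 2 * W"
    have "W * (b div W) = b" using m
      by (metis dvd_mult_div_cancel dvd_triv_right merging_def mod_0_imp_dvd dvd_trans)
    then have "j div W = Suc (b div W)" "z div W = Suc (b div W)"
      using z m W by (auto simp: merging_def intro!: div_nat_eqI)
    then have "le (p j) (p z)" using s that z by (auto simp: blocks_sorted_def)
    moreover have "le (p i) (p j)" using c z that by simp
    ultimately show ?thesis
      using trans[of "p i" "p j" "p z"] perm_less[OF perm] that z i by auto
  qed
  then show ?thesis using m i by (auto simp: merging_def less_Suc_eq)
qed

lemma merging_take_right:
  assumes m: "merging le M W p q k b i j" and j: "j < b + 2 * W" "j < M"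
    and perm: "mset (map p [0..<M]) = mset [0..<M]"
    and s: "blocks_sorted le W p M" and W: "0 < W"
    and c: "i < b + W \<Longrightarrow> i < M \<Longrightarrow> le (p j) (p i)"
  shows "merging le M W p (q(k := p j)) (Suc k) b i (Suc j)"
proof -
  have b: "W * (b div W) = b" using m
    by (metis dvd_mult_div_cancel dvd_triv_right merging_def mod_0_imp_dvd dvd_trans)
  have "le (p j) (p z)" if "z < M" "i \<le> z \<and> z < b + W \<or> Suc j \<le> z \<and> z < b + 2 * W" for z
    using that(2)
  proof
    assume z: "i \<le> z \<and> z < b + W"
    have "i div W = b div W" "z div W = b div W"
      using z m b W by (auto simp: merging_def intro!: div_nat_eqI)
    then have "le (p i) (p z)" using s that z by (auto simp: blocks_sorted_def)
    moreover have "le (p j) (p i)" using c z that by simp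
    ultimately show ?thesis
      using trans[of "p j" "p i" "p z"] perm_less[OF perm] that z j by auto
  next
    assume z: "Suc j \<le> z \<and> z < b + 2 * W"
    have "j div W = Suc (b div W)" "z div W = Suc (b div W)"
      using z m b W by (auto simp: merging_def intro!: div_nat_eqI)
    then show ?thesis using s that z by (auto simp: blocks_sorted_def)
  qed
  then show ?thesis using m j by (auto simp: merging_def less_Suc_eq Suc_diff_le)
qed

lemma blocks_sorted_extend:
  assumes q: "blocks_sorted le (2 * W) q k" and m: "merging le M W p q k b i j" "k < b + 2 * W"
    and z: "z < M" "i \<le> z \<and> z < b + W \<or> j \<le> z \<and> z < b + 2 * W"
    and perm: "mset (map p [0..<M]) = mset [0..<M]" and W: "0 < W"
  shows "blocks_sorted le (2 * W) (q(k := p z)) (Suc k)"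
proof -
  have b: "2 * W * (b div (2 * W)) = b" using m(1)
    by (metis dvd_mult_div_cancel merging_def mod_0_imp_dvd)
  have "b \<le> k" using m(1) by (auto simp: merging_def)
  then have kd: "k div (2 * W) = b div (2 * W)"
    using m b W by (auto simp: merging_def intro!: div_nat_eqI)
  have "le (q x) (p z)" if "x < k" "x div (2 * W) = k div (2 * W)" for x
  proof -
    have "b \<le> x" using that kd b by (metis times_div_less_eq_dividend)
    then show ?thesis using m(1) z that by (auto simp: merging_def)
  qed
  moreover have "le (p z) (p z)" using total[of "p z" "p z"] perm_less[OF perm z(1)] by blast
  ultimately show ?thesis using q by (auto simp: blocks_sorted_def less_Suc_eq)
qed

end

text \<open>One call writes one entry of \<open>x_q\<close>, and the read positions are reset
  whenever the output position is a multiple of \<open>2 * W\<close>; a pass is thus a single loop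
  of \<open>M\<close> iterations. The guards on \<open>x_x\<close> and \<open>x_y\<close> prevent
  loading entries beyond \<open>M\<close>, which may be left over from a longer list.\<close>

definition merge_step :: "bexp \<Rightarrow> com" where
  "merge_step cmp =
     Cond (WEq (WMod (Var x_o) (WMul (WConst 2) (Var x_W))) (WConst 0))
       (set0 x_i (Var x_o) ;; set0 x_e (WAdd (Var x_o) (Var x_W)) ;;
        set0 x_j (Var x_e) ;; set0 x_f (WAdd (Var x_e) (Var x_W)))
       Skip ;;
     Cond (WLt (Var x_i) (Var x_M)) (set0 x_x (Arr x_p (Var x_i))) Skip ;;
     Cond (WLt (Var x_j) (Var x_M)) (set0 x_y (Arr x_p (Var x_j))) Skip ;;
     Cond (BAnd (WLt (Var x_i) (Var x_e))
             (BNot (BAnd (WLt (Var x_j) (Var x_f)) (BAnd (WLt (Var x_j) (Var x_M)) (BNot cmp)))))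
       (WWrite x_q (Var x_o) (Var x_x) ;; inc x_i)
       (WWrite x_q (Var x_o) (Var x_y) ;; inc x_j) ;;
     inc x_o"

definition merge_pass :: "bexp \<Rightarrow> com" where
  "merge_pass cmp =
     set0 x_o (WConst 0) ;;
     While (WLt (Var x_o) (Var x_M)) (merge_step cmp) ;;
     set0 x_o (WConst 0) ;;
     While (WLt (Var x_o) (Var x_M))
       (WWrite x_p (Var x_o) (Arr x_q (Var x_o)) ;; inc x_o) ;;
     set0 x_W (WMul (WConst 2) (Var x_W))"

definition merge_sort :: "bexp \<Rightarrow> com" where
  "merge_sort cmp =
     set0 x_o (WConst 0) ;;
     While (WLt (Var x_o) (Var x_M))
       (WWrite x_p (Var x_o) (Var x_o) ;; inc x_o) ;;
     set0 x_W (WConst 1) ;;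
     While (WLt (Var x_W) (Var x_M)) (merge_pass cmp)"

lemma wmod_merge_sort [simp]:
  "wmod (merge_step cmp) = {x_i, x_e, x_j, x_f, x_x, x_y, x_q, x_o}"
  "wmod (merge_pass cmp) = {x_i, x_e, x_j, x_f, x_x, x_y, x_q, x_o, x_p, x_W}"
  "wmod (merge_sort cmp) = {x_i, x_e, x_j, x_f, x_x, x_y, x_q, x_o, x_p, x_W}"
  "rmod (merge_step cmp) = {}" "rmod (merge_pass cmp) = {}" "rmod (merge_sort cmp) = {}"
  unfolding merge_step_def merge_pass_def merge_sort_def wmod.simps rmod.simps
  by blast+

definition (in total_preorder_below) sort_state where
  "sort_state W k s \<longleftrightarrow> words s x_M 0 = M \<and> words s x_W 0 = W \<and> words s x_o 0 = k \<and>
     mset (map (words s x_p) [0..<M]) = mset [0..<M] \<and> blocks_sorted le W (words s x_p) M \<and>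
     blocks_sorted le (2 * W) (words s x_q) k \<and>
     (if k mod (2 * W) = 0 \<or> k = M
      then mset (map (words s x_q) [0..<k]) = mset (map (words s x_p) [0..<k])
      else words s x_e 0 = k - k mod (2 * W) + W \<and> words s x_f 0 = k - k mod (2 * W) + 2 * W \<and>
        merging le M W (words s x_p) (words s x_q) k (k - k mod (2 * W)) (words s x_i 0) (words s x_j 0))"

text \<open>Quantifying over all stores that differ from \<open>s\<close> only in the arrays of the
  sort makes this condition survive every step of sorting.\<close>

definition compares :: "bexp \<Rightarrow> (nat \<Rightarrow> nat \<Rightarrow> bool) \<Rightarrow> nat \<Rightarrow> store \<Rightarrow> bool" where
  "compares cmp le M s \<longleftrightarrow>
     (\<forall>s'. same_except (merge_sort cmp) s s' \<longrightarrow> words s' x_x 0 < M \<longrightarrow> words s' x_y 0 < M \<longrightarrow>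
       bval cmp s' = le (words s' x_x 0) (words s' x_y 0))"

lemma same_except_write:
  "x \<in> wmod c \<Longrightarrow> same_except c s s' \<Longrightarrow> same_except c s (write_word x i v s')"
  "x \<in> rmod c \<Longrightarrow> same_except c s s' \<Longrightarrow> same_except c s (write_real x i r s')"
  by (auto simp: same_except_def)

lemma comparesD: "compares cmp le M s \<Longrightarrow> same_except (merge_sort cmp) s s' \<Longrightarrow>
    words s' x_x 0 < M \<Longrightarrow> words s' x_y 0 < M \<Longrightarrow>
    bval cmp s' = le (words s' x_x 0) (words s' x_y 0)"
  by (auto simp: compares_def)

lemma compares_same_except:
  "compares cmp le M s \<Longrightarrow> same_except (merge_sort cmp) s s' \<Longrightarrow> compares cmp le M s'"
  unfolding compares_def same_except_def by metis

section \<open>Execution of the sorting program\<close>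

context total_preorder_below begin

lemma run_merge_step:
  assumes st: "sort_state W k s" and k: "k < M" and W: "0 < W" "W < M"
    and B: "4 * M + 1 \<le> B" and cmp: "compares cmp le M s"
  shows "run B (merge_step cmp) (\<lambda>t s'. t \<le> 150 + bcost cmp \<and> sort_state W (Suc k) s') s"
proof -
  define b where "b = k - k mod (2 * W)"
  define p where "p = words s x_p"
  define q where "q = words s x_q"
  have bk: "b \<le> k" "k < b + 2 * W" "b mod (2 * W) = 0"
  proof -
    have "k mod (2 * W) < 2 * W" "k mod (2 * W) \<le> k" using W by auto
    then show "b \<le> k" "k < b + 2 * W" unfolding b_def by linarith+
  qed (simp add: b_def minus_mod_eq_mult_div)
  define i where "i = (if k = b then k else words s x_i 0)"
  define j where "j = (if k = b then k + W else words s x_j 0)"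
  have km: "k mod (2 * W) = 0 \<longleftrightarrow> k = b"
    using mod_less_eq_dividend[of k "2 * W"] unfolding b_def by linarith
  have perm: "mset (map p [0..<M]) = mset [0..<M]" and sp: "blocks_sorted le W p M"
    and sq: "blocks_sorted le (2 * W) q k"
    using st by (auto simp: sort_state_def p_def q_def)
  have m: "merging le M W p q k b i j"
  proof (cases "k = b")
    case True
    then show ?thesis using merging_start[of k W q p] st k bk by (auto simp: sort_state_def p_def q_def i_def j_def)
  next
    case False
    then show ?thesis using st k km by (auto simp: sort_state_def p_def q_def i_def j_def b_def)
  qed
  have pl: "p z < M" if "z < M" for z using perm_less[OF perm that] .
  have next_b: "Suc k - Suc k mod (2 * W) = b" if "Suc k mod (2 * W) \<noteq> 0"
    using that by (simp add: b_def mod_Suc split: if_splits)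
  have next0: "Suc k = b + 2 * W" if "Suc k mod (2 * W) = 0"
    using that bk by (auto simp: b_def mod_Suc split: if_splits)
  have vals: "words s x_M 0 = M" "words s x_W 0 = W" "words s x_o 0 = k" "words s x_p = p"
      "words s x_q = q"
    using st by (auto simp: sort_state_def p_def q_def)
  have run1: "run B (Cond (WEq (WMod (Var x_o) (WMul (WConst 2) (Var x_W))) (WConst 0))
       (set0 x_i (Var x_o) ;; set0 x_e (WAdd (Var x_o) (Var x_W)) ;;
        set0 x_j (Var x_e) ;; set0 x_f (WAdd (Var x_e) (Var x_W)))
       Skip) (\<lambda>t s'. t \<le> 60 \<and> words s' x_i 0 = i \<and> words s' x_j 0 = j \<and> words s' x_e 0 = b + W \<and>
          words s' x_f 0 = b + 2 * W \<and> words s' x_M 0 = M \<and> words s' x_W 0 = W \<and> words s' x_o 0 = k \<and>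
          words s' x_p = p \<and> words s' x_q = q \<and> same_except (merge_sort cmp) s s') s"
  proof (cases "k = b")
    case True
    then show ?thesis using vals km k W B by (simp add: same_except_write i_def j_def mod_eq_0_iff_dvd)
  next
    case False
    then have "words s x_e 0 = b + W" "words s x_f 0 = b + 2 * W"
      using st k km by (auto simp: sort_state_def b_def)
    then show ?thesis using False vals km by (simp add: i_def j_def mod_eq_0_iff_dvd)
  qed
  define L where "L \<longleftrightarrow> i < b + W \<and> \<not> (j < b + 2 * W \<and> j < M \<and> \<not> le (p i) (p j))"
  have L: "i < b + W \<and> i < M \<and> (j < b + 2 * W \<longrightarrow> j < M \<longrightarrow> le (p i) (p j))" if L
    using that m k unfolding L_def by (auto simp: merging_def)
  have R: "j < b + 2 * W \<and> j < M \<and> (i < b + W \<longrightarrow> i < M \<longrightarrow> le (p j) (p i))" if "\<not> L"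
    using that m k bk total[OF pl pl] unfolding L_def by (auto simp: merging_def)
  have next_state: "sort_state W (Suc k) s''"
    if "words s'' x_M 0 = M" "words s'' x_W 0 = W" "words s'' x_o 0 = Suc k" "words s'' x_p = p"
      "words s'' x_e 0 = b + W" "words s'' x_f 0 = b + 2 * W" "words s'' x_q = q(k := p z)"
      "z < M" "i \<le> z \<and> z < b + W \<or> j \<le> z \<and> z < b + 2 * W"
      "merging le M W p (q(k := p z)) (Suc k) b (words s'' x_i 0) (words s'' x_j 0)" for s'' z
    using that merging_end[OF that(10) W(1)] next_b next0 perm sp
      blocks_sorted_extend[OF sq m bk(2) that(8,9) perm W(1)]
    unfolding sort_state_def by (simp del: mset_map mset_upt)
  have bounds: "p i < B" if "i < M" using pl[OF that] B by linarith
  have bounds': "p j < B" if "j < M" using pl[OF that] B by linarith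
  have bounds'': "Suc k < B" "i < M \<Longrightarrow> Suc i < B" "j < M \<Longrightarrow> Suc j < B" using B k by linarith+
  show ?thesis
    unfolding merge_step_def
    apply (subst run_Seq)
    apply (rule run_mono[OF run1])
    apply (elim conjE)
    subgoal for t s'
    proof (cases L)
      case True
      assume s': "t \<le> 60" "words s' x_i 0 = i" "words s' x_j 0 = j" "words s' x_e 0 = b + W"
        "words s' x_f 0 = b + 2 * W" "words s' x_M 0 = M" "words s' x_W 0 = W" "words s' x_o 0 = k"
        "words s' x_p = p" "words s' x_q = q" "same_except (merge_sort cmp) s s'"
      note L = L[OF True]
      have m': "merging le M W p (q(k := p i)) (Suc k) b (Suc i) j"
        using merging_take_left[OF m _ _ perm sp W(1)] L by blast
      then have "i \<le> i \<and> i < b + W" using L by simp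
      then show ?thesis
        using L s' m' bounds bounds' bounds''
        by (cases "j < M"; cases "j < b + 2 * W") (simp_all add: comparesD[OF cmp] same_except_write pl next_state)
    next
      case False
      assume s': "t \<le> 60" "words s' x_i 0 = i" "words s' x_j 0 = j" "words s' x_e 0 = b + W"
        "words s' x_f 0 = b + 2 * W" "words s' x_M 0 = M" "words s' x_W 0 = W" "words s' x_o 0 = k"
        "words s' x_p = p" "words s' x_q = q" "same_except (merge_sort cmp) s s'"
      note R = R[OF False]
      have m': "merging le M W p (q(k := p j)) (Suc k) b i (Suc j)"
        using merging_take_right[OF m _ _ perm sp W(1)] R by blast
      have nle: "i < b + W \<Longrightarrow> \<not> le (p i) (p j)" using False R by (auto simp: L_def)
      have "i < b + W \<Longrightarrow> i < M" using m k by (auto simp: merging_def)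
      then show ?thesis
        using R s' m' bounds bounds' bounds'' nle
        by (cases "i < b + W"; cases "i < M") (simp_all add: comparesD[OF cmp] same_except_write pl next_state)
    qed
    done
qed

lemma run_merge_pass:
  assumes st: "words s x_M 0 = M" "words s x_W 0 = W"
      "mset (map (words s x_p) [0..<M]) = mset [0..<M]" "blocks_sorted le W (words s x_p) M"
    and W: "0 < W" "W < M"
    and B: "4 * M + 1 \<le> B" and cmp: "compares cmp le M s"
  shows "run B (merge_pass cmp) (\<lambda>t s'. t \<le> (200 + bcost cmp) * M + 100 \<and>
     words s' x_M 0 = M \<and> words s' x_W 0 = 2 * W \<and>
      mset (map (words s' x_p) [0..<M]) = mset [0..<M] \<and> blocks_sorted le (2 * W) (words s' x_p) M) s"
  unfolding merge_pass_def
  apply (simp del: mset_map mset_upt)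
  apply (intro conjI)
  subgoal using B by simp
  apply (rule run_While_const[where N = M and I = "sort_state W" and \<tau> = "150 + bcost cmp"])
  subgoal using st by (simp add: sort_state_def blocks_sorted_def)
  subgoal premises prems for k s'
  proof -
    have "same_except (merge_sort cmp) s s'"
      using prems(3) by (auto simp: same_except_def)
    moreover have "words s' x_M 0 = M" "words s' x_o 0 = k"
      using prems(2) by (auto simp: sort_state_def)
    ultimately show ?thesis
      using run_merge_step[OF prems(2,1) W B compares_same_except[OF cmp]] prems(1) by simp
  qed
  subgoal by (simp add: sort_state_def)
  subgoal premises s1 for t s1
  proof -
    have q: "mset (map (words s1 x_q) [0..<M]) = mset [0..<M]"
      "blocks_sorted le (2 * W) (words s1 x_q) M"
      using s1 by (auto simp: sort_state_def)
    have q_less: "words s1 x_q x < M" if "x < M" for x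
      using perm_less[OF q(1) that] .
    show ?thesis
      apply (simp del: mset_map mset_upt)
      apply (intro conjI)
      subgoal using B by simp
      apply (rule run_While_const[where N = M and \<tau> = 20 and
         I = "\<lambda>k s'. words s' x_M 0 = M \<and> words s' x_o 0 = k \<and> words s' x_W 0 = W \<and>
              words s' x_q = words s1 x_q \<and> (\<forall>x < k. words s' x_p x = words s1 x_q x)"])
      subgoal using s1 by (simp add: sort_state_def)
      subgoal for k s'
        using q_less[of k] B by (simp add: less_Suc_eq)
      subgoal by simp
      subgoal premises s2 for u s2
      proof -
        have "map (words s2 x_p) [0..<M] = map (words s1 x_q) [0..<M]"
          using s2 by simp
        then have "mset (map (words s2 x_p) [0..<M]) = mset [0..<M]"
          using q(1) by metis
        moreover have "blocks_sorted le (2 * W) (words s2 x_p) M"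
          using s2 q(2) by (auto simp: blocks_sorted_def)
        ultimately show ?thesis
          using s1(1) s2(1,2) W B q(1) by (simp del: mset_map mset_upt add: algebra_simps)
      qed
      done
  qed
  done

lemma run_merge_sort:
  assumes M: "words s x_M 0 = M" "M \<le> 2 ^ L"
    and B: "4 * M + 2 \<le> B" and cmp: "compares cmp le M s"
  shows "run B (merge_sort cmp) (\<lambda>t s'. t \<le> ((200 + bcost cmp) * M + 200) * (L + 1) \<and>
      mset (map (words s' x_p) [0..<M]) = mset [0..<M] \<and>
      (\<forall>x y. x \<le> y \<longrightarrow> y < M \<longrightarrow> le (words s' x_p x) (words s' x_p y))) s"
proof -
  \<comment> \<open>The width doubles from 1 until it reaches \<open>M\<close>, so the number of
    passes is the least such exponent; \<open>L\<close> bounds it.\<close>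
  define N where "N = (LEAST N. M \<le> 2 ^ N)"
  have N1: "M \<le> 2 ^ N" unfolding N_def using M(2) by (rule LeastI)
  have N2: "N \<le> L" unfolding N_def using M(2) by (rule Least_le)
  have N3: "2 ^ k < M" if "k < N" for k
    using not_less_Least[of k "\<lambda>N. M \<le> 2 ^ N"] that by (simp add: N_def not_le)
  note N = N1 N2 N3
  show ?thesis
    unfolding merge_sort_def
    apply (simp del: mset_map mset_upt)
    apply (intro conjI)
    subgoal using B by simp
    apply (rule run_While_const[where N = M and \<tau> = 20 and
         I = "\<lambda>k s'. words s' x_M 0 = M \<and> words s' x_o 0 = k \<and> (\<forall>x < k. words s' x_p x = x)"])
    subgoal using M by simp
    subgoal using B by (simp add: less_Suc_eq)
    subgoal by simp
    subgoal premises s1 for t s1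
    proof -
      have map1: "map (words s1 x_p) [0..<M] = [0..<M]"
        using s1 by (auto intro!: nth_equalityI)
      have sorted1: "blocks_sorted le 1 (words s1 x_p) M"
        using s1 total by (auto simp: blocks_sorted_def)
      have same1: "same_except (merge_sort cmp) s s1"
        using s1(3) by (auto simp: same_except_def)
      show ?thesis
        apply (simp del: mset_map mset_upt)
        apply (intro conjI)
        subgoal using B by simp
        apply (rule run_While_const[where N = N and \<tau> = "(200 + bcost cmp) * M + 100" and
          I = "\<lambda>k s'. words s' x_M 0 = M \<and> words s' x_W 0 = 2 ^ k \<and>
            mset (map (words s' x_p) [0..<M]) = mset [0..<M] \<and> blocks_sorted le (2 ^ k) (words s' x_p) M"])
        subgoal using s1 map1 sorted1 by simp
        subgoal premises prems for k s'
        proof -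
          have "same_except (merge_sort cmp) s s'"
            using prems(3) same1 by (auto simp: same_except_def)
          then show ?thesis
            using run_merge_pass[of s' "2 ^ k" B cmp] N(3)[of k] B compares_same_except[OF cmp, of s'] prems
            by (simp del: mset_map mset_upt)
        qed
        subgoal using N(1) by simp
        subgoal premises s2 for u s2
        proof -
          have "le (words s2 x_p x) (words s2 x_p y)" if "x \<le> y" "y < M" for x y
            using s2(2) that N(1) by (auto simp: blocks_sorted_def)
          moreover have "((200 + bcost cmp) * M + 110) * N \<le> ((200 + bcost cmp) * M + 110) * L"
            using N(2) by simp
          ultimately show ?thesis
            using s1(1) s2(1,2) by (simp del: mset_map mset_upt add: algebra_simps)
        qed
        done
    qed
    done
qed

end

section \<open>Fredman's trick and bisection\<close>

text \<open>\<open>l\<close> is the position of the highest bit in which the binary expansions of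
  \<open>x\<close> and \<open>y\<close> differ: they agree above bit \<open>l\<close> and disagree
  from bit \<open>l\<close> on.\<close>

definition separates :: "nat \<Rightarrow> nat \<Rightarrow> nat \<Rightarrow> bool" where
  "separates l x y \<longleftrightarrow> x div 2 ^ l div 2 = y div 2 ^ l div 2 \<and> x div 2 ^ l \<noteq> y div 2 ^ l"

lemma separates_Suc: "separates l x y \<longleftrightarrow> x div 2 ^ Suc l = y div 2 ^ Suc l \<and> x div 2 ^ l \<noteq> y div 2 ^ l"
  by (simp add: separates_def div_mult2_eq[symmetric] mult.commute)

lemma div_power_eq_mono: "x div 2 ^ l = y div 2 ^ l \<Longrightarrow> l \<le> m \<Longrightarrow> x div 2 ^ m = (y::nat) div 2 ^ m"
  by (metis div_mult2_eq le_add_diff_inverse power_add)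

lemma separates_unique: "separates l x y \<Longrightarrow> separates m x y \<Longrightarrow> l = m"
  unfolding separates_Suc
  by (metis Suc_leI div_power_eq_mono linorder_neqE_nat)

lemma separates_exists:
  assumes "x \<noteq> y" "x < 2 ^ m" "y < 2 ^ m"
  shows "\<exists>l. separates l x y"
proof -
  define N where "N = (LEAST N. x div 2 ^ N = y div 2 ^ N)"
  have "x div 2 ^ m = y div 2 ^ m" using assms by simp
  then have N: "x div 2 ^ N = y div 2 ^ N" unfolding N_def by (rule LeastI)
  then have "N \<noteq> 0" using assms(1) by (intro notI) simp
  then obtain l where l: "N = Suc l" by (cases N) auto
  have "x div 2 ^ l \<noteq> y div 2 ^ l"
    using not_less_Least[of l "\<lambda>N. x div 2 ^ N = y div 2 ^ N"] l by (auto simp: N_def)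
  then show ?thesis using N l separates_Suc by blast
qed

lemma separates_less: "separates l x y \<Longrightarrow> x < 2 ^ m \<Longrightarrow> y < 2 ^ m \<Longrightarrow> l < m"
  unfolding separates_def by (metis div_less div_power_eq_mono not_le)

lemma double_add_mod: "c \<le> 1 \<Longrightarrow> (2 * b + c) mod 2 = (c :: nat)"
  by (cases c) auto

text \<open>
  The items \<open>x < n\<close> are the rows of the first factor of a (max,+) product, the items \<open>n + k\<close> the
  columns of the second factor, and \<open>V i j - V (n + k) j\<close> is the value of the column index \<open>j\<close> for
  the pair \<open>(i, k)\<close>. A record \<open>x\<close> places the item \<open>it x\<close> in the problem \<open>pr x\<close>; \<open>wn x\<close> is the best
  of the indices in \<open>{a..<t}\<close> for every pair of that problem, which has at most \<open>2 ^ lm x\<close> records.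
  Every pair lies in exactly one problem.
\<close>

definition block_inv ::
    "nat \<Rightarrow> (nat \<Rightarrow> nat \<Rightarrow> real) \<Rightarrow> nat \<Rightarrow> nat \<Rightarrow> nat \<Rightarrow> (nat \<Rightarrow> nat) \<Rightarrow> (nat \<Rightarrow> nat) \<Rightarrow> (nat \<Rightarrow> nat) \<Rightarrow> (nat \<Rightarrow> nat) \<Rightarrow> bool"
  where
  "block_inv n V a t M it pr wn lm \<longleftrightarrow>
     (\<forall>x<M. it x < 2 * n \<and> a \<le> wn x \<and> wn x < t) \<and>
     (\<forall>x<M. \<forall>y<M. pr x = pr y \<longrightarrow> wn x = wn y) \<and>
     (\<forall>x<M. card {y. y < M \<and> pr y = pr x} \<le> 2 ^ lm x) \<and>
     (\<forall>i<n. \<forall>k<n. \<exists>x<M. \<exists>y<M. it x = i \<and> it y = n + k \<and> pr x = pr y) \<and>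
     inj_on (\<lambda>(x, y). (it x, it y)) {(x, y). x < M \<and> y < M \<and> it x < n \<and> n \<le> it y \<and> pr x = pr y} \<and>
     (\<forall>x<M. \<forall>y<M. it x < n \<longrightarrow> n \<le> it y \<longrightarrow> pr x = pr y \<longrightarrow>
        (\<forall>j. a \<le> j \<longrightarrow> j < t \<longrightarrow> V (it x) j - V (it y) j \<le> V (it x) (wn x) - V (it y) (wn x)))"

text \<open>With \<open>a\<close> as the only index there is nothing to decide: one problem contains
  all items, its winner is \<open>a\<close>, and its size \<open>2 * n\<close> is at most
  \<open>2 ^ L\<close>.\<close>

lemma block_inv_init:
  assumes L: "2 * n \<le> 2 ^ L" and i: "\<And>x. x < 2 * n \<Longrightarrow> it x = x" "\<And>x. x < 2 * n \<Longrightarrow> pr x = 0"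
    "\<And>x. x < 2 * n \<Longrightarrow> wn x = a" "\<And>x. x < 2 * n \<Longrightarrow> lm x = L"
  shows "block_inv n V a (Suc a) (2 * n) it pr wn lm"
  unfolding block_inv_def
proof (intro conjI)
  show "\<forall>i<n. \<forall>k<n. \<exists>x<2 * n. \<exists>y<2 * n. it x = i \<and> it y = n + k \<and> pr x = pr y"
  proof (intro allI impI)
    fix j k assume "j < n" "k < n"
    then show "\<exists>x<2 * n. \<exists>y<2 * n. it x = j \<and> it y = n + k \<and> pr x = pr y"
      by (intro exI[of _ j] exI[of _ "n + k"] conjI) (simp_all add: i)
  qed
  show "\<forall>x<2 * n. card {y. y < 2 * n \<and> pr y = pr x} \<le> 2 ^ lm x"
  proof (intro allI impI)
    fix x assume "x < 2 * n"
    moreover have "card {y. y < 2 * n \<and> pr y = pr x} \<le> card {..<2 * n}" by (rule card_mono) auto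
    ultimately show "card {y. y < 2 * n \<and> pr y = pr x} \<le> 2 ^ lm x" using L i(4) by simp
  qed
  show "\<forall>x<2 * n. \<forall>y<2 * n. it x < n \<longrightarrow> n \<le> it y \<longrightarrow> pr x = pr y \<longrightarrow>
      (\<forall>j. a \<le> j \<longrightarrow> j < Suc a \<longrightarrow> V (it x) j - V (it y) j \<le> V (it x) (wn x) - V (it y) (wn x))"
  proof (intro allI impI)
    fix x y j assume "x < 2 * n" "a \<le> j" "j < Suc a"
    then have "j = wn x" using i(3) by simp
    then show "V (it x) j - V (it y) j \<le> V (it x) (wn x) - V (it y) (wn x)" by simp
  qed
  show "inj_on (\<lambda>(x, y). (it x, it y)) {(x, y). x < 2 * n \<and> y < 2 * n \<and> it x < n \<and> n \<le> it y \<and> pr x = pr y}"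
    by (rule inj_onI) (use i(1) in auto)
qed (simp_all add: i)

text \<open>Fredman's trick: \<open>wn x\<close> beats \<open>t\<close> for a pair if and only if the key of the column is at most the
  key of the row, and these keys can be sorted together.\<close>

definition record_le ::
    "(nat \<Rightarrow> nat \<Rightarrow> real) \<Rightarrow> nat \<Rightarrow> (nat \<Rightarrow> nat) \<Rightarrow> (nat \<Rightarrow> nat) \<Rightarrow> (nat \<Rightarrow> nat) \<Rightarrow> nat \<Rightarrow> nat \<Rightarrow> bool" where
  "record_le V t it pr wn x y \<longleftrightarrow> pr x < pr y \<or>
     pr x = pr y \<and> V (it x) (wn x) - V (it x) t \<le> V (it y) (wn x) - V (it y) t"

lemma block_invD:
  assumes "block_inv n V a t M it pr wn lm"
  shows "x < M \<Longrightarrow> it x < 2 * n" "x < M \<Longrightarrow> a \<le> wn x" "x < M \<Longrightarrow> wn x < t"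
    "x < M \<Longrightarrow> y < M \<Longrightarrow> pr x = pr y \<Longrightarrow> wn x = wn y"
    "x < M \<Longrightarrow> card {y. y < M \<and> pr y = pr x} \<le> 2 ^ lm x"
    "i < n \<Longrightarrow> k < n \<Longrightarrow> \<exists>x<M. \<exists>y<M. it x = i \<and> it y = n + k \<and> pr x = pr y"
    "inj_on (\<lambda>(x, y). (it x, it y)) {(x, y). x < M \<and> y < M \<and> it x < n \<and> n \<le> it y \<and> pr x = pr y}"
    "x < M \<Longrightarrow> y < M \<Longrightarrow> it x < n \<Longrightarrow> n \<le> it y \<Longrightarrow> pr x = pr y \<Longrightarrow> a \<le> j \<Longrightarrow> j < t \<Longrightarrow>
       V (it x) j - V (it y) j \<le> V (it x) (wn x) - V (it y) (wn x)"
  using assms unfolding block_inv_def by (elim conjE; blast)+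

text \<open>One round, in which the index \<open>t\<close> challenges the winner of every problem.
  Since the problem number is the primary key of the order, each problem occupies an interval of the
  positions sorted by \<open>p\<close>.\<close>

locale phase =
  fixes n :: nat and V :: "nat \<Rightarrow> nat \<Rightarrow> real" and a t M :: nat
    and it pr wn lm p :: "nat \<Rightarrow> nat"
  assumes inv: "block_inv n V a t M it pr wn lm"
    and perm: "bij_betw p {..<M} {..<M}"
    and sorted: "x \<le> y \<Longrightarrow> y < M \<Longrightarrow> record_le V t it pr wn (p x) (p y)"
begin

definition start :: "nat \<Rightarrow> nat" where "start r = (LEAST q. pr (p q) = pr (p r))"
definition half :: "nat \<Rightarrow> nat \<Rightarrow> nat" where "half l r = (r - start r) div 2 ^ l"
text \<open>Within a dyadic block, side 1 joins the rows in the odd half with the columns in the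
  even half: the column precedes the row in the sorted order and the old winner survives. On side 0
  the row precedes the column and \<open>t\<close> wins.\<close>

definition side :: "nat \<Rightarrow> nat \<Rightarrow> nat" where
  "side l r = (if it (p r) < n then half l r mod 2 else 1 - half l r mod 2)"
text \<open>A new problem is numbered by its level \<open>l\<close>, the first position of its block in the sorted order
  and its side. The first position determines the old problem, so the numbers stay small.\<close>
definition new_problem :: "nat \<Rightarrow> nat \<Rightarrow> nat" where
  "new_problem l r = 2 * (l * M + (start r + half l r div 2 * (2 * 2 ^ l))) + side l r"
definition new_winner :: "nat \<Rightarrow> nat \<Rightarrow> nat" where
  "new_winner l r = (if side l r = 1 then wn (p r) else t)"

lemma start: "start r \<le> r" "pr (p (start r)) = pr (p r)"
  unfolding start_def by (auto intro: Least_le LeastI)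

lemma start_eq: "pr (p r) = pr (p s) \<Longrightarrow> start r = start s"
  by (simp add: start_def)

lemma p_less: "r < M \<Longrightarrow> p r < M"
  using perm by (auto simp: bij_betw_def)

lemma pr_mono: "x \<le> y \<Longrightarrow> y < M \<Longrightarrow> pr (p x) \<le> pr (p y)"
  using sorted[of x y] by (auto simp: record_le_def)

lemma pr_between: "start r \<le> q \<Longrightarrow> q \<le> r \<Longrightarrow> r < M \<Longrightarrow> pr (p q) = pr (p r)"
  using pr_mono[of "start r" q] pr_mono[of q r] start(2)[of r] by auto

text \<open>The positions from \<open>start r\<close> to \<open>r\<close> hold distinct records of
  one problem, so its size bounds their number. Offsets within the problem therefore have at most
  \<open>lm x\<close> bits, which is why copies at the levels below \<open>lm x\<close>
  suffice.\<close>

lemma pos_less: assumes "r < M" "x < M" "pr x = pr (p r)" shows "r - start r < 2 ^ lm x"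
proof -
  have "p ` {start r..r} \<subseteq> {y. y < M \<and> pr y = pr (p r)}"
    using assms p_less pr_between by auto
  then have "card (p ` {start r..r}) \<le> card {y. y < M \<and> pr y = pr (p r)}"
    by (intro card_mono) auto
  moreover have "card (p ` {start r..r}) = Suc r - start r"
    using perm assms by (subst card_image) (auto simp: bij_betw_def intro: inj_on_subset)
  moreover have "card {y. y < M \<and> pr y = pr (p r)} \<le> 2 ^ lm x"
    using block_invD(5)[OF inv assms(2)] assms(3) by simp
  ultimately show ?thesis using start(1)[of r] by linarith
qed

lemma side_le: "side l r \<le> 1"
  by (auto simp: side_def)

lemma base_bounds: "start r \<le> start r + half l r div 2 * (2 * 2 ^ l)"
    "start r + half l r div 2 * (2 * 2 ^ l) \<le> r"
    "r < start r + half l r div 2 * (2 * 2 ^ l) + 2 * 2 ^ l"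
proof -
  have d: "half l r div 2 = (r - start r) div (2 * 2 ^ l)"
    by (simp add: half_def div_mult2_eq[symmetric] mult.commute)
  have "(r - start r) div (2 * 2 ^ l) * (2 * 2 ^ l) \<le> r - start r" by simp
  then show "start r + half l r div 2 * (2 * 2 ^ l) \<le> r"
    unfolding d using start(1)[of r] by linarith
  have "(r - start r) mod (2 * 2 ^ l) < 2 * 2 ^ l" by simp
  then have "r - start r < (r - start r) div (2 * 2 ^ l) * (2 * 2 ^ l) + 2 * 2 ^ l"
    using div_mult_mod_eq[of "r - start r" "2 * 2 ^ l"] by (metis add_less_cancel_left)
  then show "r < start r + half l r div 2 * (2 * 2 ^ l) + 2 * 2 ^ l"
    unfolding d using start(1)[of r] by linarith
qed simp

lemma new_problem_less: "r < M \<Longrightarrow> l < m \<Longrightarrow> new_problem l r < 2 * (m * M)"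
proof -
  assume "r < M" "l < m"
  define b where "b = start r + half l r div 2 * (2 * 2 ^ l)"
  have "l * M + b < l * M + M" "l * M + M \<le> m * M"
    using base_bounds(2)[of r l] mult_le_mono1[of "Suc l" m M] \<open>r < M\<close> \<open>l < m\<close> by (auto simp: b_def)
  then have "Suc (l * M + b) \<le> m * M" by linarith
  then have "2 * Suc (l * M + b) \<le> 2 * (m * M)" by (rule mult_le_mono2)
  then show ?thesis using side_le[of l r] unfolding new_problem_def b_def[symmetric] by simp
qed

text \<open>The number is decoded: its parity is the side, and after halving, quotient and remainder
  by \<open>M\<close> are the level and the first position of the block. This position lies between
  \<open>start r\<close> and \<open>r\<close>, hence inside the old problem, and identifies
  it.\<close>

lemma new_problem_eq:
  assumes "new_problem l r = new_problem m s" "r < M" "s < M"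
  shows "l = m" "pr (p r) = pr (p s)" "half l r div 2 = half m s div 2" "side l r = side m s"
    "start r + half l r div 2 * (2 * 2 ^ l) = start s + half m s div 2 * (2 * 2 ^ m)"
proof -
  let ?b = "start r + half l r div 2 * (2 * 2 ^ l)" and ?c = "start s + half m s div 2 * (2 * 2 ^ m)"
  have "new_problem l r mod 2 = side l r" "new_problem m s mod 2 = side m s"
    unfolding new_problem_def by (rule double_add_mod[OF side_le])+
  then show side: "side l r = side m s" using assms by simp
  then have e: "?b + l * M = ?c + m * M" using assms(1) by (simp add: new_problem_def)
  have bc: "?b < M" "?c < M" using base_bounds(2)[of r l] base_bounds(2)[of s m] assms by linarith+
  have "(?b + l * M) div M = l" "(?c + m * M) div M = m" "(?b + l * M) mod M = ?b" "(?c + m * M) mod M = ?c"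
    using bc by simp_all
  then show lm: "l = m" and b: "?b = ?c" using e by simp_all
  have "pr (p ?b) = pr (p r)" "pr (p ?c) = pr (p s)"
    using pr_between[OF base_bounds(1,2)] assms by auto
  then show pr: "pr (p r) = pr (p s)" using b by simp
  show "half l r div 2 = half m s div 2" using b start_eq[OF pr] lm by simp
qed

text \<open>A row and a column of an old problem meet again exactly at the level of the highest bit in which
  their positions differ, on the side that says which of them comes first.\<close>

lemma cross_separates:
  assumes "new_problem l r = new_problem m s" "r < M" "s < M" "it (p r) < n" "n \<le> it (p s)"
  shows "separates l (r - start r) (s - start s)"
proof -
  note e = new_problem_eq[OF assms(1-3)]
  have "half l r mod 2 = 1 - half l s mod 2" using e(1,4) assms by (simp add: side_def)
  then have "half l r \<noteq> half l s" by (metis One_nat_def diff_diff_cancel mod_less_eq_dividend n_not_Suc_n not_mod_2_eq_0_eq_1 diff_zero zero_neq_one diff_self_eq_0)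
  then show ?thesis using e(1,3) by (simp add: separates_def half_def)
qed

lemma new_problem_eqI:
  assumes "pr (p r) = pr (p s)" "separates l (r - start r) (s - start s)"
    "it (p r) < n" "n \<le> it (p s)"
  shows "new_problem l r = new_problem l s"
proof -
  have "half l r div 2 = half l s div 2" "half l r \<noteq> half l s"
    using assms by (auto simp: separates_def half_def)
  moreover from this have "half l r mod 2 = 1 - half l s mod 2"
    by (metis div_mod_decomp not_mod_2_eq_0_eq_1 diff_zero diff_self_eq_0)
  ultimately show ?thesis
    using assms start_eq[OF assms(1)] by (simp add: new_problem_def side_def)
qed

lemma new_winner_best:
  assumes e: "new_problem l r = new_problem m s" and "r < M" "s < M" "it (p r) < n" "n \<le> it (p s)"
    and j: "a \<le> j" "j < Suc t"
  shows "V (it (p r)) j - V (it (p s)) j \<le> V (it (p r)) (new_winner l r) - V (it (p s)) (new_winner l r)"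
proof -
  note d = new_problem_eq[OF assms(1-3)]
  have ne: "half l r \<noteq> half l s" and st: "start r = start s"
    using cross_separates[OF assms(1-5)] start_eq[OF d(2)] by (auto simp: separates_def half_def)
  have old: "V (it (p r)) j' - V (it (p s)) j' \<le> V (it (p r)) (wn (p r)) - V (it (p s)) (wn (p r))"
    if "a \<le> j'" "j' < t" for j'
    using block_invD(8)[OF inv p_less p_less] that assms(2-5) d(2) by blast
  have wn: "wn (p r) = wn (p s)"
    using block_invD(4)[OF inv] p_less assms(2,3) d(2) by blast
  have hd: "half l r div 2 = half l s div 2" using d(1,3) by simp
  have sides: "half l r mod 2 = side l r" "half l s mod 2 = 1 - side l r"
    using d(1,4) assms(4,5) by (auto simp: side_def)
  show ?thesis
  proof (cases "side l r = 1")
    case True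
    \<comment> \<open>Both halves belong to the same block and differ in their last bit, which the
      side determines; this decides which of the two positions comes first.\<close>
    then have "half l s < half l r" using hd sides div_mod_decomp[of "half l r" 2] div_mod_decomp[of "half l s" 2] by simp
    then have "s - start s < r - start r" unfolding half_def by (meson div_le_mono not_le)
    then have "record_le V t it pr wn (p s) (p r)" using st assms(2) by (intro sorted) linarith+
    then have "V (it (p r)) t - V (it (p s)) t \<le> V (it (p r)) (wn (p r)) - V (it (p s)) (wn (p r))"
      using wn d(2) by (simp add: record_le_def)
    then show ?thesis using old[of j] j True by (auto simp: new_winner_def less_Suc_eq)
  next
    case False
    then have "side l r = 0" using side_le[of l r] by linarith
    then have "half l r < half l s" using hd sides div_mod_decomp[of "half l r" 2] div_mod_decomp[of "half l s" 2] by simp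
    then have "r - start r < s - start s" unfolding half_def by (meson div_le_mono not_le)
    then have "record_le V t it pr wn (p r) (p s)" using st assms(3) by (intro sorted) linarith+
    then have "V (it (p r)) (wn (p r)) - V (it (p s)) (wn (p r)) \<le> V (it (p r)) t - V (it (p s)) t"
      using wn d(2) by (simp add: record_le_def)
    then show ?thesis using old[of j] j False by (auto simp: new_winner_def less_Suc_eq)
  qed
qed

text \<open>The record at position \<open>r\<close> gives one copy for every level below its
  exponent. The numbering \<open>\<phi>\<close> of the copies stays arbitrary, so that the
  bookkeeping of the program does not enter.\<close>

lemma block_inv_step:
  fixes it' pr' wn' lm' :: "nat \<Rightarrow> nat" and \<phi> :: "nat \<times> nat \<Rightarrow> nat"
  assumes bij: "bij_betw \<phi> (SIGMA r:{..<M}. {..<lm (p r)}) {..<M'}"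
    and new: "\<And>r l. r < M \<Longrightarrow> l < lm (p r) \<Longrightarrow> it' (\<phi> (r, l)) = it (p r)"
      "\<And>r l. r < M \<Longrightarrow> l < lm (p r) \<Longrightarrow> pr' (\<phi> (r, l)) = new_problem l r"
      "\<And>r l. r < M \<Longrightarrow> l < lm (p r) \<Longrightarrow> wn' (\<phi> (r, l)) = new_winner l r"
      "\<And>r l. r < M \<Longrightarrow> l < lm (p r) \<Longrightarrow> lm' (\<phi> (r, l)) = Suc l"
  shows "block_inv n V a (Suc t) M' it' pr' wn' lm'"
proof -
  have ex: thesis if "x < M'" "\<And>r l. r < M \<Longrightarrow> l < lm (p r) \<Longrightarrow> x = \<phi> (r, l) \<Longrightarrow> thesis" for x thesis
  proof -
    have "x \<in> \<phi> ` (SIGMA r:{..<M}. {..<lm (p r)})" using bij that(1) by (simp add: bij_betw_def)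
    then show ?thesis using that(2) by auto
  qed
  have lt: "\<phi> (r, l) < M'" if "r < M" "l < lm (p r)" for r l
    using bij that by (auto simp: bij_betw_def)
  have p_inj: "r = s" if "p r = p s" "r < M" "s < M" for r s
    using perm that by (auto simp: bij_betw_def inj_on_def)
  have p_surj: "\<exists>r<M. x = p r" if "x < M" for x
  proof -
    have "x \<in> p ` {..<M}" using perm that by (simp add: bij_betw_def)
    then show ?thesis by auto
  qed
  show ?thesis
    unfolding block_inv_def
  proof (intro conjI)
    show "\<forall>x<M'. it' x < 2 * n \<and> a \<le> wn' x \<and> wn' x < Suc t"
    proof (intro allI impI)
      fix x assume "x < M'"
      obtain r l where x: "r < M" "l < lm (p r)" "x = \<phi> (r, l)" by (rule ex[OF \<open>x < M'\<close>])
      have "it (p r) < 2 * n" "a \<le> wn (p r)" "wn (p r) < t"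
        by (rule block_invD(1-3)[OF inv p_less[OF x(1)]])+
      then show "it' x < 2 * n \<and> a \<le> wn' x \<and> wn' x < Suc t"
        using x new by (auto simp: new_winner_def)
    qed
    show "\<forall>x<M'. \<forall>y<M'. pr' x = pr' y \<longrightarrow> wn' x = wn' y"
    proof (intro allI impI)
      fix x y assume "x < M'" "y < M'" and e: "pr' x = pr' y"
      obtain r l where x: "r < M" "l < lm (p r)" "x = \<phi> (r, l)" by (rule ex[OF \<open>x < M'\<close>])
      obtain s m where y: "s < M" "m < lm (p s)" "y = \<phi> (s, m)" by (rule ex[OF \<open>y < M'\<close>])
      have np: "new_problem l r = new_problem m s" using e x y new by simp
      note d = new_problem_eq[OF np x(1) y(1)]
      have "wn (p r) = wn (p s)" using block_invD(4)[OF inv p_less p_less] x(1) y(1) d(2) by blast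
      then show "wn' x = wn' y" using x y new d by (simp add: new_winner_def)
    qed
    show "\<forall>x<M'. card {y. y < M' \<and> pr' y = pr' x} \<le> 2 ^ lm' x"
    proof (intro allI impI)
      fix x assume "x < M'"
      obtain r l where x: "r < M" "l < lm (p r)" "x = \<phi> (r, l)" by (rule ex[OF \<open>x < M'\<close>])
      let ?b = "start r + half l r div 2 * (2 * 2 ^ l)"
      \<comment> \<open>A new problem of level \<open>l\<close> takes at most one copy from each
        position of a dyadic block of length \<open>2 * 2 ^ l\<close>, hence the exponent
        \<open>Suc l\<close>.\<close>
      have "{y. y < M' \<and> pr' y = pr' x} \<subseteq> (\<lambda>s. \<phi> (s, l)) ` {?b..<?b + 2 * 2 ^ l}"
      proof
        fix y assume "y \<in> {y. y < M' \<and> pr' y = pr' x}"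
        then have "y < M'" and yx: "pr' y = pr' x" by simp_all
        obtain s m where y: "s < M" "m < lm (p s)" "y = \<phi> (s, m)" by (rule ex[OF \<open>y < M'\<close>])
        have np: "new_problem l r = new_problem m s" using x y yx new by simp
        note d = new_problem_eq[OF np x(1) y(1)]
        have "s \<in> {?b..<?b + 2 * 2 ^ l}" using base_bounds[of s m] d(1,5) by auto
        then show "y \<in> (\<lambda>s. \<phi> (s, l)) ` {?b..<?b + 2 * 2 ^ l}" using y d(1) by blast
      qed
      then have "card {y. y < M' \<and> pr' y = pr' x} \<le> card {?b..<?b + 2 * 2 ^ l}"
        by (rule surj_card_le[rotated]) simp
      then show "card {y. y < M' \<and> pr' y = pr' x} \<le> 2 ^ lm' x" using new x by simp
    qed
    show "\<forall>i<n. \<forall>k<n. \<exists>x<M'. \<exists>y<M'. it' x = i \<and> it' y = n + k \<and> pr' x = pr' y"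
    proof (intro allI impI)
      fix i k assume ik: "i < n" "k < n"
      then obtain x y where xy: "x < M" "y < M" "it x = i" "it y = n + k" "pr x = pr y"
        using block_invD(6)[OF inv] by blast
      obtain r where r: "r < M" "x = p r" using p_surj[OF xy(1)] by blast
      obtain s where s: "s < M" "y = p s" using p_surj[OF xy(2)] by blast
      have pr: "pr (p r) = pr (p s)" using xy r s by simp
      \<comment> \<open>Equal offsets would mean equal positions, but one position holds a row and
        the other a column.\<close>
      have ne: "r - start r \<noteq> s - start s"
        using start_eq[OF pr] start(1)[of r] start(1)[of s] xy r s ik
        by (metis eq_diff_iff not_add_less1)
      have pos: "r - start r < 2 ^ lm x" "s - start s < 2 ^ lm x" if "x = p r \<or> x = p s" for x
        using that pos_less[OF r(1), of x] pos_less[OF s(1), of x] p_less r(1) s(1) pr by auto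
      obtain l where l: "separates l (r - start r) (s - start s)"
        using separates_exists[OF ne pos[of "p r"]] by blast
      have ll: "l < lm (p r)" "l < lm (p s)"
        using separates_less[OF l pos] by blast+
      have "new_problem l r = new_problem l s"
        using new_problem_eqI[OF pr l] xy r s ik by simp
      then show "\<exists>x<M'. \<exists>y<M'. it' x = i \<and> it' y = n + k \<and> pr' x = pr' y"
        using ll r s xy new lt by (intro exI[of _ "\<phi> (r, l)"] conjI exI[of _ "\<phi> (s, l)"]) auto
    qed
    show "inj_on (\<lambda>(x, y). (it' x, it' y))
        {(x, y). x < M' \<and> y < M' \<and> it' x < n \<and> n \<le> it' y \<and> pr' x = pr' y}"
    proof (rule inj_onI, clarify)
      fix x y x2 y2
      assume a: "x < M'" "y < M'" "it' x < n" "n \<le> it' y" "pr' x = pr' y"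
        "x2 < M'" "y2 < M'" "it' x2 < n" "n \<le> it' y2" "pr' x2 = pr' y2"
        and e: "it' x = it' x2" "it' y = it' y2"
      obtain r l where x: "r < M" "l < lm (p r)" "x = \<phi> (r, l)" by (rule ex[OF a(1)])
      obtain s m where y: "s < M" "m < lm (p s)" "y = \<phi> (s, m)" by (rule ex[OF a(2)])
      obtain r2 l2 where x2: "r2 < M" "l2 < lm (p r2)" "x2 = \<phi> (r2, l2)" by (rule ex[OF a(6)])
      obtain s2 m2 where y2: "s2 < M" "m2 < lm (p s2)" "y2 = \<phi> (s2, m2)" by (rule ex[OF a(7)])
      have np: "new_problem l r = new_problem m s" "new_problem l2 r2 = new_problem m2 s2"
        using a x y x2 y2 new by simp_all
      note d = new_problem_eq[OF np(1) x(1) y(1)] and d2 = new_problem_eq[OF np(2) x2(1) y2(1)]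
      have its: "it (p r) < n" "n \<le> it (p s)" "it (p r2) < n" "n \<le> it (p s2)"
          "it (p r) = it (p r2)" "it (p s) = it (p s2)"
        using a e x y x2 y2 new by simp_all
      have "(p r, p s) = (p r2, p s2)"
      proof (rule inj_onD[of "\<lambda>(x, y). (it x, it y)"])
        show "inj_on (\<lambda>(x, y). (it x, it y)) {(x, y). x < M \<and> y < M \<and> it x < n \<and> n \<le> it y \<and> pr x = pr y}"
          by (rule block_invD(7)[OF inv])
      qed (use its d(2) d2(2) p_less x y x2 y2 in auto)
      then have rs: "r = r2" "s = s2" using p_inj x y x2 y2 by auto
      \<comment> \<open>The old records coincide by the old uniqueness; the level is then determined
        by their positions.\<close>
      have "separates l (r - start r) (s - start s)" "separates l2 (r - start r) (s - start s)"
        using cross_separates[OF np(1)] cross_separates[OF np(2)] x y x2 y2 its rs by auto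
      then have "l = l2" by (rule separates_unique)
      then show "x = x2 \<and> y = y2" using rs x y x2 y2 d(1) d2(1) by simp
    qed
    show "\<forall>x<M'. \<forall>y<M'. it' x < n \<longrightarrow> n \<le> it' y \<longrightarrow> pr' x = pr' y \<longrightarrow>
        (\<forall>j. a \<le> j \<longrightarrow> j < Suc t \<longrightarrow> V (it' x) j - V (it' y) j \<le> V (it' x) (wn' x) - V (it' y) (wn' x))"
    proof (intro allI impI)
      fix x y j assume "x < M'" "y < M'" and e: "it' x < n" "n \<le> it' y" "pr' x = pr' y" and j: "a \<le> j" "j < Suc t"
      obtain r l where x: "r < M" "l < lm (p r)" "x = \<phi> (r, l)" by (rule ex[OF \<open>x < M'\<close>])
      obtain s m where y: "s < M" "m < lm (p s)" "y = \<phi> (s, m)" by (rule ex[OF \<open>y < M'\<close>])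
      from x y show "V (it' x) j - V (it' y) j \<le> V (it' x) (wn' x) - V (it' y) (wn' x)"
        using new_winner_best[of l r m s j] e j new by simp
    qed
  qed
qed

end

text \<open>A record with exponent \<open>l\<close> is replaced by records with exponents \<open>1, \<dots>, l\<close>, which multiplies the
  potential by at most 3. Any base between 1 and 2 would do: it must be below 2 for the number of
  records to stay below \<open>n\<^sup>2\<close>.\<close>

definition potential :: "nat \<Rightarrow> (nat \<Rightarrow> nat) \<Rightarrow> real" where
  "potential M lm = (\<Sum>x<M. (3/2) ^ lm x)"

lemma potential_ge: "real M \<le> potential M lm"
  using sum_mono[of "{..<M}" "\<lambda>_. 1" "\<lambda>x. (3/2::real) ^ lm x"] by (simp add: potential_def)

lemma (in phase) potential_step:
  assumes bij: "bij_betw \<phi> (SIGMA r:{..<M}. {..<lm (p r)}) {..<M'}"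
    and new: "\<And>r l. r < M \<Longrightarrow> l < lm (p r) \<Longrightarrow> lm' (\<phi> (r, l)) = Suc l"
  shows "potential M' lm' \<le> 3 * potential M lm"
proof -
  have geo: "(\<Sum>l<k. (3/2::real) ^ Suc l) \<le> 3 * (3/2) ^ k" for k
  proof -
    have "(\<Sum>l<k. (3/2::real) ^ Suc l) = 3 * (3/2) ^ k - 3" by (induction k) auto
    then show ?thesis by simp
  qed
  have "potential M' lm' = (\<Sum>z\<in>(SIGMA r:{..<M}. {..<lm (p r)}). (3/2) ^ lm' (\<phi> z))"
    unfolding potential_def by (rule sum.reindex_bij_betw[OF bij, symmetric])
  also have "\<dots> = (\<Sum>(r, l)\<in>(SIGMA r:{..<M}. {..<lm (p r)}). (3/2) ^ Suc l)"
    by (rule sum.cong) (auto simp: new)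
  also have "\<dots> = (\<Sum>r<M. \<Sum>l<lm (p r). (3/2) ^ Suc l)"
    by (simp add: sum.Sigma)
  also have "\<dots> \<le> (\<Sum>r<M. 3 * (3/2) ^ lm (p r))"
    by (intro sum_mono geo)
  also have "\<dots> = 3 * (\<Sum>x<M. (3/2) ^ lm x)"
    unfolding sum_distrib_left[symmetric] using sum.reindex_bij_betw[OF perm, of "\<lambda>x. (3/2) ^ lm x"] by simp
  finally show ?thesis by (simp add: potential_def)
qed

section \<open>One phase as a program\<close>

text \<open>This is the numbering in which the program emits the copies: record after record, and
  for each record by increasing level.\<close>

lemma flatten_bij:
  fixes f :: "nat \<Rightarrow> nat"
  shows "bij_betw (\<lambda>(r, l). (\<Sum>q<r. f q) + l) (SIGMA r:{..<M}. {..<f r}) {..<\<Sum>q<M. f q}"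
proof (induction M)
  case 0
  then show ?case by (simp add: bij_betw_def)
next
  case (Suc M)
  have "bij_betw (\<lambda>l. (\<Sum>q<M. f q) + l) {..<f M} {(\<Sum>q<M. f q)..<(\<Sum>q<M. f q) + f M}"
    by (rule bij_betw_byWitness[where f' = "\<lambda>x. x - (\<Sum>q<M. f q)"]) auto
  moreover have "bij_betw snd ({M} \<times> {..<f M}) {..<f M}"
    by (auto simp: bij_betw_def inj_on_def)
  ultimately have "bij_betw ((\<lambda>l. (\<Sum>q<M. f q) + l) \<circ> snd) ({M} \<times> {..<f M})
      {(\<Sum>q<M. f q)..<(\<Sum>q<M. f q) + f M}"
    using bij_betw_trans by blast
  then have "bij_betw (\<lambda>(r, l). (\<Sum>q<r. f q) + l) ({M} \<times> {..<f M})
      {(\<Sum>q<M. f q)..<(\<Sum>q<M. f q) + f M}"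
    by (rule bij_betw_cong[THEN iffD1, rotated]) auto
  moreover have "{..<\<Sum>q<M. f q} \<inter> {(\<Sum>q<M. f q)..<(\<Sum>q<M. f q) + f M} = {}"
    by auto
  ultimately have "bij_betw (\<lambda>(r, l). (\<Sum>q<r. f q) + l) ((SIGMA r:{..<M}. {..<f r}) \<union> {M} \<times> {..<f M})
      ({..<\<Sum>q<M. f q} \<union> {(\<Sum>q<M. f q)..<(\<Sum>q<M. f q) + f M})"
    using bij_betw_combine[OF Suc.IH] by blast
  moreover have "(SIGMA r:{..<M}. {..<f r}) \<union> {M} \<times> {..<f M} = (SIGMA r:{..<Suc M}. {..<f r})"
    by (auto simp: less_Suc_eq)
  moreover have "{..<\<Sum>q<M. f q} \<union> {(\<Sum>q<M. f q)..<(\<Sum>q<M. f q) + f M} = {..<\<Sum>q<Suc M. f q}"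
    by auto
  ultimately show ?case by simp
qed

text \<open>The arrays \<open>I\<close>, \<open>P\<close>, \<open>B\<close>, \<open>F\<close> hold the item, problem, winner and size exponent of each record,
  \<open>p\<close> the sorted order, and \<open>Ia\<close>, \<open>Pa\<close>, \<open>Ba\<close>, \<open>Fa\<close> the records of the next phase.\<close>

definition emit_copy :: com where
  "emit_copy =
     set0 x_v (WDiv (WSub (Var x_r) (Var x_S)) (Var x_g)) ;;
     Cond (WLt (Arr x_I (Var x_x)) (Var x_n))
       (set0 x_c (WMod (Var x_v) (WConst 2)))
       (set0 x_c (WSub (WConst 1) (WMod (Var x_v) (WConst 2)))) ;;
     WWrite x_Ia (Var x_Ma) (Arr x_I (Var x_x)) ;;
     WWrite x_Pa (Var x_Ma)
       (WAdd (WMul (WConst 2) (WAdd (WMul (Var x_l) (Var x_M))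
          (WAdd (Var x_S) (WMul (WDiv (Var x_v) (WConst 2)) (WMul (WConst 2) (Var x_g)))))) (Var x_c)) ;;
     Cond (WEq (Var x_c) (WConst 1))
       (WWrite x_Ba (Var x_Ma) (Arr x_B (Var x_x)))
       (WWrite x_Ba (Var x_Ma) (Var x_t)) ;;
     inc x_l ;;
     WWrite x_Fa (Var x_Ma) (Var x_l) ;;
     inc x_Ma ;;
     set0 x_g (WMul (WConst 2) (Var x_g))"

definition emit_init :: com where
  "emit_init =
     set0 x_x (Arr x_p (Var x_r)) ;;
     Cond (WEq (Arr x_P (Var x_x)) (Arr x_P (Arr x_p (Var x_S)))) Skip (set0 x_S (Var x_r)) ;;
     set0 x_l (WConst 0) ;; set0 x_g (WConst 1)"

definition emit_record :: com where
  "emit_record =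
     emit_init ;;
     While (WLt (Var x_l) (Arr x_F (Var x_x))) emit_copy ;;
     inc x_r"

definition copy_record :: com where
  "copy_record =
     WWrite x_I (Var x_r) (Arr x_Ia (Var x_r)) ;;
     WWrite x_P (Var x_r) (Arr x_Pa (Var x_r)) ;;
     WWrite x_B (Var x_r) (Arr x_Ba (Var x_r)) ;;
     WWrite x_F (Var x_r) (Arr x_Fa (Var x_r)) ;;
     inc x_r"

definition emit_all :: com where
  "emit_all =
     set0 x_Ma (WConst 0) ;; set0 x_S (WConst 0) ;; set0 x_r (WConst 0) ;;
     While (WLt (Var x_r) (Var x_M)) emit_record ;;
     set0 x_r (WConst 0) ;;
     While (WLt (Var x_r) (Var x_Ma)) copy_record ;;
     set0 x_M (Var x_Ma)"

lemmas wmod_emit [simp] =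
  emit_copy_def[THEN arg_cong, of wmod, unfolded wmod.simps Un_insert_left Un_empty_left]
  emit_copy_def[THEN arg_cong, of rmod, unfolded rmod.simps Un_empty_left]
  copy_record_def[THEN arg_cong, of wmod, unfolded wmod.simps Un_insert_left Un_empty_left]
  copy_record_def[THEN arg_cong, of rmod, unfolded rmod.simps Un_empty_left]

lemmas wmod_emit_record [simp] =
  emit_record_def[unfolded emit_init_def, THEN arg_cong, of wmod, unfolded wmod.simps wmod_emit Un_insert_left Un_empty_left]
  emit_record_def[unfolded emit_init_def, THEN arg_cong, of rmod, unfolded rmod.simps wmod_emit Un_empty_left]

lemmas wmod_emit_all [simp] =
  emit_all_def[THEN arg_cong, of wmod, unfolded wmod.simps wmod_emit wmod_emit_record Un_insert_left Un_empty_left]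
  emit_all_def[THEN arg_cong, of rmod, unfolded rmod.simps wmod_emit wmod_emit_record Un_empty_left]

section \<open>Correctness and cost of emitting the records of the next round\<close>

context phase begin

lemma start_Suc: "Suc r < M \<Longrightarrow> start (Suc r) = (if pr (p (Suc r)) = pr (p r) then start r else Suc r)"
proof -
  assume r: "Suc r < M"
  show ?thesis
  proof (cases "pr (p (Suc r)) = pr (p r)")
    case True
    then show ?thesis using start_eq[OF True] by simp
  next
    case False
    have "start (Suc r) = Suc r"
    proof (rule ccontr)
      assume "start (Suc r) \<noteq> Suc r"
      then have "start (Suc r) \<le> r" using start(1)[of "Suc r"] by simp
      then show False using False pr_between[of "Suc r" r] r by simp
    qed
    then show ?thesis using False by simp
  qed
qed

definition offset :: "nat \<Rightarrow> nat" where "offset r = (\<Sum>q<r. lm (p q))"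

lemma offset_simps [simp]: "offset 0 = 0" "offset (Suc r) = offset r + lm (p r)"
  by (simp_all add: offset_def)

lemma offset_bij: "bij_betw (\<lambda>(r, l). offset r + l) (SIGMA r:{..<M}. {..<lm (p r)}) {..<offset M}"
  using flatten_bij[of "\<lambda>q. lm (p q)" M] by (simp add: offset_def)

lemma offset_surj:
  assumes "x < offset M"
  obtains r l where "r < M" "l < lm (p r)" "x = offset r + l"
proof -
  have "x \<in> (\<lambda>(r, l). offset r + l) ` (SIGMA r:{..<M}. {..<lm (p r)})"
    using offset_bij assms by (simp add: bij_betw_def)
  then show thesis using that by auto
qed

lemma offset_less: "r < M \<Longrightarrow> l < lm (p r) \<Longrightarrow> offset r + l < offset M"
  using offset_bij by (auto simp: bij_betw_def)

lemma offset_inj: "offset r + l = offset s + m \<Longrightarrow> r < M \<Longrightarrow> l < lm (p r) \<Longrightarrow> s < M \<Longrightarrow> m < lm (p s) \<Longrightarrow>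
    r = s \<and> l = m"
  using offset_bij by (auto simp: bij_betw_def inj_on_def)

definition emitted :: "nat \<Rightarrow> (nat \<Rightarrow> nat) \<Rightarrow> (nat \<Rightarrow> nat) \<Rightarrow> (nat \<Rightarrow> nat) \<Rightarrow> (nat \<Rightarrow> nat) \<Rightarrow> bool" where
  "emitted m it' pr' wn' lm' \<longleftrightarrow> (\<forall>r l. r < M \<longrightarrow> l < lm (p r) \<longrightarrow> offset r + l < m \<longrightarrow>
     it' (offset r + l) = it (p r) \<and> pr' (offset r + l) = new_problem l r \<and>
     wn' (offset r + l) = new_winner l r \<and> lm' (offset r + l) = Suc l)"

lemma emitted_Suc:
  assumes "emitted m it' pr' wn' lm'" "m = offset r + l" "r < M" "l < lm (p r)"
    "i = it (p r)" "q = new_problem l r" "w = new_winner l r" "k = Suc l"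
  shows "emitted (Suc m) (it'(m := i)) (pr'(m := q)) (wn'(m := w)) (lm'(m := k))"
  unfolding emitted_def
proof (intro allI impI)
  fix s j assume s: "s < M" "j < lm (p s)" "offset s + j < Suc m"
  show "(it'(m := i)) (offset s + j) = it (p s) \<and> (pr'(m := q)) (offset s + j) = new_problem j s \<and>
     (wn'(m := w)) (offset s + j) = new_winner j s \<and> (lm'(m := k)) (offset s + j) = Suc j"
  proof (cases "offset s + j = m")
    case True
    then have "s = r \<and> j = l" using offset_inj s assms by blast
    then show ?thesis using assms True by simp
  next
    case False
    then show ?thesis using assms(1) s by (simp add: emitted_def)
  qed
qed

definition emit_ready :: "nat \<Rightarrow> nat \<Rightarrow> store \<Rightarrow> bool" where
  "emit_ready B L s \<longleftrightarrow> words s x_M 0 = M \<and> words s x_n 0 = n \<and> words s x_t 0 = t \<and>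
     words s x_I = it \<and> words s x_P = pr \<and> words s x_B = wn \<and> words s x_F = lm \<and> words s x_p = p \<and>
     (\<forall>x<M. lm x \<le> L) \<and> 2 * (L * M) \<le> B \<and> 2 ^ L < B \<and> offset M < B \<and> 2 * n \<le> B \<and> t < B \<and> M < B \<and> 2 \<le> B"

lemma emit_ready_same_except:
  "emit_ready B L s \<Longrightarrow> same_except emit_record s s' \<Longrightarrow> emit_ready B L s'"
  by (auto simp: emit_ready_def same_except_def)

lemma run_emit_copy:
  assumes e: "emit_ready B L s" and r: "r < M" "l < lm (p r)"
    and s: "words s x_r 0 = r" "words s x_S 0 = start r" "words s x_x 0 = p r"
      "words s x_l 0 = l" "words s x_g 0 = 2 ^ l" "words s x_Ma 0 = offset r + l"
      "emitted (offset r + l) (words s x_Ia) (words s x_Pa) (words s x_Ba) (words s x_Fa)"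
  shows "run B emit_copy (\<lambda>u s'. u \<le> 100 \<and> words s' x_l 0 = Suc l \<and> words s' x_g 0 = 2 ^ Suc l \<and>
       words s' x_Ma 0 = offset r + Suc l \<and>
       emitted (offset r + Suc l) (words s' x_Ia) (words s' x_Pa) (words s' x_Ba) (words s' x_Fa)) s"
proof -
  note e' = e[unfolded emit_ready_def]
  have pr: "p r < M" using p_less r by simp
  have lL: "l < L" using e' r pr by fastforce
  have "it (p r) < 2 * n" "wn (p r) < t" using block_invD(1,3)[OF inv pr] .
  then have b1: "it (p r) < B" "wn (p r) < B" using e' by linarith+
  have v: "(r - start r) div 2 ^ l = half l r" by (simp add: half_def)
  have "half l r \<le> r" unfolding half_def by (meson diff_le_self div_le_dividend le_trans)
  then have b2: "half l r < B" using r(1) e' by linarith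
  have np: "new_problem l r < B" using new_problem_less[OF r(1) lL] e' by linarith
  have "(2::nat) ^ Suc l \<le> 2 ^ L" using lL by (intro power_increasing) auto
  then have b3: "2 * 2 ^ l < B" "Suc l < B" using e' by (auto intro: le_less_trans less_trans[OF less_exp])
  have bounds: "half l r < B" "half l r mod 2 < B" "Suc 0 - half l r mod 2 < B"
      "it (p r) < B" "new_problem l r < B" "wn (p r) < B" "t < B" "Suc l < B" "2 * 2 ^ l < B"
      "Suc (offset r + l) < B"
    using b1 b2 b3 np e' offset_less[OF r] by auto
  have vals: "words s x_I = it" "words s x_P = pr" "words s x_B = wn" "words s x_n 0 = n"
      "words s x_M 0 = M" "words s x_t 0 = t"
    using e' by auto
  note em = emitted_Suc[OF s(7) refl r refl refl refl refl]
  show ?thesis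
  proof (cases "it (p r) < n")
    case True
    then have side: "half l r mod 2 = side l r" by (simp add: side_def)
    show ?thesis
      unfolding emit_copy_def
      using True bounds em side_le[of l r]
      by (cases "side l r = 1"; cases "side l r = 0") (simp_all add: vals s v side new_problem_def new_winner_def le_Suc_eq)
  next
    case False
    then have side: "Suc 0 - half l r mod 2 = side l r" by (simp add: side_def)
    show ?thesis
      unfolding emit_copy_def
      using False bounds em side_le[of l r]
      by (cases "side l r = 1"; cases "side l r = 0") (simp_all add: vals s v side new_problem_def new_winner_def le_Suc_eq)
  qed
qed

lemma run_emit_record:
  assumes e: "emit_ready B L s" and r: "r < M"
    and s: "words s x_r 0 = r" "words s x_S 0 = (if r = 0 then 0 else start (r - 1))"
      "words s x_Ma 0 = offset r"
      "emitted (offset r) (words s x_Ia) (words s x_Pa) (words s x_Ba) (words s x_Fa)"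
  shows "run B emit_record (\<lambda>u s'. u \<le> 150 * lm (p r) + 100 \<and>
       words s' x_r 0 = Suc r \<and> words s' x_S 0 = start r \<and> words s' x_Ma 0 = offset (Suc r) \<and>
       emitted (offset (Suc r)) (words s' x_Ia) (words s' x_Pa) (words s' x_Ba) (words s' x_Fa)) s"
proof -
  note e' = e[unfolded emit_ready_def]
  have pr: "p r < M" using p_less r by simp
  \<comment> \<open>For \<open>r = 0\<close> the cell \<open>x_S\<close> is 0 and the test compares
    the record with itself, which gives \<open>start 0 = 0\<close>.\<close>
  have S: "start r = (if pr (p r) = pr (p (words s x_S 0)) then words s x_S 0 else r)"
    using start_Suc[of "r - 1"] start[of "r - 1"] start(1)[of 0] s(2) r by (cases r) auto
  have init: "run B emit_init
     (\<lambda>u s'. u \<le> 50 \<and> words s' x_r 0 = r \<and> words s' x_S 0 = start r \<and> words s' x_Ma 0 = offset r \<and>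
       words s' x_x 0 = p r \<and> words s' x_l 0 = 0 \<and> words s' x_g 0 = 1 \<and>
       words s' x_Ia = words s x_Ia \<and> words s' x_Pa = words s x_Pa \<and> words s' x_Ba = words s x_Ba \<and>
       words s' x_Fa = words s x_Fa \<and> same_except emit_record s s') s"
    unfolding emit_init_def using e' s pr r S
    by (cases "pr (p r) = pr (p (words s x_S 0))") (simp_all add: same_except_write)
  show ?thesis
    unfolding emit_record_def
    apply (subst run_Seq)
    apply (rule run_mono[OF init])
    apply (subst run_Seq)
    subgoal premises s1 for u1 s1
      apply (rule run_While_const[where N = "lm (p r)" and \<tau> = 100 and I = "\<lambda>l s'. emit_ready B L s' \<and>
         words s' x_r 0 = r \<and> words s' x_S 0 = start r \<and> words s' x_x 0 = p r \<and>
         words s' x_l 0 = l \<and> words s' x_g 0 = 2 ^ l \<and> words s' x_Ma 0 = offset r + l \<and>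
         emitted (offset r + l) (words s' x_Ia) (words s' x_Pa) (words s' x_Ba) (words s' x_Fa)"])
      subgoal using s1 s(4) e by (auto intro: emit_ready_same_except)
      subgoal premises s2 for l s2
      proof -
        have "run B emit_copy (\<lambda>u s'. u \<le> 100 \<and> words s' x_l 0 = Suc l \<and> words s' x_g 0 = 2 ^ Suc l \<and>
           words s' x_Ma 0 = offset r + Suc l \<and>
           emitted (offset r + Suc l) (words s' x_Ia) (words s' x_Pa) (words s' x_Ba) (words s' x_Fa)) s2"
          using run_emit_copy[of B L s2 r l] s2 r by blast
        then have "run B emit_copy (\<lambda>u s'. u \<le> 100 \<and> emit_ready B L s' \<and>
         words s' x_r 0 = r \<and> words s' x_S 0 = start r \<and> words s' x_x 0 = p r \<and>
         words s' x_l 0 = Suc l \<and> words s' x_g 0 = 2 ^ Suc l \<and> words s' x_Ma 0 = offset r + Suc l \<and>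
         emitted (offset r + Suc l) (words s' x_Ia) (words s' x_Pa) (words s' x_Ba) (words s' x_Fa)) s2"
          by (rule run_mono_frame) (use s2 in \<open>auto simp: emit_ready_def same_except_def\<close>)
        then show ?thesis using s2 by (simp add: emit_ready_def)
      qed
      subgoal by (simp add: emit_ready_def)
      subgoal premises s2 for u2 s2
      proof -
        have "Suc r < B" using r e' by simp
        then show ?thesis using s1(1) s2 by (simp add: algebra_simps)
      qed
      done
    done
qed

lemma run_emit_all:
  assumes e: "emit_ready B L s"
  shows "run B emit_all (\<lambda>u s'. u \<le> 300 * (M + offset M) + 300 \<and>
       words s' x_M 0 = offset M \<and>
       emitted (offset M) (words s' x_I) (words s' x_P) (words s' x_B) (words s' x_F)) s"
proof -
  note e' = e[unfolded emit_ready_def]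
  show ?thesis
    unfolding emit_all_def
    apply simp
    apply (intro conjI)
    subgoal using e' by simp
    \<comment> \<open>The number of copies differs from record to record, so the cost is given per
      iteration; the copies sum to \<open>offset M\<close>.\<close>
    apply (rule run_mono[OF run_While[where N = M and \<tau> = "\<lambda>r. 150 * lm (p r) + 100" and I = "\<lambda>r s'. emit_ready B L s' \<and>
         words s' x_r 0 = r \<and> words s' x_S 0 = (if r = 0 then 0 else start (r - 1)) \<and> words s' x_Ma 0 = offset r \<and>
         emitted (offset r) (words s' x_Ia) (words s' x_Pa) (words s' x_Ba) (words s' x_Fa)"]])
    subgoal using e by (auto simp: emit_ready_def emitted_def)
    subgoal premises s2 for r s2
    proof -
      have "run B emit_record (\<lambda>u s'. u \<le> 150 * lm (p r) + 100 \<and> emit_ready B L s' \<and>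
         words s' x_r 0 = Suc r \<and> words s' x_S 0 = start r \<and> words s' x_Ma 0 = offset (Suc r) \<and>
         emitted (offset (Suc r)) (words s' x_Ia) (words s' x_Pa) (words s' x_Ba) (words s' x_Fa)) s2"
        by (rule run_mono_frame[OF run_emit_record[of B L s2 r]])
           (use s2 emit_ready_same_except in auto)
      then show ?thesis using s2 by (simp add: emit_ready_def)
    qed
    subgoal by (simp add: emit_ready_def)
    subgoal premises s1 for u1 s1
    proof -
      have time1: "u1 \<le> 150 * offset M + 110 * M + 10"
        using s1 by (simp add: sum.distrib offset_def sum_distrib_right algebra_simps)
      have new: "x < offset M \<Longrightarrow> words s1 x_Ia x < B \<and> words s1 x_Pa x < B \<and> words s1 x_Ba x < B \<and> words s1 x_Fa x < B" for x
      proof -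
        assume "x < offset M"
        then obtain r l where x: "r < M" "l < lm (p r)" "x = offset r + l"
          by (rule offset_surj)
        have pr: "p r < M" using p_less x by simp
        have lL: "l < L" using e' x pr by fastforce
        have eB: "2 * n \<le> B" "t < B" "2 ^ L < B" "2 * (L * M) \<le> B" using e' by auto
        have "it (p r) < 2 * n" "wn (p r) < t" using block_invD(1,3)[OF inv pr] .
        then have 1: "it (p r) < B" "new_winner l r < B" using eB by (auto simp: new_winner_def)
        have 2: "new_problem l r < B" using new_problem_less[OF x(1) lL] eB by linarith
        have "Suc l \<le> L" "L < 2 ^ L" using lL by auto
        then have 3: "Suc l < B" using eB by linarith
        have "emitted (offset M) (words s1 x_Ia) (words s1 x_Pa) (words s1 x_Ba) (words s1 x_Fa)"
          using s1 by blast
        then have "words s1 x_Ia x = it (p r)" "words s1 x_Pa x = new_problem l r"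
            "words s1 x_Ba x = new_winner l r" "words s1 x_Fa x = Suc l"
          using x offset_less[OF x(1,2)] by (simp_all add: emitted_def)
        then show ?thesis using 1 2 3 by simp
      qed
      show ?thesis
        apply simp
        apply (intro conjI)
        subgoal using e' by simp
        apply (rule run_While_const[where N = "offset M" and \<tau> = 60 and I = "\<lambda>k s'. words s' x_r 0 = k \<and>
          (\<forall>x<k. words s' x_I x = words s1 x_Ia x \<and> words s' x_P x = words s1 x_Pa x \<and>
             words s' x_B x = words s1 x_Ba x \<and> words s' x_F x = words s1 x_Fa x)"])
        subgoal by simp
        subgoal premises s2 for k s2
        proof -
          have "words s2 x_Ia = words s1 x_Ia" "words s2 x_Pa = words s1 x_Pa"
            "words s2 x_Ba = words s1 x_Ba" "words s2 x_Fa = words s1 x_Fa" "words s2 x_Ma 0 = offset M"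
            using s2(3) s1 by (simp_all add: same_except_def)
          moreover have "Suc k < B" using s2(1) e' by linarith
          ultimately show ?thesis
            using s2(1,2) new[OF s2(1)] unfolding copy_record_def by (simp add: less_Suc_eq)
        qed
        subgoal premises s2 for s2
          using s2 s1 by (simp add: same_except_def)
        subgoal premises s2 for u2 s2
        proof -
          have "emitted (offset M) (words s2 x_I) (words s2 x_P) (words s2 x_B) (words s2 x_F)"
            using s2(2) s1 offset_less by (simp add: emitted_def)
          moreover have "words s2 x_Ma 0 = offset M"
            using s2(3) s1 by (simp add: same_except_def)
          ultimately show ?thesis
            using s2(1) time1 e' by simp
        qed
        done
    qed
    done
qed

text \<open>The number of copies has to be bounded by the old exponents before the emission runs,
  because a program that writes a counter too large for a word has no execution. The potential
  absorbs it since \<open>k <= 3 * (3/2) ^ k\<close>.\<close>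

lemma offset_le: "real (offset M) \<le> 3 * potential M lm"
proof -
  have "real k \<le> 3 * (3/2) ^ k" for k
  proof (induction k)
    case (Suc k)
    have "1 \<le> (3/2::real) ^ k" by (rule one_le_power) simp
    then show ?case using Suc.IH unfolding power_Suc of_nat_Suc by linarith
  qed simp
  then have "real (offset M) \<le> (\<Sum>r<M. 3 * (3/2) ^ lm (p r))"
    unfolding offset_def of_nat_sum by (rule sum_mono)
  also have "\<dots> = 3 * potential M lm"
    unfolding sum_distrib_left[symmetric] potential_def
    using sum.reindex_bij_betw[OF perm, of "\<lambda>x. (3/2) ^ lm x"] by simp
  finally show ?thesis .
qed

lemma emitted_inv:
  assumes "emitted (offset M) it' pr' wn' lm'" and L: "\<And>x. x < M \<Longrightarrow> lm x \<le> L"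
  shows "block_inv n V a (Suc t) (offset M) it' pr' wn' lm'"
    and "potential (offset M) lm' \<le> 3 * potential M lm"
    and "x < offset M \<Longrightarrow> lm' x \<le> L"
proof -
  have new: "it' (offset r + l) = it (p r)" "pr' (offset r + l) = new_problem l r"
      "wn' (offset r + l) = new_winner l r" "lm' (offset r + l) = Suc l" if "r < M" "l < lm (p r)" for r l
    using assms(1) offset_less[OF that] that by (auto simp: emitted_def)
  show "block_inv n V a (Suc t) (offset M) it' pr' wn' lm'"
    by (rule block_inv_step[OF offset_bij]) (simp_all add: new)
  show "potential (offset M) lm' \<le> 3 * potential M lm"
    by (rule potential_step[OF offset_bij]) (simp add: new)
  show "lm' x \<le> L" if "x < offset M"
    using that
  proof (rule offset_surj)
    fix r l assume "r < M" "l < lm (p r)" "x = offset r + l"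
    then show "lm' x \<le> L" using new L[of "p r"] p_less by simp
  qed
qed

end

section \<open>A block of columns\<close>

definition cell :: "wexp \<Rightarrow> wexp \<Rightarrow> wexp" where
  "cell x j = WAdd (WMul (Arr x_I x) (Var x_n)) j"

text \<open>Rows are to have their entries in \<open>x_gP\<close> and zeros in \<open>x_gQ\<close>,
  columns the other way round, in a common table of \<open>2 * n\<close> rows of length
  \<open>n\<close>. One formula then compares two rows, two columns, or a row with a column.\<close>

definition cross_word :: "wexp \<Rightarrow> wexp \<Rightarrow> wexp \<Rightarrow> wexp \<Rightarrow> wexp" where
  "cross_word x y b t = WAdd (WAdd (Arr x_gP (cell x b)) (Arr x_gQ (cell x t)))
     (WAdd (Arr x_gP (cell y t)) (Arr x_gQ (cell y b)))"

definition cross_real :: "wexp \<Rightarrow> wexp \<Rightarrow> wexp \<Rightarrow> wexp \<Rightarrow> rexp" where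
  "cross_real x y b t = RAdd (RAdd (RRead x_rP (cell x b)) (RRead x_rQ (cell x t)))
     (RAdd (RRead x_rP (cell y t)) (RRead x_rQ (cell y b)))"

definition record_cmp :: bexp where
  "record_cmp =
     (let x = Var x_x; y = Var x_y; b = Arr x_B x; t = Var x_t in
      BOr (WLt (Arr x_P x) (Arr x_P y))
        (BAnd (WEq (Arr x_P x) (Arr x_P y))
          (BOr (WLt (cross_word x y b t) (cross_word y x b t))
            (BAnd (WEq (cross_word x y b t) (cross_word y x b t))
              (RLe (cross_real x y b t) (cross_real y x b t))))))"

definition phase_com :: com where
  "phase_com = merge_sort record_cmp ;; emit_all ;; inc x_t"

definition init_records :: com where
  "init_records =
     set0 x_M (WMul (WConst 2) (Var x_n)) ;; set0 x_r (WConst 0) ;;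
     While (WLt (Var x_r) (Var x_M))
       (WWrite x_I (Var x_r) (Var x_r) ;; WWrite x_P (Var x_r) (WConst 0) ;;
        WWrite x_B (Var x_r) (Var x_s) ;; WWrite x_F (Var x_r) (Var x_L) ;; inc x_r) ;;
     set0 x_t (WAdd (Var x_s) (WConst 1))"

definition phases_com :: com where
  "phases_com = init_records ;;
     While (BAnd (WLt (Var x_t) (WAdd (Var x_s) (Var x_D))) (WLt (Var x_t) (Var x_n))) phase_com"

lemmas wmod_phase [simp] =
  phase_com_def[THEN arg_cong, of wmod, unfolded wmod.simps wmod_merge_sort wmod_emit_all Un_insert_left Un_empty_left]
  phase_com_def[THEN arg_cong, of rmod, unfolded rmod.simps wmod_merge_sort wmod_emit_all Un_empty_left]
  init_records_def[THEN arg_cong, of wmod, unfolded wmod.simps Un_insert_left Un_empty_left]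
  init_records_def[THEN arg_cong, of rmod, unfolded rmod.simps Un_insert_left Un_empty_left]

lemmas wmod_phases [simp] =
  phases_com_def[THEN arg_cong, of wmod, unfolded wmod.simps wmod_phase Un_insert_left Un_empty_left]
  phases_com_def[THEN arg_cong, of rmod, unfolded rmod.simps wmod_phase Un_empty_left]

lemma cell_less: "i < m \<Longrightarrow> j < n \<Longrightarrow> i * n + j < m * (n :: nat)"
proof -
  assume "i < m" "j < n"
  then have "i * n + j < Suc i * n" by simp
  also have "\<dots> \<le> m * n" using \<open>i < m\<close> by (intro mult_le_mono1) auto
  finally show ?thesis .
qed

text \<open>With \<open>V = f - g\<close> the inequality \<open>V x b - V x t \<le> V y b - V y t\<close> reads
  \<open>cross n f g x y b t \<le> cross n f g y x b t\<close>; this form needs no subtraction.\<close>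

definition cross :: "nat \<Rightarrow> (nat \<Rightarrow> 'v::plus) \<Rightarrow> (nat \<Rightarrow> 'v) \<Rightarrow> nat \<Rightarrow> nat \<Rightarrow> nat \<Rightarrow> nat \<Rightarrow> 'v" where
  "cross n f g x y b t = f (x * n + b) + g (x * n + t) + (f (y * n + t) + g (y * n + b))"

text \<open>\<open>V\<close> occurs in no program; \<open>lex\<close> ties it to the lexicographic
  comparison that the machine performs. \<open>Mx\<close> bounds the number of records: the
  \<open>2 * n\<close> initial ones with exponent \<open>L\<close> have potential
  \<open>2 * n * (3/2) ^ L\<close>, and each round multiplies it by at most 3.\<close>

locale block =
  fixes n D L Lb Mx B :: nat and gp gq :: "nat \<Rightarrow> nat" and rp rq :: "nat \<Rightarrow> real"
    and V :: "nat \<Rightarrow> nat \<Rightarrow> real"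
  assumes lex: "x < 2 * n \<Longrightarrow> y < 2 * n \<Longrightarrow> b < n \<Longrightarrow> t < n \<Longrightarrow>
      V x b - V x t \<le> V y b - V y t \<longleftrightarrow>
      cross n gp gq x y b t < cross n gp gq y x b t \<or>
      cross n gp gq x y b t = cross n gp gq y x b t \<and> cross n rp rq x y b t \<le> cross n rp rq y x b t"
    and Mx: "2 * real n * (3/2) ^ L * 3 ^ D \<le> real Mx" "Mx \<le> 2 ^ Lb"
    and L: "2 * n \<le> 2 ^ L"
    and B: "4 * Mx + 2 \<le> B" "2 * (L * Mx) \<le> B" "2 ^ L < B" "2 * n < B" "L < B"
begin

definition ready :: "nat \<Rightarrow> store \<Rightarrow> bool" where
  "ready a s \<longleftrightarrow> words s x_n 0 = n \<and> words s x_D 0 = D \<and> words s x_L 0 = L \<and> words s x_s 0 = a \<and>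
     words s x_gP = gp \<and> words s x_gQ = gq \<and> reals s x_rP = rp \<and> reals s x_rQ = rq"

definition records :: "nat \<Rightarrow> nat \<Rightarrow> store \<Rightarrow> bool" where
  "records a t s \<longleftrightarrow> words s x_t 0 = t \<and> a < t \<and> t \<le> a + D \<and>
     block_inv n V a t (words s x_M 0) (words s x_I) (words s x_P) (words s x_B) (words s x_F) \<and>
     (\<forall>x < words s x_M 0. words s x_F x \<le> L) \<and>
     potential (words s x_M 0) (words s x_F) \<le> 3 ^ (t - a - 1) * (2 * real n * (3/2) ^ L)"

lemma records_le: assumes "records a t s" shows "words s x_M 0 \<le> Mx"
proof -
  have "real (words s x_M 0) \<le> 3 ^ (t - a - 1) * (2 * real n * (3/2) ^ L)"
    using assms potential_ge order_trans unfolding records_def by blast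
  also have "\<dots> \<le> 3 ^ D * (2 * real n * (3/2) ^ L)"
    using assms by (intro mult_right_mono power_increasing) (auto simp: records_def)
  finally show ?thesis using Mx(1) by (simp add: mult_ac)
qed

text \<open>The keys depend on the winner, which \<open>record_le\<close> takes from its left
  argument. Equal winners within a problem make all its comparisons refer to the same keys.\<close>

lemma record_le_preorder:
  assumes "\<And>x y. x < M \<Longrightarrow> y < M \<Longrightarrow> pr x = pr y \<Longrightarrow> wn x = wn y"
  shows "total_preorder_below (record_le V t it pr wn) M"
proof
  fix x y assume "x < M" "y < M"
  then show "record_le V t it pr wn x y \<or> record_le V t it pr wn y x"
    using assms[of x y] by (auto simp: record_le_def)
next
  fix x y z assume "x < M" "y < M" "z < M" "record_le V t it pr wn x y" "record_le V t it pr wn y z"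
  then show "record_le V t it pr wn x z"
    using assms[of x y] by (auto simp: record_le_def)
qed

lemma compares_record_cmp:
  assumes r: "ready a s" and rec: "records a t s" and t: "t < n"
  shows "compares record_cmp (record_le V t (words s x_I) (words s x_P) (words s x_B)) (words s x_M 0) s"
  unfolding compares_def
proof (intro allI impI)
  fix s' assume s': "same_except (merge_sort record_cmp) s s'"
    and x: "words s' x_x 0 < words s x_M 0" and y: "words s' x_y 0 < words s x_M 0"
  have inv: "block_inv n V a t (words s x_M 0) (words s x_I) (words s x_P) (words s x_B) (words s x_F)"
    using rec by (simp add: records_def)
  have same: "words s' x_I = words s x_I" "words s' x_P = words s x_P" "words s' x_B = words s x_B"
     "words s' x_t = words s x_t" "words s' x_n = words s x_n" "words s' x_gP = words s x_gP"
     "words s' x_gQ = words s x_gQ" "reals s' x_rP = reals s x_rP" "reals s' x_rQ = reals s x_rQ"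
    using s' by (simp_all add: same_except_def)
  have b: "words s x_B (words s' x_x 0) < n" using block_invD(3)[OF inv x] t by simp
  note lex = lex[OF block_invD(1)[OF inv x] block_invD(1)[OF inv y] b t]
  show "bval record_cmp s' = record_le V t (words s x_I) (words s x_P) (words s x_B) (words s' x_x 0) (words s' x_y 0)"
    using r rec unfolding record_le_def lex
    by (auto simp: record_cmp_def cross_word_def cross_real_def cell_def cross_def same ready_def records_def not_less not_le Let_def)
qed

lemma bcost_record_cmp: "bcost record_cmp \<le> 500"
  by (simp add: record_cmp_def cross_word_def cross_real_def cell_def Let_def)

lemma run_phase:
  assumes r: "ready a s" and rec: "records a t s" and t: "t < n" "t < a + D"
  shows "run B phase_com (\<lambda>u s'. u \<le> 2000 * ((Mx + 1) * (Lb + 1)) \<and> records a (Suc t) s') s"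
proof -
  let ?M = "words s x_M 0" and ?it = "words s x_I" and ?pr = "words s x_P"
    and ?wn = "words s x_B" and ?lm = "words s x_F"
  have M: "?M \<le> Mx" using records_le[OF rec] .
  have inv: "block_inv n V a t ?M ?it ?pr ?wn ?lm" using rec by (simp add: records_def)
  interpret total_preorder_below "record_le V t ?it ?pr ?wn" ?M
    by (rule record_le_preorder) (use block_invD(4)[OF inv] in blast)
  have sort: "run B (merge_sort record_cmp) (\<lambda>u s'. u \<le> ((200 + bcost record_cmp) * ?M + 200) * (Lb + 1) \<and>
      mset (map (words s' x_p) [0..<?M]) = mset [0..<?M] \<and>
      (\<forall>x y. x \<le> y \<longrightarrow> y < ?M \<longrightarrow> record_le V t ?it ?pr ?wn (words s' x_p x) (words s' x_p y))) s"
    by (rule run_merge_sort) (use M Mx B compares_record_cmp[OF r rec t(1)] in auto)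
  show ?thesis
    unfolding phase_com_def
    apply (subst run_Seq)
    apply (rule run_mono_frame[OF sort])
    apply (subst run_Seq)
    subgoal premises s1 for u1 s1
    proof -
      let ?p = "words s1 x_p"
      have perm: "bij_betw ?p {..<?M} {..<?M}"
      proof -
        have "set (map ?p [0..<?M]) = set [0..<?M]" "distinct (map ?p [0..<?M])"
          using s1(1) mset_eq_setD mset_eq_imp_distinct_iff[of "map ?p [0..<?M]" "[0..<?M]"] distinct_upt by blast+
        then show ?thesis by (auto simp: bij_betw_def distinct_map atLeast0LessThan)
      qed
      interpret phase n V a t ?M ?it ?pr ?wn ?lm ?p
        using inv perm s1(1) by unfold_locales auto
      have off: "real (offset ?M) \<le> 3 ^ D * (2 * real n * (3/2) ^ L)"
      proof -
        have "real (offset ?M) \<le> 3 * (3 ^ (t - a - 1) * (2 * real n * (3/2) ^ L))"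
          using offset_le rec unfolding records_def by linarith
        also have "\<dots> = 3 ^ Suc (t - a - 1) * (2 * real n * (3/2) ^ L)" by simp
        also have "\<dots> \<le> 3 ^ D * (2 * real n * (3/2) ^ L)"
          using rec t by (intro mult_right_mono power_increasing) (auto simp: records_def)
        finally show ?thesis .
      qed
      then have off: "offset ?M \<le> Mx" using Mx(1) by (simp add: mult_ac)
      have LM: "2 * (L * ?M) \<le> B" using B(2) M by (meson le_trans mult_le_mono2)
      have "emit_ready B L s1"
        using s1(2) r rec B M off LM t unfolding emit_ready_def same_except_def ready_def records_def by simp
      note emit = run_emit_all[OF this]
      show ?thesis
        apply (rule run_mono_frame[OF emit])
        subgoal premises s2 for u2 s2
        proof -
          note new = emitted_inv[OF s2(1)[THEN conjunct2, THEN conjunct2], of L]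
          have L: "x < ?M \<Longrightarrow> ?lm x \<le> L" for x using rec by (simp add: records_def)
          have "potential (offset ?M) (words s2 x_F) \<le> 3 ^ (Suc t - a - 1) * (2 * real n * (3 / 2) ^ L)"
          proof -
            have "Suc t - a - 1 = Suc (t - a - 1)" using rec by (auto simp: records_def)
            then show ?thesis using new(2)[OF L] rec unfolding records_def by simp
          qed
          then have rec': "records a (Suc t) (write_word x_t 0 (Suc t) s2)"
            using new(1,3)[OF L] rec t s2(1) by (simp add: records_def)
          have t2: "words s2 x_t 0 = t" using s1(2) s2(2) rec by (simp add: same_except_def records_def)
          have "((200 + bcost record_cmp) * ?M + 200) * (Lb + 1) \<le> (700 * Mx + 200) * (Lb + 1)"
            using M bcost_record_cmp by (intro mult_le_mono1 add_le_mono mult_le_mono) auto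
          then have "u1 \<le> (700 * Mx + 200) * (Lb + 1)" using s1(1) by linarith
          moreover have "300 * (?M + offset ?M) \<le> 300 * (Mx + Mx)"
            using M off by (intro mult_le_mono2 add_le_mono)
          then have "300 * (?M + offset ?M) + 300 \<le> 600 * Mx + 300" by simp
          then have "u2 \<le> 600 * Mx + 300" using s2(1)[THEN conjunct1] by (rule order_trans[rotated])
          ultimately have "u1 + u2 + 10 \<le> 2000 * ((Mx + 1) * (Lb + 1))"
            by (simp add: algebra_simps)
          then show ?thesis using rec' t2 t B by simp
        qed
        done
    qed
    done
qed

lemma run_init_records:
  assumes r: "ready a s" and D: "0 < D" and a: "a < n"
  shows "run B init_records (\<lambda>u s'. u \<le> 100 * Mx + 100 \<and> records a (Suc a) s') s"
proof -
  have "2 * real n * 1 * 1 \<le> 2 * real n * (3/2) ^ L * 3 ^ D"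
    by (intro mult_mono one_le_power) auto
  then have nM: "2 * n \<le> Mx" using Mx(1) by linarith
  show ?thesis
    unfolding init_records_def
    apply simp
    apply (intro conjI)
    subgoal using r B by (simp add: ready_def)
    subgoal using B by simp
    apply (rule run_While_const[where N = "2 * n" and \<tau> = 40 and I = "\<lambda>k s'. words s' x_M 0 = 2 * n \<and>
       words s' x_r 0 = k \<and> (\<forall>x<k. words s' x_I x = x \<and> words s' x_P x = 0 \<and> words s' x_B x = a \<and> words s' x_F x = L)"])
    subgoal using r by (simp add: ready_def)
    subgoal for k s'
      using r B a by (auto simp: ready_def same_except_def less_Suc_eq)
    subgoal by simp
    subgoal premises s1 for u1 s1
    proof -
      have s: "words s1 x_s 0 = a" using r s1(3) by (simp add: ready_def same_except_def)
      have "block_inv n V a (Suc a) (2 * n) (words s1 x_I) (words s1 x_P) (words s1 x_B) (words s1 x_F)"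
        by (rule block_inv_init[OF L]) (use s1(2) in auto)
      moreover have "potential (2 * n) (words s1 x_F) = 2 * real n * (3/2) ^ L"
        unfolding potential_def using s1(2) by simp
      ultimately show ?thesis
        using s s1(1,2) D B a nM by (simp add: records_def)
    qed
    done
qed

lemma run_phases:
  assumes r: "ready a s" and D: "0 < D" and a: "a < n"
  shows "run B phases_com (\<lambda>u s'. u \<le> 3000 * ((Mx + 1) * (Lb + 1)) * (D + 1) \<and> records a (min (a + D) n) s') s"
proof -
  define X where "X = (Mx + 1) * (Lb + 1)"
  \<comment> \<open>The index \<open>a\<close> is the initial winner and needs no round.\<close>
  define N where "N = min (a + D) n - Suc a"
  have N: "Suc a + N = min (a + D) n" "N \<le> D" using D a by (auto simp: N_def)
  have X: "Mx + 1 \<le> X" "1 \<le> X" by (auto simp: X_def)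
  show ?thesis
    unfolding phases_com_def X_def[symmetric]
    apply (subst run_Seq)
    apply (rule run_mono_frame[OF run_init_records[OF r D a]])
    subgoal premises s1 for u1 s1
      apply (rule run_While_const[where N = N and \<tau> = "2000 * X" and I = "\<lambda>k s'. records a (Suc a + k) s'"])
      subgoal using s1(1) by simp
      subgoal premises s2 for k s2
      proof -
        have r2: "ready a s2" using s1(2) s2(3) r by (simp add: ready_def same_except_def)
        have "words s2 x_t 0 = Suc a + k" using s2(2) by (simp add: records_def)
        moreover have "Suc a + k < n" "Suc a + k < a + D" using s2(1) by (auto simp: N_def)
        ultimately show ?thesis
          using run_phase[OF r2 s2(2)] r2 by (simp add: ready_def X_def)
      qed
      subgoal premises s2 for s2
      proof -
        have r2: "ready a s2" using s1(2) s2(2) r by (simp add: ready_def same_except_def)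
        moreover have "words s2 x_t 0 = min (a + D) n" using s2(1) N by (auto simp: records_def)
        ultimately show ?thesis by (auto simp: ready_def)
      qed
      subgoal premises s2 for u2 s2
      proof -
        define Y where "Y = D * X"
        have "N * (2000 * X + 30) \<le> D * (2000 * X + 30)" using N(2) by (rule mult_le_mono1)
        also have "\<dots> = 2000 * Y + 30 * D" by (simp add: Y_def algebra_simps)
        finally have "u2 \<le> 2000 * Y + 30 * D + 30" using s2(1) by (simp add: algebra_simps)
        moreover have "D \<le> Y" using X by (simp add: Y_def)
        ultimately have "u1 + u2 \<le> 3000 * X + 3000 * Y"
          using s1(1)[THEN conjunct1] X by linarith
        then have "u1 + u2 \<le> 3000 * X * (D + 1)" by (simp add: Y_def algebra_simps)
        then show ?thesis using s2(2) N(1) by simp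
      qed
      done
    done
qed

end

section \<open>Enumeration of the pairs of a block and selection of the best tuple\<close>

text \<open>Linked lists: the pointer to record \<open>x\<close> is \<open>Suc x\<close>, and 0 is the null pointer.\<close>

fun chain :: "(nat \<Rightarrow> nat) \<Rightarrow> nat \<Rightarrow> nat list \<Rightarrow> bool" where
  "chain nx y [] \<longleftrightarrow> y = 0"
| "chain nx y (x # xs) \<longleftrightarrow> y = Suc x \<and> chain nx (nx x) xs"

lemma chain_upd: "x \<notin> set xs \<Longrightarrow> chain (nx(x := v)) y xs \<longleftrightarrow> chain nx y xs"
  by (induction xs arbitrary: y) auto

lemma chain_bound: "chain nx y xs \<Longrightarrow> \<forall>x\<in>set xs. x < M \<Longrightarrow> y \<le> M"
  by (cases xs) auto

fun copy_tail :: "nat list \<Rightarrow> com" where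
  "copy_tail [] = Skip"
| "copy_tail (r # rs) = (WWrite x_out (WConst r) (Arr x_u (WConst r)) ;; copy_tail rs)"

lemma mod_copy_tail [simp]:
  "x \<in> wmod (copy_tail rs) \<longleftrightarrow> rs \<noteq> [] \<and> x = x_out" "rmod (copy_tail rs) = {}"
  by (induction rs) auto

lemma run_copy_tail:
  assumes "\<And>r. r \<in> set rs \<Longrightarrow> words s x_u r < B"
  shows "run B (copy_tail rs) (\<lambda>t s'. t \<le> 10 * length rs + 1 \<and>
     words s' x_out = (\<lambda>r. if r \<in> set rs then words s x_u r else words s x_out r)) s"
  using assms
proof (induction rs arbitrary: s)
  case (Cons r rs)
  show ?case
    using Cons.prems Cons.IH[of "write_word x_out r (words s x_u r) s"]
    by (auto elim!: run_mono)
qed simp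

text \<open>The row record is \<open>x_y - 1\<close> by the pointer convention, the column record is
  \<open>x_r\<close>, and they share the middle index \<open>j\<close>. The cell
  \<open>x_best\<close> means nothing until \<open>x_found\<close> is set: weights may be negative,
  so its initial 0 must not take part in a comparison that counts.\<close>

definition consider_com :: "nat \<Rightarrow> nat \<Rightarrow> com" where
  "consider_com h full =
     (let i = Arr x_I (WSub (Var x_y) (WConst 1)); y = Arr x_I (Var x_r); j = Arr x_B (Var x_r);
          k = WSub y (Var x_n);
          c = WAdd (WMul i (Var x_n)) j; d = WAdd (WMul y (Var x_n)) j; e = WAdd (WMul i (Var x_n)) k;
          g = WAdd (WAdd (Arr x_gP c) (Arr x_gQ d)) (Arr x_gC e);
          v = RAdd (RAdd (RRead x_rP c) (RRead x_rQ d)) (RRead x_rC e);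
          best = RRead x_best (WConst 0) in
      Cond (BAnd (WLe (WConst full) g) (BOr (WLe (Var x_found) (WConst 0)) (BNot (RLe v best))))
        (set0 x_found (WConst 1) ;; RWrite x_best (WConst 0) v ;;
         WWrite x_out (WConst 0) i ;; WWrite x_out (WConst 1) j ;; WWrite x_out (WConst 2) k ;;
         copy_tail [3..<h])
        Skip)"

text \<open>\<open>hd\<close> lists the rows of each problem, so that the pairs of a problem are enumerated in time
  proportional to their number.\<close>

definition link_com :: com where
  "link_com =
     set0 x_r (WConst 0) ;;
     While (WLt (Var x_r) (Var x_M))
       (Cond (WLt (Arr x_I (Var x_r)) (Var x_n))
          (WWrite x_nx (Var x_r) (Arr x_hd (Arr x_P (Var x_r))) ;;
           WWrite x_hd (Arr x_P (Var x_r)) (WAdd (Var x_r) (WConst 1)))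
          Skip ;;
        inc x_r)"

definition walk_com :: "nat \<Rightarrow> nat \<Rightarrow> com" where
  "walk_com h full =
     set0 x_y (Arr x_hd (Arr x_P (Var x_r))) ;;
     While (WLt (WConst 0) (Var x_y))
       (consider_com h full ;; set0 x_y (Arr x_nx (WSub (Var x_y) (WConst 1))))"

definition scan_com :: "nat \<Rightarrow> nat \<Rightarrow> com" where
  "scan_com h full =
     set0 x_r (WConst 0) ;;
     While (WLt (Var x_r) (Var x_M))
       (Cond (WLt (Arr x_I (Var x_r)) (Var x_n)) Skip (walk_com h full) ;; inc x_r)"

text \<open>Only cells of \<open>x_hd\<close> that belong to the problem of some record can be
  nonzero. Resetting them through the records makes the cost independent of the range of problem
  numbers.\<close>

definition clear_com :: com where
  "clear_com =
     set0 x_r (WConst 0) ;;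
     While (WLt (Var x_r) (Var x_M)) (WWrite x_hd (Arr x_P (Var x_r)) (WConst 0) ;; inc x_r)"

definition block_com :: "nat \<Rightarrow> nat \<Rightarrow> com" where
  "block_com h full = phases_com ;; link_com ;; scan_com h full ;; clear_com"

lemmas mod_consider [simp] =
  consider_com_def[unfolded Let_def, THEN arg_cong, of wmod, unfolded wmod.simps Un_insert_left Un_empty_left]
  consider_com_def[unfolded Let_def, THEN arg_cong, of rmod, unfolded rmod.simps mod_copy_tail Un_insert_left Un_empty_left Un_empty_right]
lemmas mod_link [simp] =
  link_com_def[THEN arg_cong, of wmod, unfolded wmod.simps Un_insert_left Un_empty_left]
  link_com_def[THEN arg_cong, of rmod, unfolded rmod.simps Un_empty_left]
  clear_com_def[THEN arg_cong, of wmod, unfolded wmod.simps Un_insert_left Un_empty_left]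
  clear_com_def[THEN arg_cong, of rmod, unfolded rmod.simps Un_empty_left]
lemmas mod_walk [simp] =
  walk_com_def[THEN arg_cong, of wmod, unfolded wmod.simps mod_consider Un_insert_left Un_empty_left]
  walk_com_def[THEN arg_cong, of rmod, unfolded rmod.simps mod_consider Un_empty_left Un_empty_right]
lemmas mod_scan [simp] =
  scan_com_def[THEN arg_cong, of wmod, unfolded wmod.simps mod_walk Un_insert_left Un_empty_left]
  scan_com_def[THEN arg_cong, of rmod, unfolded rmod.simps mod_walk Un_empty_left Un_empty_right]
lemmas mod_block [simp] =
  block_com_def[THEN arg_cong, of wmod, unfolded wmod.simps wmod_phases mod_link mod_scan Un_insert_left Un_empty_left]
  block_com_def[THEN arg_cong, of rmod, unfolded rmod.simps wmod_phases mod_link mod_scan Un_empty_left Un_empty_right]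

text \<open>\<open>X\<close> is the set of tuples examined so far. The stored tuple must be
  admissible and at least as good as every admissible member of \<open>X\<close>, but need not lie
  in \<open>X\<close>. Hence \<open>X\<close> may be shrunk at will, and the search is finished once
  \<open>X\<close> can be taken to be \<open>UNIV\<close>.\<close>

definition best_of :: "((nat \<Rightarrow> nat) \<Rightarrow> bool) \<Rightarrow> ((nat \<Rightarrow> nat) \<Rightarrow> real) \<Rightarrow> (nat \<Rightarrow> nat) set \<Rightarrow> store \<Rightarrow> bool" where
  "best_of ok wt X s \<longleftrightarrow> words s x_found 0 \<le> 1 \<and>
     (words s x_found 0 = 1 \<longrightarrow> ok (words s x_out) \<and> reals s x_best 0 = wt (words s x_out)) \<and>
     (\<forall>x\<in>X. ok x \<longrightarrow> words s x_found 0 = 1 \<and> wt x \<le> reals s x_best 0)"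

definition tuple :: "(nat \<Rightarrow> nat) \<Rightarrow> nat \<Rightarrow> nat \<Rightarrow> nat \<Rightarrow> nat \<Rightarrow> nat" where
  "tuple u i j k r = (if r = 0 then i else if r = 1 then j else if r = 2 then k else u r)"

text \<open>Admissible means that the count, split over the three matrices, attains its maximum
  \<open>full\<close>. This makes the lexicographic comparison of count and weight compatible with
  maximising the weight among admissible tuples.\<close>

locale scan = block +
  fixes h full :: nat and gc :: "nat \<Rightarrow> nat" and rc :: "nat \<Rightarrow> real" and u :: "nat \<Rightarrow> nat"
    and ok :: "(nat \<Rightarrow> nat) \<Rightarrow> bool" and wt :: "(nat \<Rightarrow> nat) \<Rightarrow> real"
  assumes h: "3 \<le> h"
    and zero_p: "x \<ge> n * n \<Longrightarrow> gp x = 0 \<and> rp x = 0"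
    and zero_q: "x < n * n \<Longrightarrow> gq x = 0 \<and> rq x = 0"
    and cong: "(\<And>r. r < h \<Longrightarrow> f r = g r) \<Longrightarrow> ok f = ok g \<and> wt f = wt g"
    and tuple_ok: "i < n \<Longrightarrow> j < n \<Longrightarrow> k < n \<Longrightarrow>
      ok (tuple u i j k) \<longleftrightarrow> full \<le> gp (i * n + j) + gq ((n + k) * n + j) + gc (i * n + k)"
    and total_le: "i < n \<Longrightarrow> j < n \<Longrightarrow> k < n \<Longrightarrow>
      gp (i * n + j) + gq ((n + k) * n + j) + gc (i * n + k) \<le> full"
    and tuple_wt: "i < n \<Longrightarrow> j < n \<Longrightarrow> k < n \<Longrightarrow>
      wt (tuple u i j k) = rp (i * n + j) + rq ((n + k) * n + j) + rc (i * n + k)"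
    and u: "r < h \<Longrightarrow> u r < B"
begin

text \<open>The matrix of \<open>(u 0, u 2)\<close> does not see the middle index, so comparing
  \<open>j\<close> with \<open>b\<close> concerns the other two only. The tuple with
  \<open>j\<close> already has count \<open>full\<close>, so the winner cannot have a larger count;
  it must have the same count and at least the same weight.\<close>

lemma winner_ok:
  assumes "i < n" "j < n" "k < n" "b < n" and V: "V i j - V (n + k) j \<le> V i b - V (n + k) b"
    and ok: "ok (tuple u i j k)"
  shows "ok (tuple u i b k) \<and> wt (tuple u i j k) \<le> wt (tuple u i b k)"
proof -
  note row = cell_less[OF assms(1), of _ n]
  have col: "n * n \<le> (n + k) * n + c" for c by (simp add: algebra_simps)
  have "V (n + k) b - V (n + k) j \<le> V i b - V i j" using V by linarith
  then have "cross n gp gq (n + k) i b j < cross n gp gq i (n + k) b j \<or>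
      cross n gp gq (n + k) i b j = cross n gp gq i (n + k) b j \<and>
      cross n rp rq (n + k) i b j \<le> cross n rp rq i (n + k) b j"
    using lex[of "n + k" i b j] assms(1-4) by simp
  then have "gp (i * n + j) + gq ((n + k) * n + j) < gp (i * n + b) + gq ((n + k) * n + b) \<or>
      gp (i * n + j) + gq ((n + k) * n + j) = gp (i * n + b) + gq ((n + k) * n + b) \<and>
      rp (i * n + j) + rq ((n + k) * n + j) \<le> rp (i * n + b) + rq ((n + k) * n + b)"
    using zero_p[OF col] zero_q[OF row[OF assms(2)]] zero_q[OF row[OF assms(4)]] by (auto simp: cross_def)
  moreover have "gp (i * n + b) + gq ((n + k) * n + b) + gc (i * n + k) \<le> full"
    using total_le assms(1-4) by blast
  ultimately show ?thesis
    using tuple_ok[of i j k] tuple_ok[of i b k] tuple_wt[of i j k] tuple_wt[of i b k] assms by auto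
qed

definition scan_ready :: "nat \<Rightarrow> store \<Rightarrow> bool" where
  "scan_ready a s \<longleftrightarrow> ready a s \<and> words s x_gC = gc \<and> reals s x_rC = rc \<and> (\<forall>r. 3 \<le> r \<longrightarrow> r < h \<longrightarrow> words s x_u r = u r)"

definition linked :: "nat \<Rightarrow> store \<Rightarrow> bool" where
  "linked a s \<longleftrightarrow> records a (min (a + D) n) s \<and> scan_ready a s"

lemma run_consider:
  assumes l: "linked a s" and best: "best_of ok wt X s"
    and xy: "x < words s x_M 0" "y < words s x_M 0" "words s x_y 0 = Suc x" "words s x_r 0 = y"
      "words s x_I x < n" "n \<le> words s x_I y" "words s x_P x = words s x_P y"
  shows "run B (consider_com h full) (\<lambda>t s'. t \<le> 300 + 10 * h \<and>
     best_of ok wt (X \<union> {tuple u (words s x_I x) j (words s x_I y - n) | j. a \<le> j \<and> j < min (a + D) n}) s') s"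
proof -
  let ?M = "words s x_M 0" and ?it = "words s x_I" and ?pr = "words s x_P"
    and ?wn = "words s x_B" and ?lm = "words s x_F"
  have rec: "records a (min (a + D) n) s" and sr: "scan_ready a s" using l by (simp_all add: linked_def)
  have inv: "block_inv n V a (min (a + D) n) ?M ?it ?pr ?wn ?lm" using rec by (simp add: records_def)
  define i where "i = ?it x"
  define k where "k = ?it y - n"
  define b where "b = ?wn y"
  have i: "i < n" using xy by (simp add: i_def)
  have y: "?it y = n + k" using xy by (simp add: k_def)
  have k: "k < n" using block_invD(1)[OF inv xy(2)] y by simp
  have b: "b < n" using block_invD(3)[OF inv xy(2)] by (simp add: b_def)
  have wn: "?wn x = b" using block_invD(4)[OF inv xy(1,2,7)] by (simp add: b_def)
  have opt: "V i j - V (n + k) j \<le> V i b - V (n + k) b" if "a \<le> j" "j < min (a + D) n" for j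
    using block_invD(8)[OF inv xy(1,2,5,6,7) that] wn y by (simp add: i_def)
  have better: "ok (tuple u i b k) \<and> wt (tuple u i j k) \<le> wt (tuple u i b k)"
    if "a \<le> j" "j < min (a + D) n" "ok (tuple u i j k)" for j
    using winner_ok[OF i _ k b opt[OF that(1,2)] that(3)] that(2) by simp
  have mem: "best_of ok wt (X \<union> {tuple u i j k | j. a \<le> j \<and> j < min (a + D) n}) s'"
    if "words s' x_found 0 \<le> 1" "words s' x_found 0 = 1 \<longrightarrow> ok (words s' x_out) \<and> reals s' x_best 0 = wt (words s' x_out)"
      "\<forall>x\<in>X. ok x \<longrightarrow> words s' x_found 0 = 1 \<and> wt x \<le> reals s' x_best 0"
      "ok (tuple u i b k) \<longrightarrow> words s' x_found 0 = 1 \<and> wt (tuple u i b k) \<le> reals s' x_best 0" for s'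
    using that better unfolding best_of_def by fastforce
  have vals: "words s x_n 0 = n" "words s x_gP = gp" "words s x_gQ = gq" "words s x_gC = gc"
    "reals s x_rP = rp" "reals s x_rQ = rq" "reals s x_rC = rc" "\<And>r. 3 \<le> r \<Longrightarrow> r < h \<Longrightarrow> words s x_u r = u r"
    using sr by (auto simp: scan_ready_def ready_def)
  let ?good = "full \<le> gp (i * n + b) + gq ((n + k) * n + b) + gc (i * n + k)"
  let ?v = "rp (i * n + b) + rq ((n + k) * n + b) + rc (i * n + k)"
  have okb: "ok (tuple u i b k) \<longleftrightarrow> ?good" and wtb: "wt (tuple u i b k) = ?v"
    using tuple_ok tuple_wt i k b by blast+
  have xi: "?it x = i" and yb: "?wn y = b" by (simp_all add: i_def b_def)
  have bounds: "i < B" "b < B" "k < B" "Suc 0 < B" using B i b k by auto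
  show ?thesis
  proof (cases "?good \<and> (words s x_found 0 = 0 \<or> \<not> ?v \<le> reals s x_best 0)")
    case True
    have fin: "best_of ok wt (X \<union> {tuple u i j k | j. a \<le> j \<and> j < min (a + D) n}) s'"
      if "words s' x_found 0 = 1" "reals s' x_best 0 = ?v"
        "words s' x_out = (\<lambda>r. if 3 \<le> r \<and> r < h then u r else
            ((words s x_out)(0 := i, Suc 0 := b, 2 := k)) r)" for s'
    proof (rule mem)
      have "words s' x_out r = tuple u i b k r" if "r < h" for r
        using that unfolding \<open>words s' x_out = _\<close> tuple_def by auto
      then have "ok (words s' x_out) = ok (tuple u i b k) \<and> wt (words s' x_out) = wt (tuple u i b k)"
        by (rule cong)
      then show "words s' x_found 0 = 1 \<longrightarrow> ok (words s' x_out) \<and> reals s' x_best 0 = wt (words s' x_out)"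
        using that okb wtb True by simp
      show "\<forall>x\<in>X. ok x \<longrightarrow> words s' x_found 0 = 1 \<and> wt x \<le> reals s' x_best 0"
        using best True that unfolding best_of_def by force
    qed (use that wtb in auto)
    show ?thesis
      unfolding consider_com_def Let_def
      using True
      apply (simp add: vals xy xi yb y bounds)
      apply (rule run_mono_frame[OF run_copy_tail])
      subgoal for r using vals(8)[of r] u[of r] by simp
      subgoal premises prems for t s'
      proof -
        have "t \<le> 10 * h + 1"
          using prems(2)[THEN conjunct1] by (rule order_trans) simp
        moreover have "best_of ok wt (X \<union> {tuple u i j k | j. a \<le> j \<and> j < min (a + D) n}) s'"
          by (rule fin) (use prems in \<open>auto simp: same_except_def vals fun_eq_iff\<close>)
        ultimately show ?thesis by simp
      qed
      done
  next
    case False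
    have "best_of ok wt (X \<union> {tuple u i j k | j. a \<le> j \<and> j < min (a + D) n}) s"
    proof (rule mem)
      show "ok (tuple u i b k) \<longrightarrow> words s x_found 0 = 1 \<and> wt (tuple u i b k) \<le> reals s x_best 0"
        using False okb wtb best by (auto simp: best_of_def le_Suc_eq)
    qed (use best in \<open>auto simp: best_of_def\<close>)
    then show ?thesis
      unfolding consider_com_def Let_def
      using False
      by (auto simp: vals xy xi yb y bounds)
  qed
qed

lemma linked_same_except:
  assumes "linked a s" "same_except c s s'"
    "wmod c \<inter> {x_n, x_D, x_L, x_s, x_gP, x_gQ, x_gC, x_u, x_t, x_M, x_I, x_P, x_B, x_F} = {}"
    "rmod c \<inter> {x_rP, x_rQ, x_rC} = {}"
  shows "linked a s'"
proof -
  have w: "words s' x = words s x"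
    if "x \<in> {x_n, x_D, x_L, x_s, x_gP, x_gQ, x_gC, x_u, x_t, x_M, x_I, x_P, x_B, x_F}" for x
    using that assms(2,3) unfolding same_except_def by blast
  have r: "reals s' x = reals s x" if "x \<in> {x_rP, x_rQ, x_rC}" for x
    using that assms(2,4) unfolding same_except_def by blast
  show ?thesis
    using assms(1) unfolding linked_def records_def scan_ready_def ready_def by (simp add: w r)
qed

text \<open>The order is reversed because every record is pushed at the head of its list.\<close>

definition row_records :: "store \<Rightarrow> nat \<Rightarrow> nat \<Rightarrow> nat list" where
  "row_records s k q = filter (\<lambda>x. words s x_I x < n \<and> words s x_P x = q) (rev [0..<k])"

lemma run_link:
  assumes l: "linked a s" and hd: "words s x_hd = (\<lambda>_. 0)"
  shows "run B link_com (\<lambda>t s'. t \<le> 50 * Mx + 50 \<and>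
     (\<forall>q. chain (words s' x_nx) (words s' x_hd q) (row_records s (words s x_M 0) q))) s"
proof -
  let ?M = "words s x_M 0" and ?I = "words s x_I" and ?P = "words s x_P"
  have M: "?M \<le> Mx" using l records_le unfolding linked_def by blast
  have n: "words s x_n 0 = n" using l by (simp add: linked_def scan_ready_def ready_def)
  show ?thesis
    unfolding link_com_def
    apply simp
    apply (intro conjI)
    subgoal using B by simp
    apply (rule run_While_const[where N = ?M and \<tau> = 40 and I = "\<lambda>k s'. words s' x_r 0 = k \<and>
       (\<forall>q. chain (words s' x_nx) (words s' x_hd q) (row_records s k q))"])
    subgoal using hd by (simp add: row_records_def)
    subgoal premises p for k s'
    proof -
      have same: "words s' x_I = ?I" "words s' x_P = ?P" "words s' x_M = words s x_M" "words s' x_n = words s x_n"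
        using p(3) by (simp_all add: same_except_def)
      have "words s' x_hd (?P k) \<le> ?M"
        by (rule chain_bound[where nx = "words s' x_nx" and xs = "row_records s k (?P k)"])
           (use p in \<open>auto simp: row_records_def\<close>)
      then have b: "words s' x_hd (?P k) < B" "Suc k < B" using M B p(1) by linarith+
      have notin: "k \<notin> set (row_records s k q)" for q by (simp add: row_records_def)
      have rec: "row_records s (Suc k) q = (if ?I k < n \<and> ?P k = q then k # row_records s k q else row_records s k q)" for q
        by (simp add: row_records_def)
      show ?thesis
        using p b n by (simp add: same rec chain_upd[OF notin])
    qed
    subgoal premises p for s'
      using p by (simp add: same_except_def)
    subgoal premises p for t s'
    proof -
      have "?M * 50 \<le> Mx * 50" using M by (rule mult_le_mono1)
      then show ?thesis using p(1,2) by simp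
    qed
    done
qed

definition covered :: "nat \<Rightarrow> nat \<Rightarrow> nat \<Rightarrow> (nat \<Rightarrow> nat) set" where
  "covered a i k = {tuple u i j k | j. a \<le> j \<and> j < min (a + D) n}"

lemma best_of_mono: "best_of ok wt X s \<Longrightarrow> Y \<subseteq> X \<Longrightarrow> best_of ok wt Y s"
  by (auto simp: best_of_def)

lemma best_of_same_except:
  "best_of ok wt X s \<Longrightarrow> same_except c s s' \<Longrightarrow> x_found \<notin> wmod c \<Longrightarrow> x_out \<notin> wmod c \<Longrightarrow> x_best \<notin> rmod c \<Longrightarrow>
     best_of ok wt X s'"
  by (simp only: best_of_def same_except_def) metis

lemma best_of_write:
  "x \<noteq> x_found \<Longrightarrow> x \<noteq> x_out \<Longrightarrow> best_of ok wt X (write_word x i v s) = best_of ok wt X s"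
  by (simp add: best_of_def)

lemma run_walk:
  assumes l: "linked a s" and best: "best_of ok wt X s"
    and y: "words s x_r 0 = y" "y < words s x_M 0" "n \<le> words s x_I y"
    and ch: "chain (words s x_nx) (words s x_hd (words s x_P y)) xs"
    and xs: "xs = row_records s (words s x_M 0) (words s x_P y)"
  shows "run B (walk_com h full) (\<lambda>t s'. t \<le> (400 + 10 * h) * length xs + 50 \<and>
     best_of ok wt (X \<union> (\<Union>x\<in>set xs. covered a (words s x_I x) (words s x_I y - n))) s') s"
proof -
  let ?M = "words s x_M 0" and ?I = "words s x_I" and ?P = "words s x_P"
  let ?X = "\<lambda>k. X \<union> (\<Union>x\<in>set (take k xs). covered a (?I x) (?I y - n))"
  have M: "?M \<le> Mx" using l records_le unfolding linked_def by blast
  have xsD: "x < ?M" "?I x < n" "?P x = ?P y" if "x \<in> set xs" for x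
    using that by (auto simp: xs row_records_def)
  have hdB: "words s x_hd (?P y) < B"
    using chain_bound[OF ch, of ?M] xsD(1) M B by auto
  show ?thesis
    unfolding walk_com_def
    apply (simp add: y hdB)
    apply (rule run_While_const[where N = "length xs" and \<tau> = "350 + 10 * h" and
       I = "\<lambda>k s'. chain (words s x_nx) (words s' x_y 0) (drop k xs) \<and> best_of ok wt (?X k) s'"])
    subgoal using ch best by (simp add: best_of_write)
    subgoal premises p for k s1
    proof -
      define x where "x = xs ! k"
      have x: "x \<in> set xs" using p(1) by (simp add: x_def)
      have dr: "drop k xs = x # drop (Suc k) xs" using p(1) by (simp add: x_def Cons_nth_drop_Suc)
      have same: "same_except (walk_com h full) s s1"
        using p(3) by (auto simp: same_except_def)
      have vals: "words s1 x_M = words s x_M" "words s1 x_I = ?I" "words s1 x_P = ?P"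
          "words s1 x_nx = words s x_nx" "words s1 x_r 0 = y"
        using same y by (simp_all add: same_except_def)
      have l1: "linked a s1" by (rule linked_same_except[OF l same]) simp_all
      have ch1: "words s1 x_y 0 = Suc x" "chain (words s x_nx) (words s x_nx x) (drop (Suc k) xs)"
        using p(2) dr by simp_all
      have nxB: "words s x_nx x < B"
      proof -
        have "\<forall>x\<in>set (drop (Suc k) xs). x < ?M" using xsD(1) in_set_dropD by metis
        then show ?thesis using chain_bound[OF ch1(2)] M B by fastforce
      qed
      have tk: "?X (Suc k) = ?X k \<union> covered a (?I x) (?I y - n)"
        using p(1) by (auto simp: take_Suc_conv_app_nth x_def)
      have "run B (consider_com h full)
          (\<lambda>t s'. t \<le> 300 + 10 * h \<and> best_of ok wt (?X k \<union> covered a (?I x) (?I y - n)) s') s1"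
        using run_consider[OF l1 p(2)[THEN conjunct2], of x y] xsD[OF x] y ch1(1)
        by (simp add: vals covered_def)
      then have "run B (consider_com h full) (\<lambda>t s'. t \<le> 300 + 10 * h \<and> best_of ok wt (?X (Suc k)) s') s1"
        by (simp only: tk)
      then have "run B (consider_com h full) (\<lambda>t s'. t \<le> 300 + 10 * h \<and> best_of ok wt (?X (Suc k)) s' \<and>
          words s' x_y 0 = Suc x \<and> words s' x_nx = words s x_nx) s1"
        by (rule run_mono_frame) (use vals ch1(1) in \<open>auto simp: same_except_def\<close>)
      then show ?thesis
        using ch1 nxB by (auto simp: best_of_write elim!: run_mono)
    qed
    subgoal premises p for s1
      using p(1) by simp
    subgoal premises p for t s1
      using p(1,2) by (simp add: algebra_simps)
    done
qed

lemma row_records: "set (row_records s M q) = {x. x < M \<and> words s x_I x < n \<and> words s x_P x = q}"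
    "length (row_records s M q) = card {x. x < M \<and> words s x_I x < n \<and> words s x_P x = q}"
proof -
  show "set (row_records s M q) = {x. x < M \<and> words s x_I x < n \<and> words s x_P x = q}"
    by (auto simp: row_records_def)
  then show "length (row_records s M q) = card {x. x < M \<and> words s x_I x < n \<and> words s x_P x = q}"
    using distinct_card[of "row_records s M q"] by (simp add: row_records_def)
qed

text \<open>A row record and a column record in one problem are determined by their two items, by
  the uniqueness part of the invariant. All problems together therefore contain at most
  \<open>n * n\<close> such pairs, however many records there are.\<close>

lemma number_of_pairs:
  assumes "linked a s"
  shows "(\<Sum>y\<in>{y. y < words s x_M 0 \<and> n \<le> words s x_I y}. length (row_records s (words s x_M 0) (words s x_P y))) \<le> n * n"
proof -
  let ?M = "words s x_M 0" and ?I = "words s x_I" and ?P = "words s x_P"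
  let ?S = "SIGMA y:{y. y < ?M \<and> n \<le> ?I y}. {x. x < ?M \<and> ?I x < n \<and> ?P x = ?P y}"
  have inv: "block_inv n V a (min (a + D) n) ?M ?I ?P (words s x_B) (words s x_F)"
    using assms by (simp add: linked_def records_def)
  have "inj_on (\<lambda>(y, x). (?I x, ?I y)) ?S"
  proof (rule inj_onI, clarify)
    fix y x y' x' assume *: "y < ?M" "n \<le> ?I y" "x < ?M" "?I x < n" "?P x = ?P y"
      "y' < ?M" "n \<le> ?I y'" "x' < ?M" "?I x' < n" "?P x' = ?P y'" "?I x = ?I x'" "?I y = ?I y'"
    have "(x, y) = (x', y')"
      by (rule inj_onD[OF block_invD(7)[OF inv]]) (use * in auto)
    then show "y = y' \<and> x = x'" by simp
  qed
  moreover have "(\<lambda>(y, x). (?I x, ?I y)) ` ?S \<subseteq> {..<n} \<times> {n..<2 * n}"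
    using block_invD(1)[OF inv] by auto
  ultimately have "card ?S \<le> card ({..<n} \<times> {n..<2 * n})"
    by (rule card_inj_on_le) simp
  moreover have "card ?S = (\<Sum>y\<in>{y. y < ?M \<and> n \<le> ?I y}. card {x. x < ?M \<and> ?I x < n \<and> ?P x = ?P y})"
    by (rule card_SigmaI) auto
  ultimately show ?thesis by (simp add: row_records)
qed

lemma run_scan:
  assumes l: "linked a s" and best: "best_of ok wt X s"
    and ch: "\<And>q. chain (words s x_nx) (words s x_hd q) (row_records s (words s x_M 0) q)"
  shows "run B (scan_com h full) (\<lambda>t s'. t \<le> (400 + 10 * h) * (n * n) + 100 * Mx + 50 \<and>
     best_of ok wt (X \<union> (\<Union>i<n. \<Union>k<n. covered a i k)) s') s"
proof -
  let ?M = "words s x_M 0" and ?I = "words s x_I" and ?P = "words s x_P"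
  let ?R = "\<lambda>y. {x. x < ?M \<and> ?I x < n \<and> ?P x = ?P y}"
  let ?X = "\<lambda>r. X \<union> (\<Union>y\<in>{y. y < r \<and> n \<le> ?I y}. \<Union>x\<in>?R y. covered a (?I x) (?I y - n))"
  \<comment> \<open>The cost of a column record is the length of its list of rows; the bound
    \<open>n * n\<close> holds for the sum over all column records.\<close>
  let ?\<tau> = "\<lambda>r. (if n \<le> ?I r then (400 + 10 * h) * length (row_records s ?M (?P r)) else 0) + 80"
  have M: "?M \<le> Mx" using l records_le unfolding linked_def by blast
  have inv: "block_inv n V a (min (a + D) n) ?M ?I ?P (words s x_B) (words s x_F)"
    using l by (simp add: linked_def records_def)
  show ?thesis
    unfolding scan_com_def
    apply simp
    apply (intro conjI)
    subgoal using B by simp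
    apply (rule run_mono[OF run_While[where N = ?M and \<tau> = ?\<tau> and I = "\<lambda>r s'. words s' x_r 0 = r \<and> best_of ok wt (?X r) s'"]])
    subgoal using best by (simp add: best_of_write)
    subgoal premises p for r s1
    proof -
      have same: "same_except (scan_com h full) s s1"
        using p(3) by (auto simp: same_except_def)
      have l1: "linked a s1" by (rule linked_same_except[OF l same]) simp_all
      have vals: "words s1 x_M = words s x_M" "words s1 x_I = ?I" "words s1 x_P = ?P" "words s1 x_n 0 = n"
          "words s1 x_nx = words s x_nx" "words s1 x_hd = words s x_hd"
        using same l by (simp_all add: same_except_def linked_def scan_ready_def ready_def)
      have rows: "row_records s1 k q = row_records s k q" for k q by (simp add: row_records_def vals)
      have rB: "Suc r < B" using p(1) M B by linarith
      show ?thesis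
      proof (cases "?I r < n")
        case True
        then have "?X (Suc r) = ?X r" by (auto simp: less_Suc_eq)
        then show ?thesis using True p rB by (simp add: vals best_of_write)
      next
        case False
        then have X: "?X (Suc r) = ?X r \<union> (\<Union>x\<in>?R r. covered a (?I x) (?I r - n))"
          by (auto simp: less_Suc_eq)
        define Q where "Q = best_of ok wt (?X (Suc r))"
        define T where "T = (400 + 10 * h) * length (row_records s ?M (?P r))"
        have Q_write: "Q (write_word x_r 0 v s') = Q s'" for v s'
          by (simp add: Q_def best_of_write)
        have T: "(if n \<le> ?I r then (400 + 10 * h) * length (row_records s ?M (?P r)) else 0) = T"
          using False by (simp add: T_def)
        have r1: "words s1 x_r 0 = r" using p(2) by simp
        have "run B (walk_com h full) (\<lambda>t s'. t \<le> T + 50 \<and> Q s') s1"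
        proof (rule run_mono[OF run_walk[OF l1 p(2)[THEN conjunct2] r1, of "row_records s ?M (?P r)"]])
          show "r < words s1 x_M 0" "n \<le> words s1 x_I r" using p(1) False by (simp_all only: vals)
          show "chain (words s1 x_nx) (words s1 x_hd (words s1 x_P r)) (row_records s ?M (?P r))"
            unfolding vals by (rule ch)
          show "row_records s ?M (?P r) = row_records s1 (words s1 x_M 0) (words s1 x_P r)"
            unfolding vals rows ..
        qed (simp only: Q_def X T_def vals row_records(1))
        then have w: "run B (walk_com h full) (\<lambda>t s'. t \<le> T + 50 \<and> Q s' \<and> words s' x_r 0 = r) s1"
          by (rule run_mono_frame) (use r1 in \<open>simp add: same_except_def\<close>)
        show ?thesis
          unfolding Q_def[symmetric] T
          using False p(1) r1 by (simp add: vals) (rule run_mono[OF w], simp add: Q_write rB)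
      qed
    qed
    subgoal premises p for s1
      using p by (simp add: same_except_def)
    subgoal premises p for t s1
    proof -
      have "(\<Sum>r<?M. ?\<tau> r + 1 + bcost (WLt (Var x_r) (Var x_M))) =
          (400 + 10 * h) * (\<Sum>r<?M. if n \<le> ?I r then length (row_records s ?M (?P r)) else 0) + 87 * ?M"
        by (simp add: sum.distrib sum_distrib_left if_distrib[of "\<lambda>x. _ * x"] cong: if_cong)
      also have "(\<Sum>r<?M. if n \<le> ?I r then length (row_records s ?M (?P r)) else 0) =
          (\<Sum>y\<in>{y. y < ?M \<and> n \<le> ?I y}. length (row_records s ?M (?P y)))"
        by (simp add: sum.inter_filter[symmetric] lessThan_def conj_commute)
      also have "(400 + 10 * h) * \<dots> + 87 * ?M \<le> (400 + 10 * h) * (n * n) + 87 * Mx"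
        by (intro add_le_mono mult_le_mono2 number_of_pairs[OF l] M)
      finally have time: "t \<le> (400 + 10 * h) * (n * n) + 87 * Mx + 10" using p by simp
      \<comment> \<open>The existence part of the invariant enters here: every row meets every
        column in some problem.\<close>
      have "(\<Union>i<n. \<Union>k<n. covered a i k) \<subseteq> ?X ?M"
      proof (rule subsetI)
        fix f assume "f \<in> (\<Union>i<n. \<Union>k<n. covered a i k)"
        then obtain i k where ik: "i < n" "k < n" and f: "f \<in> covered a i k" by auto
        obtain x y where "x < ?M" "y < ?M" "?I x = i" "?I y = n + k" "?P x = ?P y"
          using block_invD(6)[OF inv ik] by blast
        then show "f \<in> ?X ?M"
          using ik f by (intro UnI2 UN_I[of y] UN_I[of x]) auto
      qed
      then have "best_of ok wt (X \<union> (\<Union>i<n. \<Union>k<n. covered a i k)) s1"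
        using p by (elim conjE best_of_mono) blast
      then show ?thesis using time by simp
    qed
    done
qed

lemma run_clear:
  assumes l: "linked a s" and ch: "\<And>q. chain (words s x_nx) (words s x_hd q) (row_records s (words s x_M 0) q)"
  shows "run B clear_com (\<lambda>t s'. t \<le> 50 * Mx + 50 \<and> words s' x_hd = (\<lambda>_. 0)) s"
proof -
  let ?M = "words s x_M 0" and ?P = "words s x_P"
  have M: "?M \<le> Mx" using l records_le unfolding linked_def by blast
  have out: "words s x_hd q = 0" if "\<forall>r<?M. ?P r \<noteq> q" for q
  proof -
    have "row_records s ?M q = []" using that by (auto simp: row_records_def)
    then show ?thesis using ch[of q] by simp
  qed
  show ?thesis
    unfolding clear_com_def
    apply simp
    apply (intro conjI)
    subgoal using B by simp
    apply (rule run_While_const[where N = ?M and \<tau> = 30 and I = "\<lambda>k s'. words s' x_r 0 = k \<and>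
       (\<forall>q. words s' x_hd q = (if \<exists>r<k. ?P r = q then 0 else words s x_hd q))"])
    subgoal by simp
    subgoal premises p for k s1
    proof -
      have "words s1 x_M = words s x_M" "words s1 x_P = ?P"
        using p(3) by (simp_all add: same_except_def)
      moreover have "Suc k < B" using p(1) M B by linarith
      ultimately show ?thesis using p(1,2) B by (auto simp: less_Suc_eq)
    qed
    subgoal premises p for s1
      using p by (simp add: same_except_def)
    subgoal premises p for t s1
    proof -
      have "words s1 x_hd = (\<lambda>_. 0)"
        using p(2) out by (auto simp: fun_eq_iff)
      moreover have "?M * 40 \<le> Mx * 40" using M by (rule mult_le_mono1)
      ultimately show ?thesis using p(1) by simp
    qed
    done
qed

lemma run_block:
  assumes r: "scan_ready a s" and a: "a < n" "0 < D" and hd: "words s x_hd = (\<lambda>_. 0)"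
    and best: "best_of ok wt X s"
  shows "run B (block_com h full) (\<lambda>t s'. t \<le> 4000 * ((Mx + 1) * (Lb + 1)) * (D + 1) + (400 + 10 * h) * (n * n) \<and>
     words s' x_hd = (\<lambda>_. 0) \<and> best_of ok wt (X \<union> (\<Union>i<n. \<Union>k<n. covered a i k)) s') s"
proof -
  have rd: "ready a s" using r by (simp add: scan_ready_def)
  show ?thesis
    unfolding block_com_def run_Seq
    apply (rule run_mono_frame[OF run_phases[OF rd a(2,1)]])
    subgoal premises p1 for t1 s1
    proof -
      have "scan_ready a s1" using r p1(2) by (simp add: scan_ready_def ready_def same_except_def)
      then have l1: "linked a s1" using p1(1) by (simp add: linked_def)
      have hd1: "words s1 x_hd = (\<lambda>_. 0)" using hd p1(2) by (simp add: same_except_def)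
      have best1: "best_of ok wt X s1" by (rule best_of_same_except[OF best p1(2)]) simp_all
      show ?thesis
        apply (rule run_mono_frame[OF run_link[OF l1 hd1]])
        subgoal premises p2 for t2 s2
        proof -
          have l2: "linked a s2" by (rule linked_same_except[OF l1 p2(2)]) simp_all
          have best2: "best_of ok wt X s2" by (rule best_of_same_except[OF best1 p2(2)]) simp_all
          have rows2: "row_records s2 (words s2 x_M 0) q = row_records s1 (words s1 x_M 0) q" for q
            using p2(2) by (simp add: same_except_def row_records_def)
          have ch2: "chain (words s2 x_nx) (words s2 x_hd q) (row_records s2 (words s2 x_M 0) q)" for q
            using p2(1) by (simp add: rows2)
          show ?thesis
            apply (rule run_mono_frame[OF run_scan[OF l2 best2 ch2]])
            subgoal premises p3 for t3 s3
            proof -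
              have l3: "linked a s3" by (rule linked_same_except[OF l2 p3(2)]) simp_all
              have "row_records s3 (words s3 x_M 0) q = row_records s2 (words s2 x_M 0) q" for q
                using p3(2) by (simp add: same_except_def row_records_def)
              then have ch3: "chain (words s3 x_nx) (words s3 x_hd q) (row_records s3 (words s3 x_M 0) q)" for q
                using ch2[of q] p3(2) by (simp add: same_except_def)
              show ?thesis
                apply (rule run_mono_frame[OF run_clear[OF l3 ch3]])
                subgoal premises p4 for t4 s4
                proof -
                  define Z where "Z = (Mx + 1) * (Lb + 1) * (D + 1)"
                  have "Mx + 1 \<le> Z" by (simp add: Z_def)
                  moreover have "t1 \<le> 3000 * Z" using p1(1)[THEN conjunct1] by (simp only: Z_def mult.assoc)
                  ultimately have "t1 + (t2 + (t3 + t4)) \<le> 4000 * Z + (400 + 10 * h) * (n * n)"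
                    using p2(1)[THEN conjunct1] p3(1)[THEN conjunct1] p4(1)[THEN conjunct1] by linarith
                  moreover have "best_of ok wt (X \<union> (\<Union>i<n. \<Union>k<n. covered a i k)) s4"
                    by (rule best_of_same_except[OF p3(1)[THEN conjunct2] p4(2)]) simp_all
                  ultimately show ?thesis using p4(1) by (simp only: Z_def mult.assoc simp_thms)
                qed
                done
            qed
            done
        qed
        done
    qed
    done
qed

end

section \<open>All tuples\<close>

definition blocks_com :: "nat \<Rightarrow> nat \<Rightarrow> com" where
  "blocks_com h full =
     set0 x_s (WConst 0) ;;
     While (WLt (Var x_s) (Var x_n)) (block_com h full ;; set0 x_s (WAdd (Var x_s) (Var x_D)))"

lemmas mod_blocks [simp] =
  blocks_com_def[THEN arg_cong, of wmod, unfolded wmod.simps mod_block Un_insert_left Un_empty_left]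
  blocks_com_def[THEN arg_cong, of rmod, unfolded rmod.simps mod_block Un_empty_left Un_empty_right]

context scan begin

lemma run_blocks:
  assumes r: "scan_ready a s" and D: "0 < D" and hd: "words s x_hd = (\<lambda>_. 0)"
    and best: "best_of ok wt X s"
  shows "run B (blocks_com h full)
     (\<lambda>t s'. t \<le> (n div D + 1) * (4000 * ((Mx + 1) * (Lb + 1)) * (D + 1) + (400 + 10 * h) * (n * n) + 50) + 50 \<and>
     words s' x_hd = (\<lambda>_. 0) \<and> best_of ok wt (X \<union> {tuple u i j k | i j k. i < n \<and> j < n \<and> k < n}) s') s"
proof -
  define N where "N = (LEAST N. n \<le> N * D)"
  have ex: "n \<le> n * D" using D by simp
  have N1: "n \<le> N * D" unfolding N_def using ex by (rule LeastI)
  have N2: "k * D < n" if "k < N" for k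
    using not_less_Least[of k "\<lambda>N. n \<le> N * D"] that by (simp add: N_def not_le)
  have "n \<le> (n div D + 1) * D"
    using div_mult_mod_eq[of n D] mod_less_divisor[OF D, of n]
    unfolding add_mult_distrib mult_1 by linarith
  then have N3: "N \<le> n div D + 1" unfolding N_def by (rule Least_le)
  let ?X = "\<lambda>k. X \<union> {tuple u i j k' | i j k'. i < n \<and> j < min (k * D) n \<and> k' < n}"
  define T where "T = 4000 * ((Mx + 1) * (Lb + 1)) * (D + 1) + (400 + 10 * h) * (n * n)"
  have step: "?X (Suc k) \<subseteq> ?X k \<union> (\<Union>i<n. \<Union>k'<n. covered (k * D) i k')" for k
  proof (rule subsetI)
    fix f assume "f \<in> ?X (Suc k)"
    then consider "f \<in> X" | i j k' where "f = tuple u i j k'" "i < n" "j < min (Suc k * D) n" "k' < n"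
      by blast
    then show "f \<in> ?X k \<union> (\<Union>i<n. \<Union>k'<n. covered (k * D) i k')"
    proof cases
      case 2
      show ?thesis
      proof (cases "j < k * D")
        case True
        then have "f \<in> ?X k" using 2 by auto
        then show ?thesis by (rule UnI1)
      next
        case False
        then have "f \<in> covered (k * D) i k'" using 2 by (auto simp: covered_def)
        then have "f \<in> (\<Union>i<n. \<Union>k'<n. covered (k * D) i k')" using 2 by blast
        then show ?thesis by (rule UnI2)
      qed
    qed simp
  qed
  \<comment> \<open>The position of the next block is written even when it passes \<open>n\<close>.
    Its bound comes from \<open>Mx\<close>: for positive \<open>n\<close> the growth condition
    yields \<open>3 ^ D <= Mx\<close>, and \<open>D < 3 ^ D\<close>.\<close>
  have DB: "k * D + D < B" if "k < N" for k
  proof -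
    have n: "k * D < n" using N2[OF that] .
    then have "1 * 1 \<le> 2 * real n * (3/2) ^ L"
      by (intro mult_mono one_le_power) auto
    then have "1 * 1 * 3 ^ D \<le> 2 * real n * (3/2) ^ L * 3 ^ D"
      by (rule mult_right_mono) simp
    then have "real (3 ^ D) \<le> real Mx" using Mx(1) by (simp only: of_nat_power of_nat_numeral mult_1)
    then have "3 ^ D \<le> Mx" by (simp only: of_nat_le_iff)
    moreover have "D < 3 ^ D" by (rule power_gt_expt) simp
    ultimately show ?thesis using n B by linarith
  qed
  show ?thesis
    unfolding blocks_com_def T_def[symmetric]
    apply simp
    apply (intro conjI)
    subgoal using B by simp
    apply (rule run_While_const[where N = N and \<tau> = "T + 20" and
       I = "\<lambda>k s'. scan_ready (k * D) s' \<and> words s' x_hd = (\<lambda>_. 0) \<and> best_of ok wt (?X k) s'"])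
    subgoal using r hd best by (auto simp: scan_ready_def ready_def best_of_write)
    subgoal premises p for k s1
    proof -
      have kn: "k * D < n" using N2 p(1) .
      have "run B (block_com h full) (\<lambda>t s'. t \<le> T \<and> scan_ready (k * D) s' \<and> words s' x_hd = (\<lambda>_. 0) \<and> best_of ok wt (?X (Suc k)) s') s1"
      proof (rule run_mono_frame[OF run_block[of "k * D" s1, folded T_def]])
        fix t s2
        assume *: "t \<le> T \<and> words s2 x_hd = (\<lambda>_. 0) \<and> best_of ok wt (?X k \<union> (\<Union>i<n. \<Union>k'<n. covered (k * D) i k')) s2"
          "same_except (block_com h full) s1 s2"
        have "scan_ready (k * D) s2" using p(2) *(2) by (simp add: scan_ready_def ready_def same_except_def)
        then show "t \<le> T \<and> scan_ready (k * D) s2 \<and> words s2 x_hd = (\<lambda>_. 0) \<and> best_of ok wt (?X (Suc k)) s2"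
          using * best_of_mono[OF _ step] by blast
      qed (use p kn D in auto)
      moreover have "words s1 x_s 0 < words s1 x_n 0" using p(2) kn by (simp add: scan_ready_def ready_def)
      ultimately show ?thesis
        using DB[OF p(1)]
        by (auto simp: best_of_write scan_ready_def ready_def add.commute elim!: run_mono)
    qed
    subgoal premises p for s1
      using p(1) N1 by (simp add: scan_ready_def ready_def)
    subgoal premises p for t s1
    proof -
      have "N * (T + 20 + 1 + bcost (WLt (Var x_s) (Var x_n))) \<le> (n div D + 1) * (T + 50)"
        by (rule mult_le_mono[OF N3]) simp
      moreover have "1 + bcost (WLt (Var x_s) (Var x_n)) \<le> 40" by simp
      ultimately have "t \<le> (n div D + 1) * (T + 50) + 40" using p(1) by linarith
      moreover have "?X N = X \<union> {tuple u i j k | i j k. i < n \<and> j < n \<and> k < n}"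
        using N1 by (simp add: min_absorb2)
      ultimately show ?thesis using p(2) by simp
    qed
    done
qed

end

text \<open>For a 0-1 matrix \<open>aw\<close> the value is 1 if the pair is mapped correctly and 0
  otherwise. Equal images are excluded for a non-edge of \<open>E\<close> by the last subtrahend,
  and for an edge by the zero diagonal of the adjacency matrix.\<close>

definition pair_good :: "(nat \<Rightarrow> nat \<Rightarrow> bool) \<Rightarrow> nat \<Rightarrow> (nat \<Rightarrow> nat) \<Rightarrow> (nat \<Rightarrow> nat) \<Rightarrow> nat \<times> nat \<Rightarrow> nat" where
  "pair_good E n aw f = (\<lambda>(p, q). if E p q then aw (f p * n + f q)
     else 1 - aw (f p * n + f q) - (if f p = f q then 1 else 0))"

definition pair_weight :: "nat \<Rightarrow> (nat \<Rightarrow> real) \<Rightarrow> (nat \<Rightarrow> nat) \<Rightarrow> nat \<times> nat \<Rightarrow> real" where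
  "pair_weight n rw f = (\<lambda>(p, q). rw (f p * n + f q))"

definition pair_cell :: "nat \<times> nat \<Rightarrow> wexp" where
  "pair_cell = (\<lambda>(p, q). WAdd (WMul (Arr x_u (WConst p)) (Var x_n)) (Arr x_u (WConst q)))"

text \<open>\<open>E\<close> describes the fixed graph, so the case distinction is made when the
  program is constructed. With truncated subtraction the final product is the indicator of
  \<open>u = v\<close>.\<close>

definition good_exp :: "(nat \<Rightarrow> nat \<Rightarrow> bool) \<Rightarrow> nat \<times> nat \<Rightarrow> wexp" where
  "good_exp E = (\<lambda>(p, q). if E p q then Arr x_adj (pair_cell (p, q))
     else (let u = Arr x_u (WConst p); v = Arr x_u (WConst q) in
       WSub (WSub (WConst 1) (Arr x_adj (pair_cell (p, q))))
         (WMul (WSub (WConst 1) (WSub u v)) (WSub (WConst 1) (WSub v u)))))"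

fun good_sum :: "(nat \<Rightarrow> nat \<Rightarrow> bool) \<Rightarrow> (nat \<times> nat) list \<Rightarrow> wexp" where
  "good_sum E [] = WConst 0"
| "good_sum E (x # xs) = WAdd (good_exp E x) (good_sum E xs)"

text \<open>The real cell \<open>x_n\<close> is never written, so it supplies the constant 0.\<close>

fun weight_sum :: "(nat \<times> nat) list \<Rightarrow> rexp" where
  "weight_sum [] = RRead x_n (WConst 0)"
| "weight_sum (x # xs) = RAdd (RRead x_w (pair_cell x)) (weight_sum xs)"

definition sum_good where "sum_good E n aw ps f = (\<Sum>x\<leftarrow>ps. pair_good E n aw f x)"
definition sum_weight where "sum_weight n rw ps f = (\<Sum>x\<leftarrow>ps. pair_weight n rw f x)"

lemma equality_indicator: "(Suc 0 - (x - y)) * (Suc 0 - (y - x)) = (if x = y then 1 else 0)"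
  by (cases "x < y") auto

lemma wval_good_sum: "wval (good_sum E ps) s = sum_good E (words s x_n 0) (words s x_adj) ps (words s x_u)"
proof (induction ps)
  case (Cons x ps)
  have "wval (good_exp E x) s = pair_good E (words s x_n 0) (words s x_adj) (words s x_u) x"
    by (cases x) (simp add: good_exp_def pair_good_def pair_cell_def Let_def equality_indicator)
  then show ?case using Cons.IH by (simp add: sum_good_def)
qed (simp add: sum_good_def)

lemma rval_weight_sum: "reals s x_n 0 = 0 \<Longrightarrow>
    rval (weight_sum ps) s = sum_weight (words s x_n 0) (reals s x_w) ps (words s x_u)"
  by (induction ps) (auto simp: sum_weight_def pair_weight_def pair_cell_def)

lemma wcost_good_sum: "wcost (good_sum E ps) \<le> 40 * length ps + 1"
proof (induction ps)
  case (Cons x ps)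
  have "wcost (good_exp E x) \<le> 39"
    by (cases x) (auto simp: good_exp_def pair_cell_def Let_def)
  then show ?case using Cons.IH by simp
qed simp

lemma rcost_weight_sum: "rcost (weight_sum ps) \<le> 40 * length ps + 2"
  by (induction ps) (auto simp: pair_cell_def)

lemma sum_good_cong:
  "(\<And>p q. (p, q) \<in> set ps \<Longrightarrow> f p = g p \<and> f q = g q) \<Longrightarrow> sum_good E n aw ps f = sum_good E n aw ps g"
  unfolding sum_good_def by (rule arg_cong[where f = sum_list], rule map_cong) (auto simp: pair_good_def)

lemma sum_weight_cong:
  "(\<And>p q. (p, q) \<in> set ps \<Longrightarrow> f p = g p \<and> f q = g q) \<Longrightarrow> sum_weight n rw ps f = sum_weight n rw ps g"
  unfolding sum_weight_def by (rule arg_cong[where f = sum_list], rule map_cong) (auto simp: pair_weight_def)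

lemma sum_good_le: "(\<And>x. aw x \<le> 1) \<Longrightarrow> sum_good E n aw ps f \<le> length ps"
proof (induction ps)
  case (Cons x ps)
  then have "pair_good E n aw f x \<le> 1" by (auto simp: pair_good_def split: prod.splits)
  then show ?case using Cons by (simp add: sum_good_def)
qed (simp add: sum_good_def)

definition all_pairs :: "nat \<Rightarrow> (nat \<times> nat) list" where
  "all_pairs h = filter (\<lambda>(p, q). p < q) (List.product [0..<h] [0..<h])"

text \<open>The pairs of a tuple \<open>u\<close> are divided among three matrices, indexed by
  \<open>(u 0, u 1)\<close>, \<open>(u 1, u 2)\<close> and \<open>(u 0, u 2)\<close>.\<close>

definition pairs01 :: "nat \<Rightarrow> (nat \<times> nat) list" where
  "pairs01 h = filter (\<lambda>(p, q). p = 0 \<and> q \<noteq> 2) (all_pairs h)"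
definition pairs12 :: "nat \<Rightarrow> (nat \<times> nat) list" where
  "pairs12 h = filter (\<lambda>(p, q). p = 1) (all_pairs h)"
definition pairs02 :: "nat \<Rightarrow> (nat \<times> nat) list" where
  "pairs02 h = filter (\<lambda>(p, q). \<not> (p = 0 \<and> q \<noteq> 2) \<and> p \<noteq> 1) (all_pairs h)"

lemma set_all_pairs: "set (all_pairs h) = {(p, q). p < q \<and> q < h}"
  by (auto simp: all_pairs_def)

text \<open>Each group avoids one of the coordinates 0, 1, 2, so its sum depends only on the other
  two once the tail of the tuple is fixed.\<close>

lemma set_pairs:
  "(p, q) \<in> set (pairs01 h) \<Longrightarrow> p = 0 \<and> q \<noteq> 0 \<and> q \<noteq> 2"
  "(p, q) \<in> set (pairs12 h) \<Longrightarrow> p = 1 \<and> 2 \<le> q"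
  "(p, q) \<in> set (pairs02 h) \<Longrightarrow> p \<noteq> 1 \<and> q \<noteq> 1"
  by (auto simp: pairs01_def pairs12_def pairs02_def set_all_pairs)

lemma sum_list_pairs:
  fixes g :: "nat \<times> nat \<Rightarrow> 'v::comm_monoid_add"
  shows "(\<Sum>x\<leftarrow>pairs01 h. g x) + (\<Sum>x\<leftarrow>pairs12 h. g x) + (\<Sum>x\<leftarrow>pairs02 h. g x) = (\<Sum>x\<leftarrow>all_pairs h. g x)"
proof -
  have "(\<Sum>x\<leftarrow>filter P ps. g x) + (\<Sum>x\<leftarrow>filter Q ps. g x) + (\<Sum>x\<leftarrow>filter R ps. g x) = (\<Sum>x\<leftarrow>ps. g x)"
    if "\<And>x. P x \<and> \<not> Q x \<and> \<not> R x \<or> \<not> P x \<and> Q x \<and> \<not> R x \<or> \<not> P x \<and> \<not> Q x \<and> R x" for P Q R ps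
  proof (induction ps)
    case (Cons x ps)
    show ?case using that[of x] by (auto simp: Cons.IH[symmetric] add_ac)
  qed simp
  then show ?thesis unfolding pairs01_def pairs12_def pairs02_def by this auto
qed

lemma length_pairs: "length (pairs01 h) \<le> length (all_pairs h)" "length (pairs12 h) \<le> length (all_pairs h)"
   "length (pairs02 h) \<le> length (all_pairs h)"
  by (auto simp: pairs01_def pairs12_def pairs02_def)

text \<open>The index \<open>a\<close> stands for the cell \<open>(a div n, a mod n)\<close>. The
  second matrix is stored transposed and shifted by \<open>n * n\<close>: row \<open>n + k\<close>
  of the common table belongs to the value \<open>k\<close> of coordinate 2, and its entries are
  indexed by coordinate 1.\<close>

definition build_com :: "(nat \<Rightarrow> nat \<Rightarrow> bool) \<Rightarrow> nat \<Rightarrow> com" where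
  "build_com E h =
     set0 x_a (WConst 0) ;;
     While (WLt (Var x_a) (WMul (Var x_n) (Var x_n)))
       (WWrite x_u (WConst 0) (WDiv (Var x_a) (Var x_n)) ;;
        WWrite x_u (WConst 1) (WMod (Var x_a) (Var x_n)) ;;
        WWrite x_gP (Var x_a) (good_sum E (pairs01 h)) ;;
        RWrite x_rP (Var x_a) (weight_sum (pairs01 h)) ;;
        WWrite x_u (WConst 2) (WDiv (Var x_a) (Var x_n)) ;;
        WWrite x_gQ (WAdd (WMul (Var x_n) (Var x_n)) (Var x_a)) (good_sum E (pairs12 h)) ;;
        RWrite x_rQ (WAdd (WMul (Var x_n) (Var x_n)) (Var x_a)) (weight_sum (pairs12 h)) ;;
        WWrite x_u (WConst 2) (WMod (Var x_a) (Var x_n)) ;;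
        WWrite x_gC (Var x_a) (good_sum E (pairs02 h)) ;;
        RWrite x_rC (Var x_a) (weight_sum (pairs02 h)) ;;
        inc x_a)"

lemmas mod_build [simp] =
  build_com_def[THEN arg_cong, of wmod, unfolded wmod.simps Un_insert_left Un_empty_left]
  build_com_def[THEN arg_cong, of rmod, unfolded rmod.simps Un_insert_left Un_empty_left Un_empty_right]

definition built :: "(nat \<Rightarrow> nat \<Rightarrow> bool) \<Rightarrow> nat \<Rightarrow> nat \<Rightarrow> (nat \<Rightarrow> nat) \<Rightarrow> (nat \<Rightarrow> real) \<Rightarrow> (nat \<Rightarrow> nat) \<Rightarrow> nat \<Rightarrow> store \<Rightarrow> bool" where
  "built E h n aw rw u k s \<longleftrightarrow> (\<forall>x<k.
     words s x_gP x = sum_good E n aw (pairs01 h) (tuple u (x div n) (x mod n) 0) \<and>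
     reals s x_rP x = sum_weight n rw (pairs01 h) (tuple u (x div n) (x mod n) 0) \<and>
     words s x_gQ (n * n + x) = sum_good E n aw (pairs12 h) (tuple u 0 (x mod n) (x div n)) \<and>
     reals s x_rQ (n * n + x) = sum_weight n rw (pairs12 h) (tuple u 0 (x mod n) (x div n)) \<and>
     words s x_gC x = sum_good E n aw (pairs02 h) (tuple u (x div n) 0 (x mod n)) \<and>
     reals s x_rC x = sum_weight n rw (pairs02 h) (tuple u (x div n) 0 (x mod n)))"

definition padded :: "nat \<Rightarrow> store \<Rightarrow> bool" where
  "padded n s \<longleftrightarrow> (\<forall>x\<ge>n * n. words s x_gP x = 0 \<and> reals s x_rP x = 0) \<and>
     (\<forall>x<n * n. words s x_gQ x = 0 \<and> reals s x_rQ x = 0)"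

lemma run_build:
  assumes s: "words s x_n 0 = n" "words s x_adj = aw" "reals s x_w = rw" "reals s x_n 0 = 0" "padded n s"
    and aw: "\<And>x. aw x \<le> 1" and B: "n * n < B" "length (all_pairs h) < B"
    and u: "\<And>r. 3 \<le> r \<Longrightarrow> words s x_u r = u r"
  shows "run B (build_com E h) (\<lambda>t s'. t \<le> n * n * (300 * (length (all_pairs h) + 1)) + 50 \<and>
     built E h n aw rw u (n * n) s' \<and> padded n s' \<and> (\<forall>r\<ge>3. words s' x_u r = u r)) s"
  unfolding build_com_def
  apply simp
  apply (intro conjI)
  subgoal using B by simp
  apply (rule run_While_const[where N = "n * n" and \<tau> = "250 * (length (all_pairs h) + 1)" and
     I = "\<lambda>k s'. words s' x_a 0 = k \<and> built E h n aw rw u k s' \<and> padded n s' \<and> (\<forall>r\<ge>3. words s' x_u r = u r)"])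
  subgoal using s u by (simp add: built_def padded_def)
  subgoal premises p for k s1
  proof -
    have vals: "words s1 x_n 0 = n" "words s1 x_adj = aw" "reals s1 x_w = rw" "reals s1 x_n 0 = 0"
      using s p(3) by (simp_all add: same_except_def)
    have n: "0 < n" using p(1) by (cases n) auto
    let ?i = "k div n" and ?j = "k mod n"
    let ?g0 = "(words s1 x_u)(0 := ?i, Suc 0 := ?j)"
    have u1: "words s1 x_u r = u r" if "r \<noteq> 0" "r \<noteq> Suc 0" "r \<noteq> 2" for r
      using p(2) that by auto
    have "(p, q) \<in> set (pairs01 h) \<Longrightarrow> (?g0) p = tuple u ?i ?j 0 p \<and> (?g0) q = tuple u ?i ?j 0 q" for p q
      using set_pairs(1)[of p q h] by (simp add: tuple_def u1)
    note g0 = sum_good_cong[OF this] sum_weight_cong[OF this]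
    have "(p, q) \<in> set (pairs12 h) \<Longrightarrow> (?g0(2 := ?i)) p = tuple u 0 ?j ?i p \<and> (?g0(2 := ?i)) q = tuple u 0 ?j ?i q" for p q
      using set_pairs(2)[of p q h] by (simp add: tuple_def u1)
    note g1 = sum_good_cong[OF this] sum_weight_cong[OF this]
    have "(p, q) \<in> set (pairs02 h) \<Longrightarrow> (?g0(2 := ?j)) p = tuple u ?i 0 ?j p \<and> (?g0(2 := ?j)) q = tuple u ?i 0 ?j q" for p q
      using set_pairs(3)[of p q h] by (simp add: tuple_def u1)
    note g2 = sum_good_cong[OF this] sum_weight_cong[OF this]
    have bnd: "sum_good E n aw ps f < B" if "length ps \<le> length (all_pairs h)" for ps f
      using sum_good_le[of aw E n ps f, OF aw] that B by linarith
    have "?i \<le> k" "?j \<le> k" by auto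
    then have idx: "?i < B" "?j < B" "Suc k < B" using p(1) B by linarith+
    have cost: "wcost (good_sum E ps) \<le> 40 * length (all_pairs h) + 1" "rcost (weight_sum ps) \<le> 40 * length (all_pairs h) + 2"
      if "length ps \<le> length (all_pairs h)" for ps
      using wcost_good_sum[of E ps] rcost_weight_sum[of ps] that by linarith+
    have built: "built E h n aw rw u (Suc k) s'"
      if "words s' x_gP = (words s1 x_gP)(k := sum_good E n aw (pairs01 h) (tuple u ?i ?j 0))"
        "reals s' x_rP = (reals s1 x_rP)(k := sum_weight n rw (pairs01 h) (tuple u ?i ?j 0))"
        "words s' x_gQ = (words s1 x_gQ)(n * n + k := sum_good E n aw (pairs12 h) (tuple u 0 ?j ?i))"
        "reals s' x_rQ = (reals s1 x_rQ)(n * n + k := sum_weight n rw (pairs12 h) (tuple u 0 ?j ?i))"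
        "words s' x_gC = (words s1 x_gC)(k := sum_good E n aw (pairs02 h) (tuple u ?i 0 ?j))"
        "reals s' x_rC = (reals s1 x_rC)(k := sum_weight n rw (pairs02 h) (tuple u ?i 0 ?j))" for s'
      using p(2) unfolding built_def that by (simp add: less_Suc_eq)
    have padded: "padded n s'"
      if "words s' x_gP = (words s1 x_gP)(k := a)" "reals s' x_rP = (reals s1 x_rP)(k := b)"
        "words s' x_gQ = (words s1 x_gQ)(n * n + k := c)" "reals s' x_rQ = (reals s1 x_rQ)(n * n + k := d)" for s' a b c d
      using p(1,2) unfolding padded_def that by simp
    show ?thesis
      using p(1) p(2)[THEN conjunct1] p(2)[THEN conjunct2, THEN conjunct2, THEN conjunct2]
        cost[OF length_pairs(1)[of h]] cost[OF length_pairs(2)[of h]] cost[OF length_pairs(3)[of h]]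
      by (simp add: vals idx wval_good_sum rval_weight_sum g0 g1 g2 bnd length_pairs built padded)
  qed
  subgoal premises p for s1
    using p s by (simp add: same_except_def)
  subgoal premises p for t s1
    using p by (simp add: algebra_simps)
  done

text \<open>The number of correct pairs of a tuple takes precedence over its weight. Adding a large multiple of
  the former to the latter turns this lexicographic order into the order of the reals.\<close>

definition lex_potential ::
    "nat \<Rightarrow> (nat \<Rightarrow> nat) \<Rightarrow> (nat \<Rightarrow> nat) \<Rightarrow> (nat \<Rightarrow> real) \<Rightarrow> (nat \<Rightarrow> real) \<Rightarrow> (nat \<Rightarrow> nat \<Rightarrow> real) \<Rightarrow> bool" where
  "lex_potential n gp gq rp rq V \<longleftrightarrow> (\<forall>x y b t. x < 2 * n \<longrightarrow> y < 2 * n \<longrightarrow> b < n \<longrightarrow> t < n \<longrightarrow>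
    (V x b - V x t \<le> V y b - V y t \<longleftrightarrow>
      cross n gp gq x y b t < cross n gp gq y x b t \<or>
      cross n gp gq x y b t = cross n gp gq y x b t \<and> cross n rp rq x y b t \<le> cross n rp rq y x b t))"

lemma lex_potential_exists: "\<exists>V. lex_potential n gp gq rp rq V"
proof -
  define S where "S = (\<Sum>c<2 * n * n. \<bar>rp c\<bar> + \<bar>rq c\<bar>)"
  \<comment> \<open>A crossed sum has four terms of absolute value at most \<open>S\<close>, so two
    such sums differ by at most \<open>8 * S < R\<close>: one unit of count outweighs every
    difference of weights.\<close>
  define R where "R = 8 * S + 1"
  define V where "V x j = (rp (x * n + j) - rq (x * n + j)) + R * (real (gp (x * n + j)) - real (gq (x * n + j)))" for x j
  have S: "rp (x * n + j) \<le> S" "- S \<le> rp (x * n + j)" "rq (x * n + j) \<le> S" "- S \<le> rq (x * n + j)"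
    if "x < 2 * n" "j < n" for x j
  proof -
    have "x * n + j < 2 * n * n" using that by (rule cell_less)
    then have "\<bar>rp (x * n + j)\<bar> + \<bar>rq (x * n + j)\<bar> \<le> S" unfolding S_def by (intro member_le_sum) auto
    then show "rp (x * n + j) \<le> S" "- S \<le> rp (x * n + j)" "rq (x * n + j) \<le> S" "- S \<le> rq (x * n + j)"
      by linarith+
  qed
  have "V x b - V x t \<le> V y b - V y t \<longleftrightarrow>
      cross n gp gq x y b t < cross n gp gq y x b t \<or>
      cross n gp gq x y b t = cross n gp gq y x b t \<and> cross n rp rq x y b t \<le> cross n rp rq y x b t"
    if "x < 2 * n" "y < 2 * n" "b < n" "t < n" for x y b t
  proof -
    define X Y where "X = cross n rp rq x y b t" and "Y = cross n rp rq y x b t"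
    define G K where "G = cross n gp gq x y b t" and "K = cross n gp gq y x b t"
    have "X \<le> 4 * S" "- (4 * S) \<le> X" "Y \<le> 4 * S" "- (4 * S) \<le> Y"
      using S[OF that(1,3)] S[OF that(1,4)] S[OF that(2,3)] S[OF that(2,4)]
      unfolding X_def Y_def cross_def by linarith+
    then have XY: "X - Y < R" "Y - X < R" and R: "0 < R" unfolding R_def by linarith+
    have "V x b - V x t \<le> V y b - V y t \<longleftrightarrow> X + R * real G \<le> Y + R * real K"
      by (simp add: V_def X_def Y_def G_def K_def cross_def algebra_simps)
    also have "\<dots> \<longleftrightarrow> G < K \<or> G = K \<and> X \<le> Y"
    proof (cases G K rule: linorder_cases)
      case less
      then have "R * 1 \<le> R * (real K - real G)" using R by (intro mult_left_mono) auto
      then show ?thesis using less XY by (simp add: algebra_simps)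
    next
      case greater
      then have "R * 1 \<le> R * (real G - real K)" using R by (intro mult_left_mono) auto
      then show ?thesis using greater XY by (simp add: algebra_simps)
    qed simp
    finally show ?thesis unfolding X_def Y_def G_def K_def .
  qed
  then show ?thesis unfolding lex_potential_def by blast
qed

section \<open>Enumeration of the remaining \<open>h - 3\<close> coordinates as base
  \<open>n\<close> digits of a counter\<close>

fun digits_com :: "nat list \<Rightarrow> com" where
  "digits_com [] = Skip"
| "digits_com (r # rs) = (WWrite x_u (WConst r) (WMod (Var x_d) (Var x_n)) ;;
     set0 x_d (WDiv (Var x_d) (Var x_n)) ;; digits_com rs)"

lemma mod_digits [simp]:
  "x \<in> wmod (digits_com rs) \<longleftrightarrow> rs \<noteq> [] \<and> (x = x_u \<or> x = x_d)" "rmod (digits_com rs) = {}"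
  by (induction rs) auto

lemma run_digits:
  assumes "words s x_n 0 = n" "words s x_d 0 = z" "z < B"
  shows "run B (digits_com [m..<m + k]) (\<lambda>t s'. t \<le> 20 * k + 1 \<and>
     (\<forall>r. m \<le> r \<longrightarrow> r < m + k \<longrightarrow> words s' x_u r = z div n ^ (r - m) mod n) \<and>
     (\<forall>r<m. words s' x_u r = words s x_u r)) s"
  using assms
proof (induction k arbitrary: m z s)
  case (Suc k)
  let ?s = "write_word x_d 0 (z div n) (write_word x_u m (z mod n) s)"
  have up: "[m..<m + Suc k] = m # [Suc m..<Suc m + k]" by (simp add: upt_conv_Cons)
  have b: "z div n < B" "z mod n < B"
    using Suc.prems(3) div_le_dividend[of z n] mod_less_eq_dividend[of z n] by linarith+
  have "run B (digits_com [Suc m..<Suc m + k]) (\<lambda>t s'. t \<le> 20 * k + 1 \<and>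
     (\<forall>r. Suc m \<le> r \<longrightarrow> r < Suc m + k \<longrightarrow> words s' x_u r = z div n div n ^ (r - Suc m) mod n) \<and>
     (\<forall>r<Suc m. words s' x_u r = words ?s x_u r)) ?s"
    by (rule Suc.IH) (use Suc.prems b in auto)
  then have "run B (digits_com [Suc m..<Suc m + k]) (\<lambda>t s'. 14 + t \<le> 20 * Suc k + 1 \<and>
     (\<forall>r. m \<le> r \<longrightarrow> r < m + Suc k \<longrightarrow> words s' x_u r = z div n ^ (r - m) mod n) \<and>
     (\<forall>r<m. words s' x_u r = words s x_u r)) ?s"
  proof (rule run_mono, intro conjI allI impI)
    fix t s' r assume *: "t \<le> 20 * k + 1 \<and>
     (\<forall>r. Suc m \<le> r \<longrightarrow> r < Suc m + k \<longrightarrow> words s' x_u r = z div n div n ^ (r - Suc m) mod n) \<and>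
     (\<forall>r<Suc m. words s' x_u r = words ?s x_u r)"
    show "14 + t \<le> 20 * Suc k + 1" using * by simp
    show "words s' x_u r = z div n ^ (r - m) mod n" if "m \<le> r" "r < m + Suc k"
    proof (cases "r = m")
      case False
      then have "r - m = Suc (r - Suc m)" "Suc m \<le> r" using that by auto
      then show ?thesis using * that by (simp add: div_mult2_eq)
    qed (use * in simp)
    show "words s' x_u r = words s x_u r" if "r < m" using * that by simp
  qed
  then show ?case unfolding up using Suc.prems b by (auto elim!: run_mono)
qed simp

lemma digits_exist:
  fixes f :: "nat \<Rightarrow> nat" and n :: nat
  assumes "\<And>r. r < m \<Longrightarrow> f r < n"
  shows "\<exists>z < n ^ m. \<forall>r<m. z div n ^ r mod n = f r"
  using assms
proof (induction m arbitrary: f)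
  case (Suc m)
  obtain z where z: "z < n ^ m" "\<forall>r<m. z div n ^ r mod n = f (Suc r)"
    using Suc.IH[of "\<lambda>r. f (Suc r)"] Suc.prems by auto
  have f0: "f 0 < n" using Suc.prems by simp
  have "n * z + f 0 < n * Suc z" using f0 by simp
  also have "\<dots> \<le> n * n ^ m" using z(1) by (intro mult_le_mono2) simp
  finally have "n * z + f 0 < n ^ Suc m" by simp
  moreover have "(n * z + f 0) div n ^ r mod n = f r" if "r < Suc m" for r
  proof (cases r)
    case (Suc q)
    have "(n * z + f 0) div n = z" using f0 by simp
    then show ?thesis using z(2) that Suc by (simp add: div_mult2_eq)
  qed (use f0 in simp)
  ultimately show ?case by blast
qed simp

fun power_exp :: "nat \<Rightarrow> wexp" where
  "power_exp 0 = WConst 1"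
| "power_exp (Suc m) = WMul (Var x_n) (power_exp m)"

lemma power_exp [simp]: "wval (power_exp m) s = words s x_n 0 ^ m" "wcost (power_exp m) = 3 * m + 1"
  by (induction m) auto

definition step_com :: "(nat \<Rightarrow> nat \<Rightarrow> bool) \<Rightarrow> nat \<Rightarrow> com" where
  "step_com E h = set0 x_d (Var x_z) ;; digits_com [3..<h] ;; build_com E h ;;
     blocks_com h (length (all_pairs h)) ;; inc x_z"

definition prelude_com :: com where
  "prelude_com = set0 x_L (WConst 0) ;; set0 x_g (WConst 1) ;;
     While (WLt (Var x_g) (WMul (WConst 2) (Var x_n))) (set0 x_g (WMul (WConst 2) (Var x_g)) ;; inc x_L) ;;
     set0 x_D (WAdd (WDiv (Var x_L) (WConst 16)) (WConst 1))"

definition search_com :: "(nat \<Rightarrow> nat \<Rightarrow> bool) \<Rightarrow> nat \<Rightarrow> com" where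
  "search_com E h = prelude_com ;; While (WLt (Var x_z) (power_exp (h - 3))) (step_com E h)"

lemmas mod_search [simp] =
  prelude_com_def[THEN arg_cong, of wmod, unfolded wmod.simps Un_insert_left Un_empty_left]
  prelude_com_def[THEN arg_cong, of rmod, unfolded rmod.simps Un_empty_left]
  step_com_def[THEN arg_cong, of wmod, unfolded wmod.simps mod_build mod_blocks Un_insert_left Un_empty_left]
  step_com_def[THEN arg_cong, of rmod, unfolded rmod.simps mod_build mod_blocks mod_digits Un_insert_left Un_empty_left Un_empty_right]

text \<open>The range condition is explicit because a cell index \<open>f p * n + f q\<close> with
  \<open>f q >= n\<close> would denote a different pair. It also allows the search to be specified
  over all functions.\<close>

definition good_tuple :: "(nat \<Rightarrow> nat \<Rightarrow> bool) \<Rightarrow> nat \<Rightarrow> nat \<Rightarrow> (nat \<Rightarrow> nat) \<Rightarrow> (nat \<Rightarrow> nat) \<Rightarrow> bool" where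
  "good_tuple E h n aw f \<longleftrightarrow> (\<forall>r<h. f r < n) \<and> sum_good E n aw (all_pairs h) f = length (all_pairs h)"

definition tuple_weight :: "nat \<Rightarrow> nat \<Rightarrow> (nat \<Rightarrow> real) \<Rightarrow> (nat \<Rightarrow> nat) \<Rightarrow> real" where
  "tuple_weight h n rw f = sum_weight n rw (all_pairs h) f"

lemma good_tuple_cong:
  assumes "\<And>r. r < h \<Longrightarrow> f r = g r"
  shows "good_tuple E h n aw f = good_tuple E h n aw g \<and> tuple_weight h n rw f = tuple_weight h n rw g"
proof -
  have "(p, q) \<in> set (all_pairs h) \<Longrightarrow> f p = g p \<and> f q = g q" for p q
    using assms by (auto simp: set_all_pairs)
  then show ?thesis
    using assms sum_good_cong[of "all_pairs h" f g] sum_weight_cong[of "all_pairs h" f g]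
    by (simp add: good_tuple_def tuple_weight_def)
qed

definition block_cost :: "nat \<Rightarrow> nat \<Rightarrow> nat \<Rightarrow> nat \<Rightarrow> nat \<Rightarrow> nat" where
  "block_cost h n D Lb Mx = 4000 * ((Mx + 1) * (Lb + 1)) * (D + 1) + (400 + 10 * h) * (n * n) + 50"

definition step_cost :: "nat \<Rightarrow> nat \<Rightarrow> nat \<Rightarrow> nat \<Rightarrow> nat \<Rightarrow> nat" where
  "step_cost h n D Lb Mx = 20 * h + 300 * (length (all_pairs h) + 1) * (n * n) +
     (n div D + 1) * block_cost h n D Lb Mx + 200"

locale search =
  fixes E :: "nat \<Rightarrow> nat \<Rightarrow> bool" and h n :: nat and aw :: "nat \<Rightarrow> nat" and rw :: "nat \<Rightarrow> real"
    and D L Lb Mx B :: nat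
  assumes h: "3 \<le> h" and aw: "\<And>x. aw x \<le> 1" and D: "0 < D"
    and Mx: "2 * real n * (3/2) ^ L * 3 ^ D \<le> real Mx" "Mx \<le> 2 ^ Lb"
    and L: "2 * n \<le> 2 ^ L"
    and B: "4 * Mx + 2 \<le> B" "2 * (L * Mx) \<le> B" "2 ^ L < B" "2 * n < B" "L < B"
      "n * n < B" "length (all_pairs h) < B" "n ^ (h - 3) < B"
begin

abbreviation "best X s \<equiv> best_of (good_tuple E h n aw) (tuple_weight h n rw) X s"

definition step_inv :: "nat \<Rightarrow> store \<Rightarrow> bool" where
  "step_inv z s \<longleftrightarrow> words s x_n 0 = n \<and> words s x_adj = aw \<and> reals s x_w = rw \<and> reals s x_n 0 = 0 \<and>
     words s x_D 0 = D \<and> words s x_L 0 = L \<and> words s x_hd = (\<lambda>_. 0) \<and> words s x_z 0 = z \<and> padded n s"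

definition tail :: "nat \<Rightarrow> nat \<Rightarrow> nat" where
  "tail z r = (if 3 \<le> r \<and> r < h then z div n ^ (r - 3) mod n else 0)"

definition explored :: "nat \<Rightarrow> (nat \<Rightarrow> nat) set" where
  "explored z = {tuple (tail y) i j k | y i j k. y < z \<and> i < n \<and> j < n \<and> k < n}"

abbreviation block_time :: nat where "block_time \<equiv> block_cost h n D Lb Mx"
abbreviation step_time :: nat where "step_time \<equiv> step_cost h n D Lb Mx"

lemma scan_built:
  assumes V: "lex_potential n (words s x_gP) (words s x_gQ) (reals s x_rP) (reals s x_rQ) V"
    and b: "built E h n aw rw u (n * n) s" and p: "padded n s"
    and u: "\<And>r. 3 \<le> r \<Longrightarrow> r < h \<Longrightarrow> 0 < n \<Longrightarrow> u r < n" "\<And>r. r < h \<Longrightarrow> u r < B"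
  shows "scan n D L Lb Mx B (words s x_gP) (words s x_gQ) (reals s x_rP) (reals s x_rQ) V h (length (all_pairs h))
     (words s x_gC) (reals s x_rC) u (good_tuple E h n aw) (tuple_weight h n rw)"
proof -
  have idx: "i * n + j < n * n" "(n + k) * n + j = n * n + (k * n + j)" "(i * n + j) div n = i" "(i * n + j) mod n = j"
    if "i < n" "j < n" for i j k
  proof -
    show "i * n + j < n * n" using that by (rule cell_less)
  qed (use that in \<open>auto simp: algebra_simps\<close>)
  have e: "words s x_gP (i * n + j) = sum_good E n aw (pairs01 h) (tuple u i j k)"
     "reals s x_rP (i * n + j) = sum_weight n rw (pairs01 h) (tuple u i j k)"
     "words s x_gQ ((n + k) * n + j) = sum_good E n aw (pairs12 h) (tuple u i j k)"
     "reals s x_rQ ((n + k) * n + j) = sum_weight n rw (pairs12 h) (tuple u i j k)"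
     "words s x_gC (i * n + k) = sum_good E n aw (pairs02 h) (tuple u i j k)"
     "reals s x_rC (i * n + k) = sum_weight n rw (pairs02 h) (tuple u i j k)"
    if "i < n" "j < n" "k < n" for i j k
  proof -
    have 1: "(p, q) \<in> set (pairs01 h) \<Longrightarrow> tuple u i j 0 p = tuple u i j k p \<and> tuple u i j 0 q = tuple u i j k q" for p q
      using set_pairs(1)[of p q h] by (simp add: tuple_def)
    have 2: "(p, q) \<in> set (pairs12 h) \<Longrightarrow> tuple u 0 j k p = tuple u i j k p \<and> tuple u 0 j k q = tuple u i j k q" for p q
      using set_pairs(2)[of p q h] by (simp add: tuple_def)
    have 3: "(p, q) \<in> set (pairs02 h) \<Longrightarrow> tuple u i 0 k p = tuple u i j k p \<and> tuple u i 0 k q = tuple u i j k q" for p q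
      using set_pairs(3)[of p q h] by (simp add: tuple_def)
    note cong = sum_good_cong[OF 1] sum_weight_cong[OF 1] sum_good_cong[OF 2] sum_weight_cong[OF 2]
      sum_good_cong[OF 3] sum_weight_cong[OF 3]
    show "words s x_gP (i * n + j) = sum_good E n aw (pairs01 h) (tuple u i j k)"
     "reals s x_rP (i * n + j) = sum_weight n rw (pairs01 h) (tuple u i j k)"
     "words s x_gQ ((n + k) * n + j) = sum_good E n aw (pairs12 h) (tuple u i j k)"
     "reals s x_rQ ((n + k) * n + j) = sum_weight n rw (pairs12 h) (tuple u i j k)"
     "words s x_gC (i * n + k) = sum_good E n aw (pairs02 h) (tuple u i j k)"
     "reals s x_rC (i * n + k) = sum_weight n rw (pairs02 h) (tuple u i j k)"
      using b[unfolded built_def, rule_format, OF idx(1)[OF that(1,2)]]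
        b[unfolded built_def, rule_format, OF idx(1)[OF that(3,2)]]
        b[unfolded built_def, rule_format, OF idx(1)[OF that(1,3)]] that idx
      by (simp_all add: cong add.assoc)
  qed
  have good: "sum_good E n aw (pairs01 h) f + sum_good E n aw (pairs12 h) f + sum_good E n aw (pairs02 h) f =
      sum_good E n aw (all_pairs h) f" for f
    unfolding sum_good_def by (rule sum_list_pairs)
  have weight: "sum_weight n rw (pairs01 h) f + sum_weight n rw (pairs12 h) f + sum_weight n rw (pairs02 h) f =
      tuple_weight h n rw f" for f
    unfolding sum_weight_def tuple_weight_def by (rule sum_list_pairs)
  have le: "sum_good E n aw (all_pairs h) f \<le> length (all_pairs h)" for f
    by (rule sum_good_le) (rule aw)
  have block: "block n D L Lb Mx B (words s x_gP) (words s x_gQ) (reals s x_rP) (reals s x_rQ) V"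
    by unfold_locales ((rule V[unfolded lex_potential_def, rule_format]; assumption) | rule Mx L B)+
  show ?thesis
  proof (rule scan.intro[OF block], rule scan_axioms.intro)
    fix i j k assume ijk: "i < n" "j < n" "k < n"
    have "tuple u i j k r < n" if "r < h" for r
      using ijk u(1)[of r] that by (auto simp: tuple_def)
    then show "good_tuple E h n aw (tuple u i j k) \<longleftrightarrow>
       length (all_pairs h) \<le> words s x_gP (i * n + j) + words s x_gQ ((n + k) * n + j) + words s x_gC (i * n + k)"
      using le[of "tuple u i j k"] unfolding e[OF ijk] good good_tuple_def by auto
    show "words s x_gP (i * n + j) + words s x_gQ ((n + k) * n + j) + words s x_gC (i * n + k) \<le> length (all_pairs h)"
      unfolding e[OF ijk] good by (rule le)
    show "tuple_weight h n rw (tuple u i j k) =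
        reals s x_rP (i * n + j) + reals s x_rQ ((n + k) * n + j) + reals s x_rC (i * n + k)"
      unfolding e[OF ijk] weight ..
  next
    show "words s x_gP x = 0 \<and> reals s x_rP x = 0" if "n * n \<le> x" for x
      using p that by (simp add: padded_def)
    show "words s x_gQ x = 0 \<and> reals s x_rQ x = 0" if "x < n * n" for x
      using p that by (simp add: padded_def)
    show "good_tuple E h n aw f = good_tuple E h n aw g \<and> tuple_weight h n rw f = tuple_weight h n rw g"
      if "\<And>r. r < h \<Longrightarrow> f r = g r" for f g
      by (rule good_tuple_cong) (rule that)
  qed (rule h u(2))+
qed

text \<open>Tuples are functions on all natural numbers, but only their values below
  \<open>h\<close> matter; this exchanges sets of tuples up to agreement there.\<close>

lemma best_transfer:
  assumes "best X s" "\<And>f. f \<in> Y \<Longrightarrow> \<exists>g\<in>X. \<forall>r<h. f r = g r"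
  shows "best Y s"
proof -
  have "good_tuple E h n aw f \<longrightarrow> words s x_found 0 = 1 \<and> tuple_weight h n rw f \<le> reals s x_best 0" if f: "f \<in> Y" for f
  proof -
    obtain g where g: "g \<in> X" "\<forall>r<h. f r = g r" using assms(2)[OF f] by blast
    have "good_tuple E h n aw g \<longrightarrow> words s x_found 0 = 1 \<and> tuple_weight h n rw g \<le> reals s x_best 0"
      using assms(1) g(1) unfolding best_of_def by blast
    then show ?thesis using good_tuple_cong[of h f g E n aw rw] g(2) by simp
  qed
  then show ?thesis using assms(1) unfolding best_of_def by blast
qed

lemma run_step:
  assumes s: "step_inv z s" and z: "z < n ^ (h - 3)" and best: "best X s"
  shows "run B (step_com E h) (\<lambda>t s'. t \<le> step_time \<and> step_inv (Suc z) s' \<and>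
     best (X \<union> {tuple (tail z) i j k | i j k. i < n \<and> j < n \<and> k < n}) s') s"
proof -
  have zB: "z < B" "Suc z < B" using z B by linarith+
  have up: "[3..<h] = [3..<3 + (h - 3)]" using h by simp
  let ?s = "write_word x_d 0 z s"
  have digits: "run B (digits_com [3..<h]) (\<lambda>t s'. t \<le> 20 * (h - 3) + 1 \<and>
     (\<forall>r. 3 \<le> r \<longrightarrow> r < 3 + (h - 3) \<longrightarrow> words s' x_u r = z div n ^ (r - 3) mod n) \<and>
     (\<forall>r<3. words s' x_u r = words ?s x_u r)) ?s"
    unfolding up by (rule run_digits) (use s zB in \<open>auto simp: step_inv_def\<close>)
  have main: "run B (digits_com [3..<h] ;; build_com E h ;; blocks_com h (length (all_pairs h)) ;; inc x_z)
    (\<lambda>t s'. 10 + t \<le> step_time \<and> step_inv (Suc z) s' \<and>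
     best (X \<union> {tuple (tail z) i j k | i j k. i < n \<and> j < n \<and> k < n}) s') ?s"
    unfolding run_Seq
    apply (rule run_mono_frame[OF digits])
    subgoal premises p1 for t1 s1
    proof -
      \<comment> \<open>\<open>run_build\<close> fixes the tail for all \<open>r >= 3\<close>, and
        from \<open>h\<close> on the store may contain anything. Hence \<open>u\<close> is read off
        the store and identified with \<open>tail z\<close> below \<open>h\<close> only.\<close>
      define u where "u r = (if r < 3 then 0 else words s1 x_u r)" for r
      have u_tail: "u r = tail z r" if "r < h" for r
        using p1(1) that h by (auto simp: u_def tail_def)
      have v1: "words s1 x_n 0 = n" "words s1 x_adj = aw" "reals s1 x_w = rw" "reals s1 x_n 0 = 0" "padded n s1"
        using s p1(2) by (simp_all add: same_except_def step_inv_def padded_def)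
      have u3: "words s1 x_u r = u r" if "3 \<le> r" for r using that by (simp add: u_def)
      show ?thesis
        apply (rule run_mono_frame[OF run_build[OF v1 aw B(6,7) u3]], assumption)
        subgoal premises p2 for t2 s2
        proof -
          \<comment> \<open>\<open>V\<close> depends on the matrices just built, so one is chosen
            anew for every tail.\<close>
          obtain V where V: "lex_potential n (words s2 x_gP) (words s2 x_gQ) (reals s2 x_rP) (reals s2 x_rQ) V"
            using lex_potential_exists by blast
          have built: "built E h n aw rw u (n * n) s2" and pad: "padded n s2" using p2(1) by auto
          have un: "u r < n" if "3 \<le> r" "r < h" "0 < n" for r using u_tail[of r] that by (simp add: tail_def)
          have uB: "u r < B" if "r < h" for r
          proof -
            have "tail z r \<le> z" by (auto simp: tail_def intro: le_trans[OF mod_less_eq_dividend div_le_dividend])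
            then show ?thesis using u_tail[OF that] zB by simp
          qed
          interpret scan n D L Lb Mx B "words s2 x_gP" "words s2 x_gQ" "reals s2 x_rP" "reals s2 x_rQ" V h
            "length (all_pairs h)" "words s2 x_gC" "reals s2 x_rC" u "good_tuple E h n aw" "tuple_weight h n rw"
            by (rule scan_built[OF V built pad un uB])
          have best2: "best X s2"
            by (rule best_of_same_except[OF best_of_same_except[OF best_of_write[THEN iffD2, OF _ _ best] p1(2)] p2(2)]) simp_all
          have v2: "words s2 x_n 0 = n" "words s2 x_adj = aw" "reals s2 x_w = rw" "reals s2 x_n 0 = 0"
            "words s2 x_D 0 = D" "words s2 x_L 0 = L" "words s2 x_hd = (\<lambda>_. 0)" "words s2 x_z 0 = z"
            using s p1(2) p2(2) by (simp_all add: same_except_def step_inv_def)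
          have "\<forall>r. 3 \<le> r \<longrightarrow> r < h \<longrightarrow> words s2 x_u r = u r" using p2(1) by simp
          then have rd: "scan_ready (words s2 x_s 0) s2"
            using v2 by (simp add: scan_ready_def ready_def)
          show ?thesis
            apply (rule run_mono_frame[OF run_blocks[OF rd D v2(7) best2]])
            subgoal premises p3 for t3 s3
            proof -
              have fin: "best (X \<union> {tuple (tail z) i j k | i j k. i < n \<and> j < n \<and> k < n}) s3"
              proof (rule best_transfer)
                show "best (X \<union> {tuple u i j k | i j k. i < n \<and> j < n \<and> k < n}) s3"
                  using p3(1) by blast
                fix f assume "f \<in> X \<union> {tuple (tail z) i j k | i j k. i < n \<and> j < n \<and> k < n}"
                then consider "f \<in> X" | i j k where "f = tuple (tail z) i j k" "i < n" "j < n" "k < n" by blast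
                then show "\<exists>g\<in>X \<union> {tuple u i j k | i j k. i < n \<and> j < n \<and> k < n}. \<forall>r<h. f r = g r"
                proof cases
                  case 2
                  then have "\<forall>r<h. f r = tuple u i j k r" using u_tail by (simp add: tuple_def)
                  then show ?thesis using 2 by blast
                qed blast
              qed
              have pad3: "padded n s3" using pad p3(2) by (simp add: padded_def same_except_def)
              have "10 + (t1 + (t2 + (t3 + 10))) \<le> step_time"
              proof -
                have "t2 \<le> 300 * (length (all_pairs h) + 1) * (n * n) + 50"
                  using p2(1)[THEN conjunct1] by (simp only: mult_ac)
                moreover have "t3 \<le> (n div D + 1) * block_time + 50"
                  using p3(1)[THEN conjunct1] unfolding block_cost_def .
                moreover have "t1 \<le> 20 * h + 1" using p1(1) by auto
                ultimately show ?thesis unfolding step_cost_def by linarith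
              qed
              then show ?thesis
                using v2 p3 fin pad3 zB by (simp add: step_inv_def same_except_def best_of_write padded_def)
            qed
            done
        qed
        done
    qed
    done
  have start: "write_word x_d (wval (WConst 0) s) (wval (Var x_z) s) s = ?s" "wval (Var x_z) s < B"
    using s zB by (simp_all add: step_inv_def)
  show ?thesis
    unfolding step_com_def
    apply (subst run_Seq, subst run_WWrite, unfold start(1))
    apply (rule conjI[OF start(2)], rule run_mono[OF main])
    apply simp
    done
qed

lemma explored_Suc: "explored z \<union> {tuple (tail z) i j k | i j k. i < n \<and> j < n \<and> k < n} = explored (Suc z)"
  unfolding explored_def less_Suc_eq by blast

lemma explored_all:
  assumes "\<And>r. r < h \<Longrightarrow> f r < n"
  shows "\<exists>g\<in>explored (n ^ (h - 3)). \<forall>r<h. f r = g r"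
proof -
  have "\<And>r. r < h - 3 \<Longrightarrow> f (r + 3) < n" using assms by simp
  then obtain z where z: "z < n ^ (h - 3)" "\<forall>r<h - 3. z div n ^ r mod n = f (r + 3)"
    using digits_exist[of "h - 3" "\<lambda>r. f (r + 3)" n] by blast
  have "f r = tuple (tail z) (f 0) (f 1) (f 2) r" if "r < h" for r
  proof (cases "3 \<le> r")
    case True
    then show ?thesis using z(2)[rule_format, of "r - 3"] that by (simp add: tuple_def tail_def)
  next
    case False
    then consider "r = 0" | "r = 1" | "r = 2" by linarith
    then show ?thesis by cases (simp_all add: tuple_def)
  qed
  moreover have "tuple (tail z) (f 0) (f 1) (f 2) \<in> explored (n ^ (h - 3))"
  proof -
    have "f 0 < n" "f 1 < n" "f 2 < n" using assms h by auto
    then show ?thesis unfolding explored_def using z(1) by blast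
  qed
  ultimately show ?thesis by blast
qed

lemma run_steps:
  assumes s: "step_inv 0 s" and found: "words s x_found 0 = 0"
  shows "run B (While (WLt (Var x_z) (power_exp (h - 3))) (step_com E h))
    (\<lambda>t s'. t \<le> (n ^ (h - 3) + 1) * (step_time + 3 * h + 20) \<and> best UNIV s') s"
proof -
  define b where "b = bcost (WLt (Var x_z) (power_exp (h - 3)))"
  have b: "1 + b \<le> 3 * h + 20" by (simp add: b_def)
  show ?thesis
    apply (rule run_While_const[where N = "n ^ (h - 3)" and \<tau> = step_time and
       I = "\<lambda>z s'. step_inv z s' \<and> best (explored z) s'", folded b_def])
    subgoal using s found by (simp add: best_of_def explored_def)
    subgoal for z s1
      using run_step[of z s1 "explored z"] unfolding explored_Suc by (simp add: step_inv_def)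
    subgoal by (simp add: step_inv_def)
    subgoal premises p for t s1
    proof -
      have "best {f. \<forall>r<h. f r < n} s1"
        by (rule best_transfer[OF conjunct2[OF p(2)]]) (rule explored_all, simp)
      \<comment> \<open>A tuple with one of its first \<open>h\<close> entries outside
        \<open>{..<n}\<close> is never good and imposes no condition.\<close>
      then have "best UNIV s1" by (auto simp: best_of_def good_tuple_def)
      moreover have "n ^ (h - 3) * (step_time + 1 + b) \<le> n ^ (h - 3) * (step_time + 3 * h + 20)"
        using b by (intro mult_le_mono2) simp
      then have "t \<le> (n ^ (h - 3) + 1) * (step_time + 3 * h + 20)"
        using p(1)[folded b_def] b unfolding add_mult_distrib mult_1 by linarith
      ultimately show ?thesis by simp
    qed
    done
qed

end

section \<open>The logarithm of the order and the block width computed from it\<close>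

definition level :: "nat \<Rightarrow> nat" where "level n = (LEAST L. 2 * n \<le> 2 ^ L)"

lemma level: "2 * n \<le> 2 ^ level n" "l < level n \<Longrightarrow> 2 ^ l < 2 * n"
proof -
  have "2 * n \<le> 2 ^ (2 * n)" by (rule less_imp_le) (rule less_exp)
  then show "2 * n \<le> 2 ^ level n" unfolding level_def by (rule LeastI)
  show "l < level n \<Longrightarrow> 2 ^ l < 2 * n" unfolding level_def using not_less_Least by (metis not_le)
qed

lemma run_prelude:
  assumes n: "words s x_n 0 = n" and B: "2 ^ level n < B" "level n < B"
  shows "run B prelude_com (\<lambda>t s'. t \<le> 30 * level n + 50 \<and>
     words s' x_L 0 = level n \<and> words s' x_D 0 = level n div 16 + 1) s"
  unfolding prelude_com_def
  apply simp
  apply (intro conjI)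
  subgoal using B by simp
  subgoal using le_less_trans[OF one_le_power[of "2::nat" "level n"] B(1)] by simp
  apply (rule run_While_const[where N = "level n" and \<tau> = 20 and
     I = "\<lambda>k s'. words s' x_L 0 = k \<and> words s' x_g 0 = 2 ^ k"])
  subgoal by simp
  subgoal premises p for k s1
  proof -
    have "(2::nat) ^ Suc k \<le> 2 ^ level n" using p(1) by (intro power_increasing) auto
    moreover have "words s1 x_n 0 = n" using p(3) n by (simp add: same_except_def)
    ultimately show ?thesis using p B level(2)[OF p(1)] by simp
  qed
  subgoal premises p for s1
    using p n level(1)[of n] by (simp add: same_except_def)
  subgoal premises p for t s1
  proof -
    have "level n div 16 + 1 \<le> level n + 1" by simp
    moreover have "level n + 1 < B" using B less_exp[of "level n"] by linarith
    ultimately have "Suc (level n div 16) < B" by linarith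
    then show ?thesis using p(1,2) by simp
  qed
  done

section \<open>Tuples and induced subgraphs\<close>

lemma pair_good_le: "aw (f p * n + f q) \<le> 1 \<Longrightarrow> pair_good E n aw f (p, q) \<le> 1"
  by (simp add: pair_good_def)

lemma sum_good_full:
  assumes "\<And>x. aw x \<le> 1"
  shows "sum_good E n aw ps f = length ps \<longleftrightarrow> (\<forall>x\<in>set ps. pair_good E n aw f x = 1)"
proof (induction ps)
  case (Cons x ps)
  have "pair_good E n aw f x \<le> 1" using assms pair_good_le by (cases x) blast
  moreover have "sum_good E n aw ps f \<le> length ps" by (rule sum_good_le) (rule assms)
  ultimately show ?case using Cons.IH by (auto simp: sum_good_def)
qed (simp add: sum_good_def)

locale graph_input =
  fixes H :: "'b graph" and h n :: nat and G :: "nat graph" and w :: "nat set \<Rightarrow> real" and g :: "nat \<Rightarrow> 'b"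
  assumes H: "simple_graph H" and g: "bij_betw g {..<h} (verts H)"
    and G: "simple_graph G" "verts G = {..<n}"
begin

definition E :: "nat \<Rightarrow> nat \<Rightarrow> bool" where "E p q \<longleftrightarrow> {g p, g q} \<in> edges H"
abbreviation adj :: "nat \<Rightarrow> nat" where "adj \<equiv> words (input n G w) x_adj"
abbreviation edge_weight :: "nat \<Rightarrow> real" where "edge_weight \<equiv> reals (input n G w) x_w"

lemma adj: "i < n \<Longrightarrow> j < n \<Longrightarrow> adj (i * n + j) = (if {i, j} \<in> edges G then 1 else 0)"
  using cell_less[of i n j n] by (simp add: input_def name_defs)

lemma adj_le: "adj x \<le> 1"
  by (simp add: input_def name_defs)

lemma edge_weight: "i < n \<Longrightarrow> j < n \<Longrightarrow> edge_weight (i * n + j) = (if {i, j} \<in> edges G then w {i, j} else 0)"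
  using cell_less[of i n j n] by (simp add: input_def name_defs)

lemma no_loop: "{x} \<notin> edges G" "{y} \<notin> edges H"
  using G H by (auto simp: simple_graph_def)

definition copy :: "(nat \<Rightarrow> nat) \<Rightarrow> bool" where
  "copy f \<longleftrightarrow> f ` {..<h} \<subseteq> {..<n} \<and> inj_on f {..<h} \<and>
     (\<forall>p<h. \<forall>q<h. E p q \<longleftrightarrow> {f p, f q} \<in> edges G)"

text \<open>A sum of values at most 1 equals its number of terms exactly if every term is 1. For
  \<open>p < q\<close> this forces \<open>f p \<noteq> f q\<close>: for an edge through the absence
  of loops, for a non-edge through the explicit penalty. The symmetry of unordered pairs settles
  \<open>p > q\<close>.\<close>

lemma good_tuple_copy: "good_tuple E h n adj f \<longleftrightarrow> copy f"
proof
  assume good: "good_tuple E h n adj f"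
  then have lt: "\<And>r. r < h \<Longrightarrow> f r < n"
    and one: "\<And>p q. p < q \<Longrightarrow> q < h \<Longrightarrow> pair_good E n adj f (p, q) = 1"
    by (auto simp: good_tuple_def sum_good_full[OF adj_le] set_all_pairs)
  have ne: "f p \<noteq> f q \<and> (E p q \<longleftrightarrow> {f p, f q} \<in> edges G)" if "p < q" "q < h" for p q
  proof -
    have a: "adj (f p * n + f q) = (if {f p, f q} \<in> edges G then 1 else 0)"
      using lt that by (intro adj) auto
    then show ?thesis
      using one[OF that] no_loop(1)[of "f p"]
      by (cases "E p q"; cases "f p = f q"; cases "{f p, f q} \<in> edges G") (simp_all add: pair_good_def)
  qed
  have "E p q \<longleftrightarrow> {f p, f q} \<in> edges G" if "p < h" "q < h" for p q
  proof (cases p q rule: linorder_cases)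
    case equal
    then show ?thesis using no_loop by (simp add: E_def)
  next
    case greater
    then show ?thesis using ne[of q p] that by (simp add: E_def insert_commute)
  qed (use ne that in blast)
  moreover have "inj_on f {..<h}"
    by (rule linorder_inj_onI) (use ne in auto)
  ultimately show "copy f" using lt by (auto simp: copy_def)
next
  assume c: "copy f"
  have "pair_good E n adj f (p, q) = 1" if "p < q" "q < h" for p q
  proof -
    have "p \<in> {..<h}" "q \<in> {..<h}" using that by auto
    then have "f p \<in> {..<n}" "f q \<in> {..<n}" "f p \<noteq> f q" "E p q \<longleftrightarrow> {f p, f q} \<in> edges G"
      using c that unfolding copy_def inj_on_def by blast+
    then show ?thesis using adj[of "f p" "f q"] by (simp add: pair_good_def)
  qed
  then show "good_tuple E h n adj f"
    using c by (auto simp: good_tuple_def sum_good_full[OF adj_le] set_all_pairs copy_def)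
qed

lemma copy_induced:
  assumes "copy f"
  shows "induced_H_subgraph H G (induced_subgraph G (f ` {..<h}))"
proof -
  let ?S = "f ` {..<h}"
  define \<phi> where "\<phi> = g \<circ> inv_into {..<h} f"
  have inj: "inj_on f {..<h}" using assms by (simp add: copy_def)
  then have "bij_betw (inv_into {..<h} f) ?S {..<h}"
    by (intro bij_betw_inv_into) (simp add: bij_betw_def)
  then have "bij_betw \<phi> ?S (verts H)" unfolding \<phi>_def using g by (rule bij_betw_trans)
  moreover have "{x, y} \<in> edges (induced_subgraph G ?S) \<longleftrightarrow> {\<phi> x, \<phi> y} \<in> edges H"
    if xy: "x \<in> ?S" "y \<in> ?S" for x y
  proof -
    obtain p q where pq: "p < h" "q < h" "x = f p" "y = f q" using xy by auto
    then have "\<phi> x = g p" "\<phi> y = g q" using inj by (simp_all add: \<phi>_def)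
    then show ?thesis using assms pq xy by (auto simp: copy_def E_def induced_subgraph_def)
  qed
  ultimately have "graph_isomorphic (induced_subgraph G ?S) H"
    unfolding graph_isomorphic_def by (intro exI[of _ \<phi>]) (simp add: induced_subgraph_def)
  moreover have "?S \<subseteq> verts G" using assms G by (auto simp: copy_def)
  ultimately show ?thesis unfolding induced_H_subgraph_def by blast
qed

lemma induced_copy:
  assumes "induced_H_subgraph H G K"
  obtains f where "copy f" "K = induced_subgraph G (f ` {..<h})"
proof -
  obtain S \<phi> where S: "S \<subseteq> verts G" "K = induced_subgraph G S" and \<phi>: "bij_betw \<phi> (verts K) (verts H)"
    and e: "\<And>x y. x \<in> verts K \<Longrightarrow> y \<in> verts K \<Longrightarrow> {x, y} \<in> edges K \<longleftrightarrow> {\<phi> x, \<phi> y} \<in> edges H"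
    using assms unfolding induced_H_subgraph_def graph_isomorphic_def by blast
  have K: "verts K = S" "edges K = {e \<in> edges G. e \<subseteq> S}" using S by (simp_all add: induced_subgraph_def)
  define f where "f = inv_into S \<phi> \<circ> g"
  have "bij_betw (inv_into S \<phi>) (verts H) S" using \<phi> K by (simp add: bij_betw_inv_into)
  then have f: "bij_betw f {..<h} S" unfolding f_def using g by (blast intro: bij_betw_trans)
  have \<phi>f: "\<phi> (f p) = g p" if "p < h" for p
  proof -
    have "g p \<in> \<phi> ` S" using g \<phi> K that by (auto simp: bij_betw_def)
    then show ?thesis by (simp add: f_def f_inv_into_f)
  qed
  have fS: "f p \<in> S" if "p < h" for p using f that by (auto simp: bij_betw_def)
  have "E p q \<longleftrightarrow> {f p, f q} \<in> edges G" if "p < h" "q < h" for p q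
    using e[of "f p" "f q"] \<phi>f that fS K by (auto simp: E_def)
  moreover have "f ` {..<h} = S" "inj_on f {..<h}" using f by (simp_all add: bij_betw_def)
  ultimately have "copy f" using S G by (auto simp: copy_def)
  then show thesis using that S \<open>f ` {..<h} = S\<close> by blast
qed

text \<open>Since \<open>f\<close> is injective, the pairs \<open>p < q\<close> with adjacent images
  correspond to the edges of the induced subgraph, each counted once. The other pairs contribute 0,
  as the input stores 0 for non-edges.\<close>

lemma copy_weight:
  assumes "copy f"
  shows "weight w (induced_subgraph G (f ` {..<h})) = tuple_weight h n edge_weight f"
proof -
  let ?P = "{(p, q). p < q \<and> q < h}" and ?Q = "{(p, q). p < q \<and> q < h \<and> {f p, f q} \<in> edges G}"
  let ?E = "{e \<in> edges G. e \<subseteq> f ` {..<h}}"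
  have inj: "inj_on f {..<h}" and lt: "\<And>p. p < h \<Longrightarrow> f p < n" using assms by (auto simp: copy_def)
  have "finite ({..<h} \<times> {..<h})" by simp
  then have fin: "finite ?P" by (rule rev_finite_subset) auto
  have bij: "bij_betw (\<lambda>(p, q). {f p, f q}) ?Q ?E"
  proof (rule bij_betw_imageI)
    show "inj_on (\<lambda>(p, q). {f p, f q}) ?Q"
    proof (rule inj_onI, clarify)
      fix p q p' q' assume *: "p < q" "q < h" "p' < q'" "q' < h" "{f p, f q} = {f p', f q'}"
      then have "f ` {p, q} = f ` {p', q'}" by simp
      then have "{p, q} = {p', q'}"
        using inj_on_image_eq_iff[OF inj, of "{p, q}" "{p', q'}"] * by auto
      then show "p = p' \<and> q = q'" using * by (auto simp: doubleton_eq_iff)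
    qed
    show "(\<lambda>(p, q). {f p, f q}) ` ?Q = ?E"
    proof (intro equalityI subsetI)
      fix e assume e: "e \<in> ?E"
      then have "card e = 2" using G by (auto simp: simple_graph_def)
      then obtain x y where xy: "e = {x, y}" "x \<noteq> y" by (auto simp: card_2_iff)
      then obtain p q where "p < h" "q < h" "x = f p" "y = f q" using e by auto
      then have "(p, q) \<in> ?Q \<and> e = {f p, f q} \<or> (q, p) \<in> ?Q \<and> e = {f q, f p}"
        using xy e by (cases p q rule: linorder_cases) (auto simp: insert_commute)
      then show "e \<in> (\<lambda>(p, q). {f p, f q}) ` ?Q" by force
    qed auto
  qed
  have "distinct (all_pairs h)" by (simp add: all_pairs_def distinct_product)
  then have "tuple_weight h n edge_weight f = (\<Sum>x\<in>?P. pair_weight n edge_weight f x)"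
    by (simp add: tuple_weight_def sum_weight_def sum_list_distinct_conv_sum_set set_all_pairs)
  also have "\<dots> = (\<Sum>x\<in>?Q. pair_weight n edge_weight f x)"
    by (rule sum.mono_neutral_right[OF fin]) (auto simp: pair_weight_def edge_weight lt split: if_splits)
  also have "\<dots> = (\<Sum>x\<in>?Q. w ((\<lambda>(p, q). {f p, f q}) x))"
    by (rule sum.cong) (auto simp: pair_weight_def edge_weight lt)
  also have "\<dots> = (\<Sum>e\<in>?E. w e)" by (rule sum.reindex_bij_betw[OF bij])
  finally show ?thesis by (simp add: weight_def induced_subgraph_def)
qed

lemma best_output_correct:
  assumes best: "best_of (good_tuple E h n adj) (tuple_weight h n edge_weight) UNIV s"
  shows "output_correct H G w s"
proof -
  have h: "card (verts H) = h" using bij_betw_same_card[OF g] by simp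
  let ?K = "induced_subgraph G (words s x_out ` {..<h})"
  have found: "words s x_found 0 = 1" if "induced_H_subgraph H G K" for K
    using induced_copy[OF that] best good_tuple_copy by (metis UNIV_I best_of_def)
  have max: "max_induced_H_subgraph H G w ?K" if 1: "words s x_found 0 = 1"
  proof -
    have c: "copy (words s x_out)" "reals s x_best 0 = tuple_weight h n edge_weight (words s x_out)"
      using best 1 good_tuple_copy unfolding best_of_def by blast+
    have "weight w K \<le> weight w ?K" if K: "induced_H_subgraph H G K" for K
    proof -
      obtain f where f: "copy f" "K = induced_subgraph G (f ` {..<h})" by (rule induced_copy[OF K])
      then have "tuple_weight h n edge_weight f \<le> reals s x_best 0"
        using best good_tuple_copy unfolding best_of_def by blast
      then show ?thesis using copy_weight f c by simp
    qed
    then show ?thesis using copy_induced[OF c(1)] by (simp add: max_induced_H_subgraph_def)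
  qed
  have zero: "words s x_found 0 = 0" if "\<nexists>K. induced_H_subgraph H G K"
  proof -
    have "words s x_found 0 \<noteq> 1" using max that by (auto simp: max_induced_H_subgraph_def)
    then show ?thesis using best unfolding best_of_def by linarith
  qed
  show ?thesis
    using found max zero unfolding output_correct_def h by (auto simp: name_defs)
qed

end

section \<open>Running time\<close>

definition block_width :: "nat \<Rightarrow> nat" where "block_width n = level n div 16 + 1"

text \<open>By \<open>2 * n <= 2 ^ level n\<close> the initial potential is at most
  \<open>2 ^ level n * (3/2) ^ level n = 3 ^ level n\<close>, and the rounds of a block contribute
  at most \<open>3 ^ block_width n\<close>.\<close>

definition record_bound :: "nat \<Rightarrow> nat" where "record_bound n = 3 ^ (level n + block_width n)"

lemma cube_le_power8: "(Suc q) ^ 3 \<le> 8 ^ q"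
proof -
  have "Suc q \<le> 2 ^ q" using less_exp[of q] by (rule Suc_leI)
  then have "(Suc q) ^ 3 \<le> (2 ^ q) ^ 3" by (rule power_mono) simp
  also have "\<dots> = 8 ^ q" by (simp add: power_mult[symmetric] mult.commute[of q] power_mult)
  finally show ?thesis .
qed

text \<open>The divisor 16 in the block width is chosen such that \<open>3\<^sup>1\<^sup>7 * 8 \<le> 4\<^sup>1\<^sup>6\<close>.\<close>

lemma power3_level: "3 ^ L * 3 ^ (L div 16) * (L div 16 + 1) ^ 3 \<le> (4::nat) ^ L"
proof -
  define q r where "q = L div 16" and "r = L mod 16"
  have L: "L = 16 * q + r" by (simp add: q_def r_def)
  have "3 ^ L * 3 ^ q * Suc q ^ 3 \<le> 3 ^ L * 3 ^ q * 8 ^ q"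
    using cube_le_power8 by (rule mult_le_mono2)
  also have "\<dots> = 3 ^ r * (3 ^ 16 * 3 * 8) ^ q"
    unfolding L power_add power_mult power_mult_distrib by (simp only: mult_ac)
  also have "\<dots> \<le> 4 ^ r * (4 ^ 16) ^ q"
    by (intro mult_le_mono power_mono) simp_all
  also have "\<dots> = 4 ^ L" unfolding L power_add power_mult by (simp only: mult_ac)
  finally show ?thesis by (simp add: q_def)
qed

lemma two_power_level: "2 ^ level n \<le> 4 * n + 1"
proof (cases "level n")
  case (Suc l)
  then show ?thesis using level(2)[of l n] by simp
qed simp

text \<open>By \<open>two_power_level\<close> the right-hand side is \<open>O(n ^ 2)\<close>: the
  work on records, including its logarithmic factors, stays within the cost of enumerating all
  pairs.\<close>

lemma record_bound_le: "record_bound n * block_width n ^ 3 \<le> 3 * 4 ^ level n"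
  using power3_level[of "level n"] by (simp add: record_bound_def block_width_def power_add mult_ac)

lemma record_bound_enough:
  "2 * real n * (3/2) ^ level n * 3 ^ block_width n \<le> real (record_bound n)"
  "record_bound n \<le> 2 ^ (2 * (level n + block_width n))"
proof -
  have "2 * real n \<le> 2 ^ level n"
    using level(1)[of n] by (metis of_nat_le_iff of_nat_mult of_nat_numeral of_nat_power)
  then have "2 * real n * (3/2) ^ level n \<le> 2 ^ level n * (3/2) ^ level n"
    by (intro mult_right_mono) auto
  also have "\<dots> = 3 ^ level n" by (simp add: power_mult_distrib[symmetric])
  finally have "2 * real n * (3/2) ^ level n * 3 ^ block_width n \<le> 3 ^ level n * 3 ^ block_width n"
    by (rule mult_right_mono) simp
  then show "2 * real n * (3/2) ^ level n * 3 ^ block_width n \<le> real (record_bound n)"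
    by (simp add: record_bound_def power_add)
  show "record_bound n \<le> 2 ^ (2 * (level n + block_width n))"
    unfolding record_bound_def power_mult by (rule power_mono) auto
qed

definition word_exponent :: "nat \<Rightarrow> nat" where "word_exponent h = 20 + h + length (all_pairs h)"

text \<open>As \<open>n + 2 >= 2\<close> even for \<open>n = 0\<close>, every constant
  \<open>2 ^ m\<close> is absorbed by \<open>(n + 2) ^ m\<close>; \<open>word_exponent h\<close> is
  large enough to collect all of them.\<close>

lemma search_bounds:
  assumes h: "3 \<le> h" and aw: "\<And>x. aw x \<le> 1"
  shows "search h n aw (block_width n) (level n) (2 * (level n + block_width n)) (record_bound n) ((n + 2) ^ word_exponent h)"
proof -
  let ?y = "n + 2" and ?k = "word_exponent h"
  have up: "?y ^ m \<le> ?y ^ ?k" if "m \<le> ?k" for m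
    using that by (intro power_increasing) auto
  have strict: "?y ^ m < ?y ^ ?k" if "m < ?k" for m
    using that by (intro power_strict_increasing) auto
  have c: "2 ^ m \<le> ?y ^ m" for m by (rule power_mono) auto
  have "4 * n + 1 \<le> 2 ^ 2 * ?y ^ 1" by simp
  also have "\<dots> \<le> ?y ^ 2 * ?y ^ 1" by (intro mult_le_mono1 c)
  finally have y: "4 * n + 1 \<le> ?y ^ 3" by (simp only: power3_eq_cube power2_eq_square power_one_right)
  then have L: "2 ^ level n \<le> ?y ^ 3" using two_power_level[of n] by linarith
  have "record_bound n * 1 \<le> record_bound n * block_width n ^ 3"
    by (intro mult_le_mono2) (simp add: block_width_def)
  also have "\<dots> \<le> 3 * (2 ^ level n) ^ 2"
    using record_bound_le[of n] by (simp add: power_mult[symmetric] power_mult power2_eq_square power_mult_distrib[symmetric])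
  also have "\<dots> \<le> 3 * (?y ^ 3) ^ 2" using L by (intro mult_le_mono2 power_mono) auto
  finally have M: "record_bound n \<le> 3 * ?y ^ 6" by (simp add: power_mult[symmetric])
  have "1 \<le> ?y ^ 6" by (rule one_le_power) simp
  then have "4 * record_bound n + 2 \<le> 16 * ?y ^ 6" using M by linarith
  also have "\<dots> = 2 ^ 4 * ?y ^ 6" by simp
  also have "\<dots> \<le> ?y ^ 4 * ?y ^ 6" by (intro mult_le_mono1 c)
  also have "\<dots> = ?y ^ 10" by (simp add: power_add[symmetric])
  also have "\<dots> \<le> ?y ^ ?k" by (rule up) (simp add: word_exponent_def)
  finally have B1: "4 * record_bound n + 2 \<le> ?y ^ ?k" .
  have lev: "level n \<le> ?y ^ 3" using L less_exp[of "level n"] by linarith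
  have "level n * record_bound n \<le> ?y ^ 3 * (3 * ?y ^ 6)" using lev M by (rule mult_le_mono)
  then have "2 * (level n * record_bound n) \<le> 2 * (?y ^ 3 * (3 * ?y ^ 6))" by (rule mult_le_mono2)
  also have "2 * (?y ^ 3 * (3 * ?y ^ 6)) \<le> 2 ^ 3 * (?y ^ 3 * ?y ^ 6)"
  proof -
    have "2 * (a * (3 * b)) \<le> 2 ^ 3 * (a * b)" for a b :: nat by simp
    then show ?thesis .
  qed
  also have "\<dots> \<le> ?y ^ 3 * (?y ^ 3 * ?y ^ 6)" by (intro mult_le_mono1 c)
  also have "\<dots> = ?y ^ 12" by (simp add: power_add[symmetric])
  also have "\<dots> \<le> ?y ^ ?k" by (rule up) (simp add: word_exponent_def)
  finally have B2: "2 * (level n * record_bound n) \<le> ?y ^ ?k" .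
  have y3: "?y ^ 3 < ?y ^ ?k" by (rule strict) (simp add: word_exponent_def)
  have "n * n \<le> ?y ^ 2" by (simp add: power2_eq_square)
  also have "\<dots> < ?y ^ ?k" by (rule strict) (simp add: word_exponent_def)
  finally have B6: "n * n < ?y ^ ?k" .
  have "length (all_pairs h) < 2 ^ length (all_pairs h)" by (rule less_exp)
  also have "\<dots> \<le> ?y ^ length (all_pairs h)" by (rule c)
  also have "\<dots> \<le> ?y ^ ?k" by (rule up) (simp add: word_exponent_def)
  finally have B7: "length (all_pairs h) < ?y ^ ?k" .
  have "n ^ (h - 3) \<le> ?y ^ (h - 3)" by (rule power_mono) auto
  also have "\<dots> < ?y ^ ?k" by (rule strict) (simp add: word_exponent_def)
  finally have B8: "n ^ (h - 3) < ?y ^ ?k" .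
  have B345: "2 ^ level n < ?y ^ ?k" "2 * n < ?y ^ ?k" "level n < ?y ^ ?k"
    using L y lev y3 by linarith+
  show ?thesis
    by unfold_locales
       (rule h aw record_bound_enough level(1) B1 B2 B345 B6 B7 B8 | simp add: block_width_def)+
qed

definition search_time :: "nat \<Rightarrow> nat \<Rightarrow> nat" where
  "search_time h n = 30 * level n + 50 + (n ^ (h - 3) + 1) *
     (step_cost h n (block_width n) (2 * (level n + block_width n)) (record_bound n) + 3 * h + 20)"

lemma run_search:
  assumes g: "graph_input H h n G g" and h: "3 \<le> h"
  shows "\<exists>t s. exec ((n + 2) ^ word_exponent h) (search_com (graph_input.E H g) h) (input n G w) t s \<and>
     t \<le> search_time h n \<and> output_correct H G w s"
proof -
  interpret graph_input H h n G w g by (rule g)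
  let ?B = "(n + 2) ^ word_exponent h" and ?s = "input n G w"
  interpret search E h n adj edge_weight "block_width n" "level n" "2 * (level n + block_width n)" "record_bound n" ?B
    by (rule search_bounds[OF h adj_le])
  have "run ?B (search_com E h) (\<lambda>t s. t \<le> search_time h n \<and> best UNIV s) ?s"
    unfolding search_com_def run_Seq
  proof (rule run_mono_frame[OF run_prelude])
    show "words ?s x_n 0 = n" by (simp add: input_def name_defs)
    show "2 ^ level n < ?B" "level n < ?B" by (rule B)+
    fix t1 s1
    assume p: "t1 \<le> 30 * level n + 50 \<and> words s1 x_L 0 = level n \<and> words s1 x_D 0 = level n div 16 + 1"
      and same: "same_except prelude_com ?s s1"
    have zero: "words ?s x_hd = (\<lambda>_. 0)" "words ?s x_z 0 = 0" "words ?s x_found 0 = 0" "words ?s x_gP = (\<lambda>_. 0)"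
      "words ?s x_gQ = (\<lambda>_. 0)" "reals ?s x_rP = (\<lambda>_. 0)" "reals ?s x_rQ = (\<lambda>_. 0)" "reals ?s x_n 0 = 0" "words ?s x_n 0 = n"
      by (simp_all add: input_def name_defs)
    have "words s1 x_D 0 = block_width n" using p by (simp add: block_width_def)
    then have "step_inv 0 s1"
      using p same zero by (simp add: step_inv_def padded_def same_except_def)
    moreover have "words s1 x_found 0 = 0" using same zero by (simp add: same_except_def)
    ultimately show "run ?B (While (WLt (Var x_z) (power_exp (h - 3))) (step_com E h))
        (\<lambda>u s'. t1 + u \<le> search_time h n \<and> best UNIV s') s1"
      using run_steps[of s1] p unfolding search_time_def by (auto elim!: run_mono)
  qed
  then show ?thesis using best_output_correct unfolding run_def by blast
qed

text \<open>Multiplying by the block width \<open>D\<close> avoids a division. The number of blocks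
  times \<open>D\<close> is linear in \<open>n\<close> and each block costs \<open>O(n ^ 2)\<close>;
  for the \<open>O(n ^ 2)\<close> work that is done once per tail the crude bound
  \<open>D = O(n)\<close> suffices.\<close>

lemma search_time_le:
  assumes h: "3 \<le> h"
  shows "\<exists>C. \<forall>n\<ge>1. block_width n * search_time h n \<le> C * n ^ h"
proof -
  define P where "P = length (all_pairs h)"
  \<comment> \<open>42000000 is \<open>4000 * 140 * 75\<close>: 4000 from \<open>block_cost\<close>,
    140 from the factors \<open>2 * M\<close>, \<open>35 * D\<close> and \<open>2 * D\<close> that
    bound those of \<open>Z\<close>, and 75 from \<open>M * D ^ 2 <= 75 * n ^ 2\<close>. The
    remaining 450 collects 400 and 50.\<close>
  define C1 where "C1 = 42000450 + 10 * h"
  \<comment> \<open>The numbers 115, 1500 and 1100 contain the factor 5 of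
    \<open>D <= 5 * n\<close>; the factor 6 comes from \<open>D * N <= 6 * n\<close>.\<close>
  define C3 where "C3 = 115 * h + 1500 * (P + 1) + 6 * C1 + 1100"
  \<comment> \<open>The factor 2 pays for \<open>n ^ (h - 3) + 1\<close>, and
    \<open>39750 = 530 * 75\<close> for the prelude.\<close>
  have "block_width n * search_time h n \<le> (2 * C3 + 39750) * n ^ h" if n: "1 \<le> n" for n
  proof -
    define D L M where "D = block_width n" and "L = level n" and "M = record_bound n"
    define b where "b = search.block_time h n D (2 * (L + D)) M"
    define N where "N = n div D + 1"
    have D: "1 \<le> D" "L \<le> 16 * D" "D \<le> L + 1"
      by (auto simp: D_def L_def block_width_def)
    have M: "1 \<le> M" by (simp add: M_def record_bound_def)
    have pow: "2 ^ L \<le> 5 * n" using two_power_level[of n] n by (simp add: L_def)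
    have Dn: "D \<le> 5 * n" using D pow less_exp[of L] by linarith
    have "M * D ^ 3 \<le> 3 * (2 ^ L) ^ 2"
      using record_bound_le[of n] by (simp add: M_def D_def L_def power2_eq_square power_mult_distrib[symmetric])
    also have "\<dots> \<le> 3 * (5 * n) ^ 2" using pow by (intro mult_le_mono2 power_mono) auto
    finally have MD: "M * D ^ 3 \<le> 75 * n ^ 2" by (simp add: power_mult_distrib)
    have "M * D ^ 2 \<le> M * D ^ 3" using D by (intro mult_le_mono2 power_increasing) auto
    then have MD2: "M * D ^ 2 \<le> 75 * n ^ 2" using MD by linarith
    have "1 * D ^ 2 \<le> M * D ^ 2" using M by (rule mult_le_mono1)
    then have D2: "D ^ 2 \<le> 75 * n ^ 2" using MD2 by linarith
    have n2: "1 \<le> n ^ 2" using n by (rule one_le_power)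
    define Z where "Z = (M + 1) * (2 * (L + D) + 1) * (D + 1)"
    have "Z \<le> (2 * M) * (35 * D) * (2 * D)"
      unfolding Z_def using M D by (intro mult_le_mono) auto
    also have "\<dots> = 140 * (M * D ^ 2)" by (simp add: power2_eq_square)
    finally have Z: "4000 * Z \<le> 42000000 * n ^ 2" using MD2 by linarith
    have "b = 4000 * Z + (400 + 10 * h) * n ^ 2 + 50"
      by (simp only: b_def block_cost_def Z_def power2_eq_square mult.assoc)
    moreover have "C1 * n ^ 2 = 42000000 * n ^ 2 + (400 + 10 * h) * n ^ 2 + 50 * n ^ 2"
      by (simp add: C1_def algebra_simps)
    ultimately have b: "b \<le> C1 * n ^ 2" using Z n2 by linarith
    have "D * (n div D) \<le> n" by simp
    then have N: "D * N \<le> 6 * n" using Dn unfolding N_def distrib_left mult_1_right by linarith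
    have cube: "n ^ 3 = n * n ^ 2" by (simp add: power3_eq_cube power2_eq_square)
    have "n * 1 \<le> n * n ^ 2" using n2 by (rule mult_le_mono2)
    then have n3: "n \<le> n ^ 3" by (simp add: cube)
    have "D * (N * b) \<le> 6 * n * (C1 * n ^ 2)"
      unfolding mult.assoc[symmetric, of D N b] using N b by (rule mult_le_mono)
    then have DNb: "D * (N * b) \<le> 6 * C1 * n ^ 3" by (simp add: cube mult_ac)
    have "D * (300 * (P + 1) * n ^ 2) \<le> 5 * n * (300 * (P + 1) * n ^ 2)"
      using Dn by (rule mult_le_mono1)
    then have DP: "D * (300 * (P + 1) * n ^ 2) \<le> 1500 * (P + 1) * n ^ 3" by (simp add: cube mult_ac)
    have "D * (23 * h + 220) \<le> 5 * n ^ 3 * (23 * h + 220)"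
      using Dn n3 by (intro mult_le_mono1) linarith
    then have Dh: "D * (23 * h + 220) \<le> (115 * h + 1100) * n ^ 3" by (simp add: algebra_simps)
    let ?s = "step_cost h n D (2 * (L + D)) M + 3 * h + 20"
    have "D * ?s = D * (23 * h + 220) + D * (300 * (P + 1) * n ^ 2) + D * (N * b)"
      by (simp add: step_cost_def b_def N_def P_def power2_eq_square distrib_left)
    also have "\<dots> \<le> (115 * h + 1100) * n ^ 3 + 1500 * (P + 1) * n ^ 3 + 6 * C1 * n ^ 3"
      by (intro add_le_mono Dh DP DNb)
    also have "\<dots> = C3 * n ^ 3" by (simp add: C3_def algebra_simps)
    finally have Ds: "D * ?s \<le> C3 * n ^ 3" .
    have pre: "D * (30 * L + 50) \<le> 39750 * n ^ h"
    proof -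
      have "D * (30 * L + 50) \<le> D * (530 * D)" using D by (intro mult_le_mono2) linarith
      also have "\<dots> = 530 * D ^ 2" by (simp add: power2_eq_square)
      also have "\<dots> \<le> 39750 * n ^ 2" using D2 by linarith
      also have "\<dots> \<le> 39750 * n ^ h" using n h by (intro mult_le_mono2 power_increasing) auto
      finally show ?thesis .
    qed
    have "1 \<le> n ^ (h - 3)" using n by (rule one_le_power)
    then have "(n ^ (h - 3) + 1) * (D * ?s) \<le> (2 * n ^ (h - 3)) * (C3 * n ^ 3)"
      by (intro mult_le_mono Ds) simp
    also have "\<dots> = 2 * C3 * (n ^ (h - 3) * n ^ 3)" by simp
    also have "n ^ (h - 3) * n ^ 3 = n ^ h" using h by (simp add: power_add[symmetric])
    finally have main: "(n ^ (h - 3) + 1) * (D * ?s) \<le> 2 * C3 * n ^ h" .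
    have "D * search_time h n = D * (30 * L + 50) + (n ^ (h - 3) + 1) * (D * ?s)"
      unfolding search_time_def D_def[symmetric] L_def[symmetric] M_def[symmetric] by (simp only: distrib_left mult.left_commute)
    also have "\<dots> \<le> 39750 * n ^ h + 2 * C3 * n ^ h" by (intro add_le_mono pre main)
    finally show ?thesis by (simp add: D_def add_mult_distrib)
  qed
  then show ?thesis by blast
qed

text \<open>\<open>n <= 2 ^ level n\<close> gives \<open>ln n <= level n * ln 2 <= level n\<close>,
  which is at most 16 times the block width; so the factor \<open>block_width n\<close> of the
  previous bound turns into the denominator.\<close>

lemma search_time_bigo:
  assumes h: "3 \<le> h"
  shows "(\<lambda>n. real (search_time h n)) \<in> O(\<lambda>n. real n ^ h / ln (real n))"
proof -
  obtain C where C: "\<And>n. 1 \<le> n \<Longrightarrow> block_width n * search_time h n \<le> C * n ^ h"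
    using search_time_le[OF h] by blast
  have "norm (real (search_time h n)) \<le> (16 * real C) * norm (real n ^ h / ln (real n))" if n: "2 \<le> n" for n
  proof -
    have "n \<le> 2 ^ level n" using level(1)[of n] by linarith
    then have "real n \<le> real (2 ^ level n)" by (simp only: of_nat_le_iff)
    then have "real n \<le> 2 ^ level n" by simp
    then have "ln (real n) \<le> ln (2 ^ level n)" using n by (intro ln_mono) auto
    also have "\<dots> = real (level n) * ln 2" by (rule ln_realpow)
    also have "\<dots> \<le> real (level n) * 1" by (intro mult_left_mono) (use ln_2_less_1 in auto)
    also have "level n \<le> 16 * block_width n" by (simp add: block_width_def)
    then have "real (level n) * 1 \<le> 16 * real (block_width n)" by linarith
    finally have ln: "ln (real n) \<le> 16 * real (block_width n)" .
    have "ln (real n) * real (search_time h n) \<le> 16 * real (block_width n) * real (search_time h n)"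
      using ln by (rule mult_right_mono) simp
    also have "\<dots> = 16 * real (block_width n * search_time h n)" by simp
    also have "real (block_width n * search_time h n) \<le> real (C * n ^ h)"
      using C[of n] n by (simp only: of_nat_le_iff)
    finally have "ln (real n) * real (search_time h n) \<le> 16 * real C * real n ^ h" by simp
    moreover have "0 < ln (real n)" using n by simp
    ultimately show ?thesis by (simp add: field_simps)
  qed
  then show ?thesis by (intro bigoI[of _ "16 * real C"]) (auto simp: eventually_at_top_linorder intro!: exI[of _ 2])
qed

text \<open>The untouched cell 0 of \<open>out\<close> already names the vertex 0.\<close>

definition single_vertex_com :: com where
  "single_vertex_com = Cond (WLe (WConst 1) (Var x_n)) (set0 x_found (WConst 1)) Skip"

theorem theorem1p4:
  fixes H :: "'b graph" and h :: nat
  assumes "simple_graph H" and "card (verts H) = h" and "h \<noteq> 0" and "h \<noteq> 2"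
  shows "\<exists>(c :: com) (k :: nat) (T :: nat \<Rightarrow> real).
           T \<in> O(\<lambda>n. real n ^ h / ln (real n)) \<and>
           (\<forall>(n :: nat) (G :: nat graph) (w :: nat set \<Rightarrow> real).
              simple_graph G \<and> verts G = {..<n} \<longrightarrow>
              (\<exists>t s. exec ((n + 2) ^ k) c (input n G w) t s \<and>
                     real t \<le> T n \<and> output_correct H G w s))"
proof -
  have "finite (verts H)" using assms(1) by (simp add: simple_graph_def)
  then obtain g where g: "bij_betw g {..<h} (verts H)"
    using ex_bij_betw_nat_finite assms(2) lessThan_atLeast0 by metis
  have input: "graph_input H h n G g" if "simple_graph G" "verts G = {..<n}" for n G
    using assms(1) g that by unfold_locales
  show ?thesis
  proof (cases "h = 1")
    case True
    have bigo: "(\<lambda>n. 20) \<in> O(\<lambda>n. real n ^ h / ln (real n))"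
    proof (rule bigoI[of _ 20], rule eventually_mono[OF eventually_ge_at_top[of 2]])
      fix n :: nat assume "2 \<le> n"
      moreover from this have "0 < real n" "0 < ln (real n)" by auto
      moreover from this have "ln (real n) \<le> real n" using ln_less_self[of "real n"] by linarith
      ultimately show "norm (20 :: real) \<le> 20 * norm (real n ^ h / ln (real n))"
        using True by (simp add: field_simps)
    qed
    have "\<exists>t s. exec ((n + 2) ^ 2) single_vertex_com (input n G w) t s \<and> real t \<le> 20 \<and> output_correct H G w s"
      if "simple_graph G" "verts G = {..<n}" for n G w
    proof -
      interpret graph_input H h n G w g by (rule input[OF that])
      let ?s = "input n G w"
      have n: "words ?s x_n 0 = n" "words ?s x_out 0 = 0" "words ?s x_found 0 = 0" "reals ?s x_best 0 = 0"
        by (simp_all add: input_def name_defs)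
      \<comment> \<open>With a single coordinate there are no pairs: every vertex is a copy of
        weight 0, which is also the value of the untouched \<open>x_best\<close>.\<close>
      have pairs: "all_pairs (Suc 0) = []" by (simp add: all_pairs_def)
      have "run ((n + 2) ^ 2) single_vertex_com
          (\<lambda>t s. t \<le> 20 \<and> best_of (good_tuple E h n adj) (tuple_weight h n edge_weight) UNIV s) ?s"
        unfolding single_vertex_com_def
        by (simp add: n best_of_def good_tuple_def tuple_weight_def sum_good_def sum_weight_def pairs True power2_eq_square)
      then show ?thesis using best_output_correct unfolding run_def
        by (metis of_nat_le_iff of_nat_numeral)
    qed
    then show ?thesis using bigo by blast
  next
    case False
    then have h: "3 \<le> h" using assms(3,4) by linarith
    have "\<exists>t s. exec ((n + 2) ^ word_exponent h) (search_com (graph_input.E H g) h) (input n G w) t s \<and>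
        real t \<le> real (search_time h n) \<and> output_correct H G w s"
      if "simple_graph G" "verts G = {..<n}" for n G w
      using run_search[OF input[OF that] h, of w] by (simp only: of_nat_le_iff)
    then show ?thesis using search_time_bigo[OF h] by blast
  qed
qed

end
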